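(* Let $\alpha\in(0,1]$, with $k,k'$ and the sets $\mathscr{L}'_\alpha,\Psi_\alpha,\Psi'_\alpha,\mathscr{C}_\alpha$ as defined in the context. Then we have $$\Omega_\alpha=\mathbb{I}_\alpha\times\Psi_\alpha\ \cup\ \overline{\bigcup_{1\le j<k}\big[T_\alpha^j(\alpha-1),\alpha\big]\times N_{\underline{b}^\alpha_{[1,j]}}\cdot\Psi_\alpha}\ \cup\ \overline{\bigcup_{1\le j<k'}\big[T_\alpha^j(\alpha),\alpha\big]\times N_{\overline{b}^\alpha_{[1,j]}}\cdot\Psi'_\alpha}\,.$$ If $T_\alpha^j(\alpha-1)\notin(x,x')$ for all $0\le j<k$ and $T_\alpha^j(\alpha)\notin(x,x')$ for all $0\le j<k'$, then the density of the invariant measure $\nu_\alpha$ is continuous on $(x,x')$. For any $Y\in\mathscr{C}_\alpha$, the Lebesgue measure of $Y\cap\overline{\bigcup_{Y'\in\mathscr{C}_\alpha\setminus\{Y\}}Y'}$ is zero, and $$\overline{\bigcup_{Y\in\mathscr{C}_\alpha}Y}=\Psi'_\alpha={}^tE\cdot\Psi_\alpha\,.$$ For any $w\in\mathscr{L}'_\alpha$, we have $N_w\cdot\big(0,\tfrac{1}{d_\alpha(\alpha)+1}\big)\cap\overline{\bigcup_{w'\in\mathscr{L}'_\alpha\setminus\{w\}}N_{w'}\cdot\big[0,\tfrac{1}{d_\alpha(\alpha)+1}\big]}=\emptyset$.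
   Context: For $\alpha\in[0,1]$ let $\mathbb{I}_\alpha=[\alpha-1,\alpha]$ and define $T_\alpha:\mathbb{I}_\alpha\to[\alpha-1,\alpha)$ by $T_\alpha(x)=|1/x|-\lfloor |1/x|+1-\alpha\rfloor$ for $x\neq0$ and $T_\alpha(0)=0$. Put $\varepsilon(x)=+1$ if $x\ge0$, $\varepsilon(x)=-1$ if $x<0$, and $d_\alpha(x)=\lfloor|1/x|+1-\alpha\rfloor$ for $x\ne0$, $d_\alpha(0)=\infty$. For $n\ge1$ set $\underline{b}^\alpha_n=(\varepsilon(y):d_\alpha(y))$ with $y=T_\alpha^{n-1}(\alpha-1)$ and $\overline{b}^\alpha_n=(\varepsilon(z):d_\alpha(z))$ with $z=T_\alpha^{n-1}(\alpha)$. The planar map is $\mathcal{T}_\alpha(x,y)=\big(T_\alpha(x),\frac{1}{d_\alpha(x)+\varepsilon(x)y}\big)$ for $x\in\mathbb{I}_\alpha$, $y\in[0,1]$ (second coordinate $0$ when $x=0$). For $\alpha\in(0,1]$, $\Omega_\alpha=\overline{\{\mathcal{T}_\alpha^n(x,0)\mid x\in[\alpha-1,\alpha),\ n\ge0\}}$. With $d\mu=\frac{dx\,dy}{(1+xy)^2}$ one has $0<\mu(\Omega_\alpha)<\infty$; $\mu_\alpha$ is $\mu$ normalized to a probability measure on $\Omega_\alpha$, and $\nu_\alpha$ is its marginal on $\mathbb{I}_\alpha$ (image under projection to the first coordinate). Words. $\mathscr{A}_-=\{(-1:d)\mid d\in\mathbb{Z},d\ge2\}$, $\mathscr{A}_+=\{(+1:d)\mid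 d\in\mathbb{Z},d\ge1\}$, $\mathscr{A}=\mathscr{A}_-\cup\mathscr{A}_+$; the order on letters is $(\varepsilon:d)\preceq(\varepsilon':d')$ iff $\varepsilon/d\le\varepsilon'/d'$ (with $\prec$ its strict version; $1/\infty=0$). $V^*$ is the set of finite concatenations (including the empty word) of elements of $V$; products of sets of words are sets of concatenations; $|v|$ is the length; $w_{[m,n]}=w_m\cdots w_n$, $w_{[m,n)}=w_m\cdots w_{n-1}$ (empty when the index range is empty); $v^\omega=vvv\cdots$. ${}^{(W)}(\varepsilon:d)=(-\varepsilon:d+\varepsilon)$ for $d<\infty$. For finite nonempty $v$, $v^{(+1)}$ is $v$ with last letter $(\varepsilon:d)$ replaced by $(\varepsilon:d+1)$. $\llbracket(\varepsilon_1:d_1)(\varepsilon_2:d_2)\cdots\rrbracket=\dfrac{\varepsilon_1}{d_1+\dfrac{\varepsilon_2}{d_2+\cdots}}$. Matrices act by Möbius transformations. $N_{(\varepsilon:d)}=(-\varepsilon)\begin{pmatrix}0&1\\ \varepsilon&d\end{pmatrix}$, so $N_{(\varepsilon:d)}\cdot y=\frac1{d+\varepsilon y}$; for $w=w_1\cdots w_n\in\mathscr{A}^*$, $N_w=N_{w_n}\cdots N_{w_1}$ (the identity for the empty word). $E=\begin{pmatrix}1&-1\\0&1\end{pmatrix}$, with transpose ${}^tE$, so ${}^tE\cdot y=\frac{y}{1-y}$. The characteristic sequence of $v\in\mathscr{A}_-^*$ is $a_1\cdots a_{2\ell+1}$, where $\ell\ge0$ and $a_j\ge1$ are the integers with $v=(-1:2)^{a_1-1}(-1:2+a_2)(-1:2)^{a_3-1}\cdots(-1:2+a_{2\ell})(-1:2)^{a_{2\ell+1}-1}$,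 and $\widehat v=(-1:2+a_1)(-1:2)^{a_2-1}(-1:2+a_3)\cdots(-1:2)^{a_{2\ell}-1}(-1:2+a_{2\ell+1})$. Alternating order on integer words of equal length: $a<_{\mathrm{alt}}a'$ iff for some $j\ge0$, $a_{[1,j]}=a'_{[1,j]}$ and $(-1)^ja_{j+1}<(-1)^ja'_{j+1}$; $\le_{\mathrm{alt}}$ means $<_{\mathrm{alt}}$ or $=$. $\mathscr{F}$ is the set of $v\in\mathscr{A}_-^*$ whose characteristic sequence $a_{[1,2\ell+1]}$ satisfies $a_{[2j,2\ell+1]}<_{\mathrm{alt}}a_{[1,2\ell-2j+2]}$ and $a_{[2j+1,2\ell+1]}\le_{\mathrm{alt}}a_{[1,2\ell-2j+1]}$ for all $1\le j\le\ell$. For $v\in\mathscr{F}$: $\Gamma_v=(\zeta_v,\eta_v)$ with $\zeta_v=\llbracket(v\widehat v)^\omega\rrbracket+1$, $\eta_v=\llbracket(v^{(+1)})^\omega\rrbracket+1$ if $|v|\ge1$, and $\Gamma_v=(g,1]$ with $g=(\sqrt5-1)/2$ if $v$ is empty. $\Gamma=\{\alpha\in(0,1]\mid T_\alpha^n(\alpha-1)\ge0\text{ or }T_\alpha^n(\alpha)\ge0\text{ for some }n\ge1\}$, which is the disjoint union of the $\Gamma_v$, $v\in\mathscr{F}$. Set $k=|v|+1$, $k'=|\widehat v|+1$ if $\alpha\in\Gamma_v$, $v\in\mathscr{F}$, and $k=k'=\infty$ if $\alpha\in(0,1]\setminus\Gamma$. Define $U_{\alpha,1}=\{\underline{b}^\alpha_{[1,j]}\mid0\le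 j<k\}$, $U_{\alpha,2}=\{\overline{b}^\alpha_{[1,j]}\mid1\le j<k'\}$, $U_{\alpha,3}=\{\underline{b}^\alpha_{[1,j)}a\mid1\le j<k,\ a\in\mathscr{A}_-,\ \underline{b}^\alpha_j\prec a\preceq{}^{(W)}\overline{b}^\alpha_1\}$, $U_{\alpha,4}=\{\overline{b}^\alpha_{[1,j)}a\mid2\le j<k',\ a\in\mathscr{A}_-,\ \overline{b}^\alpha_j\prec a\preceq{}^{(W)}\overline{b}^\alpha_1\}$, $\mathscr{L}_\alpha=(U_{\alpha,3}\cup U_{\alpha,1}U_{\alpha,2}^*U_{\alpha,4})^*$, $\mathscr{L}'_\alpha=\mathscr{L}_\alpha U_{\alpha,1}U_{\alpha,2}^*$, $\Psi_\alpha=\overline{\bigcup_{w\in\mathscr{L}_\alpha}N_w\cdot[0,\frac1{d_\alpha(\alpha)+1}]}$, $\Psi'_\alpha=\overline{\bigcup_{w\in\mathscr{L}'_\alpha}N_w\cdot[0,\frac1{d_\alpha(\alpha)+1}]}$, $\mathscr{C}_\alpha=\{\Psi_\alpha\}\cup\{N_{\underline{b}^\alpha_{[1,j]}}\cdot\Psi_\alpha\mid1\le j<k\}\cup\{N_{\overline{b}^\alpha_{[1,j]}}\cdot\Psi'_\alpha\mid1\le j<k'\}$. *)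

theory Defs
  imports "HOL-Analysis.Analysis"
begin

text \<open>A letter \<open>(e, d)\<close> consists of a sign \<open>e \<in> {1, -1}\<close> and a digit; an infinite digit
  occurs only in the letter of the point 0.\<close>

datatype digit = Fin int | Infty

type_synonym letter = "int \<times> digit"

definition alph_neg :: "letter set" where
  "alph_neg = {(-1, Fin d) | d. d \<ge> 2}"

fun letter_val :: "letter \<Rightarrow> real" where
  "letter_val (e, Fin d) = of_int e / of_int d"
| "letter_val (e, Infty) = 0"

definition letter_le :: "letter \<Rightarrow> letter \<Rightarrow> bool" where
  "letter_le a b \<longleftrightarrow> letter_val a \<le> letter_val b"

definition letter_less :: "letter \<Rightarrow> letter \<Rightarrow> bool" where
  "letter_less a b \<longleftrightarrow> letter_val a < letter_val b"

text \<open>The clause for an infinite digit is a dummy: the operation is only meant for finite digits.\<close>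

fun letter_W :: "letter \<Rightarrow> letter" where
  "letter_W (e, Fin d) = (- e, Fin (d + e))"
| "letter_W (e, Infty) = (- e, Infty)"

fun letter_succ :: "letter \<Rightarrow> letter" where
  "letter_succ (e, Fin d) = (e, Fin (d + 1))"
| "letter_succ (e, Infty) = (e, Infty)"

definition word_succ :: "letter list \<Rightarrow> letter list" where
  "word_succ v = butlast v @ [letter_succ (last v)]"

definition conc :: "'a list set \<Rightarrow> 'a list set \<Rightarrow> 'a list set" (infixr "@@" 75) where
  "A @@ B = {u @ v | u v. u \<in> A \<and> v \<in> B}"

definition kstar :: "'a list set \<Rightarrow> 'a list set" where
  "kstar A = concat ` lists A"

text \<open>The factor with indices \<open>m, \<dots>, n\<close>, counted from 1.\<close>

definition factor :: "nat \<Rightarrow> nat \<Rightarrow> 'a list \<Rightarrow> 'a list" where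
  "factor m n w = take (n + 1 - m) (drop (m - 1) w)"

fun cf_fin :: "letter list \<Rightarrow> real" where
  "cf_fin [] = 0"
| "cf_fin ((e, Fin d) # w) = of_int e / (of_int d + cf_fin w)"
| "cf_fin ((e, Infty) # w) = 0"

definition cf_value :: "(nat \<Rightarrow> letter) \<Rightarrow> real" where
  "cf_value s = lim (\<lambda>n. cf_fin (map s [0..<n]))"

definition periodic :: "'a list \<Rightarrow> nat \<Rightarrow> 'a" where
  "periodic v n = v ! (n mod length v)"

definition II :: "real \<Rightarrow> real set" where
  "II \<alpha> = {\<alpha> - 1..\<alpha>}"

definition eps :: "real \<Rightarrow> int" where
  "eps x = (if x \<ge> 0 then 1 else -1)"

text \<open>The integer \<open>d_int \<alpha> x\<close> is the digit of a nonzero \<open>x\<close>; the digit of 0 is infinite.\<close>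

definition d_int :: "real \<Rightarrow> real \<Rightarrow> int" where
  "d_int \<alpha> x = \<lfloor>\<bar>1 / x\<bar> + 1 - \<alpha>\<rfloor>"

definition dig :: "real \<Rightarrow> real \<Rightarrow> digit" where
  "dig \<alpha> x = (if x = 0 then Infty else Fin (d_int \<alpha> x))"

definition T :: "real \<Rightarrow> real \<Rightarrow> real" where
  "T \<alpha> x = (if x = 0 then 0 else \<bar>1 / x\<bar> - of_int (d_int \<alpha> x))"

definition letter_at :: "real \<Rightarrow> real \<Rightarrow> letter" where
  "letter_at \<alpha> x = (eps x, dig \<alpha> x)"

text \<open>Expansions of the left and right end point; these are only used for \<open>n \<ge> 1\<close>.\<close>

definition b_lo :: "real \<Rightarrow> nat \<Rightarrow> letter" where
  "b_lo \<alpha> n = letter_at \<alpha> ((T \<alpha> ^^ (n - 1)) (\<alpha> - 1))"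

definition b_up :: "real \<Rightarrow> nat \<Rightarrow> letter" where
  "b_up \<alpha> n = letter_at \<alpha> ((T \<alpha> ^^ (n - 1)) \<alpha>)"

text \<open>The prefix with indices \<open>1, \<dots>, n\<close>.\<close>

definition prefix1 :: "(nat \<Rightarrow> letter) \<Rightarrow> nat \<Rightarrow> letter list" where
  "prefix1 b n = map b [1..<Suc n]"

definition TT :: "real \<Rightarrow> real \<times> real \<Rightarrow> real \<times> real" where
  "TT \<alpha> = (\<lambda>(x, y). (T \<alpha> x,
     if x = 0 then 0 else 1 / (of_int (d_int \<alpha> x) + of_int (eps x) * y)))"

definition \<Omega> :: "real \<Rightarrow> (real \<times> real) set" where
  "\<Omega> \<alpha> = closure {(TT \<alpha> ^^ n) (x, 0) | n x. x \<in> {\<alpha> - 1..<\<alpha>}}"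

definition \<mu> :: "(real \<times> real) measure" where
  "\<mu> = density lborel (\<lambda>(x, y). ennreal (1 / (1 + x * y)\<^sup>2))"

definition \<mu>_norm :: "real \<Rightarrow> (real \<times> real) measure" where
  "\<mu>_norm \<alpha> = uniform_measure \<mu> (\<Omega> \<alpha>)"

definition \<nu> :: "real \<Rightarrow> real measure" where
  "\<nu> \<alpha> = distr (\<mu>_norm \<alpha>) borel fst"

text \<open>On the point at infinity and on the pole this action is not meaningful (division by zero);
  all sets to which it is applied below stay away from the poles.\<close>

definition mobius_act :: "real^2^2 \<Rightarrow> real \<Rightarrow> real" where
  "mobius_act M y = (M $ 1 $ 1 * y + M $ 1 $ 2) / (M $ 2 $ 1 * y + M $ 2 $ 2)"

text \<open>For an infinite digit the matrix of the limit map \<open>y \<mapsto> 0\<close> is used.\<close>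

fun N_letter :: "letter \<Rightarrow> real^2^2" where
  "N_letter (e, Fin d) =
     (- of_int e) *\<^sub>R vector [vector [0, 1], vector [of_int e, of_int d]]"
| "N_letter (e, Infty) = vector [vector [0, 0], vector [0, 1]]"

fun N :: "letter list \<Rightarrow> real^2^2" where
  "N [] = mat 1"
| "N (a # w) = N w ** N_letter a"

definition E_mat :: "real^2^2" where
  "E_mat = vector [vector [1, -1], vector [0, 1]]"

lemma mobius_act_N_letter:
  assumes "e = 1 \<or> e = -1"
  shows "mobius_act (N_letter (e, Fin d)) y = 1 / (of_int d + of_int e * y)"
  using assms by (auto simp: mobius_act_def divide_simps)

lemma mobius_act_tE: "mobius_act (transpose E_mat) y = y / (1 - y)"
  by (simp add: mobius_act_def E_mat_def transpose_def)

text \<open>In both functions only lists of odd length with positive entries are relevant: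
  \<open>char_word a\<close> is the word with characteristic sequence \<open>a\<close>, and \<open>hat_word a\<close> is its dual,
  in which the roles of odd and even positions are exchanged.\<close>

fun char_word :: "nat list \<Rightarrow> letter list" where
  "char_word [] = []"
| "char_word [a] = replicate (a - 1) (-1, Fin 2)"
| "char_word (a # b # as) =
     replicate (a - 1) (-1, Fin 2) @ (-1, Fin (2 + int b)) # char_word as"

fun hat_word :: "nat list \<Rightarrow> letter list" where
  "hat_word [] = []"
| "hat_word [a] = [(-1, Fin (2 + int a))]"
| "hat_word (a # b # as) =
     (-1, Fin (2 + int a)) # replicate (b - 1) (-1, Fin 2) @ hat_word as"

definition is_char_seq :: "letter list \<Rightarrow> nat list \<Rightarrow> bool" where
  "is_char_seq v a \<longleftrightarrow> odd (length a) \<and> (\<forall>n \<in> set a. n \<ge> 1) \<and> v = char_word a"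

lemma replicate_split:
  fixes x :: 'a assumes "y \<noteq> x" "z \<noteq> x" "replicate m x @ y # u = replicate n x @ z # w"
  shows "m = n \<and> y = z \<and> u = w"
  using assms
proof (induction m arbitrary: n)
  case 0 then show ?case by (cases n) auto
next
  case (Suc m) then show ?case by (cases n) auto
qed

lemma replicate_neq:
  fixes x :: 'a assumes "y \<noteq> x"
  shows "replicate m x @ y # u \<noteq> replicate n x"
  using assms by (metis in_set_conv_decomp in_set_replicate)

lemma char_word_inj:
  "\<lbrakk>odd (length a); odd (length b); \<forall>n\<in>set a. n \<ge> 1; \<forall>n\<in>set b. n \<ge> 1; char_word a = char_word b\<rbrakk> \<Longrightarrow> a = b"
proof (induction a arbitrary: b rule: char_word.induct)
  case 1 then show ?case by simp
next
  case (2 p)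
  then show ?case
  proof (cases b rule: char_word.cases)
    case (3 q r bs)
    with 2 have "r \<ge> 1" by auto
    with 2 3 replicate_neq[of "(-1, Fin (2 + int r))" "(-1, Fin 2)" "q-1" "char_word bs" "p-1"]
    show ?thesis by auto
  next
    case 1 with 2 show ?thesis by simp
  next
    case (2 r)
    with "2.prems" have "length (char_word [p]) = length (char_word [r])" by metis
    with 2 "2.prems" show ?thesis by auto
  qed
next
  case (3 p q as)
  then have q: "q \<ge> 1" "p \<ge> 1" by auto
  show ?case
  proof (cases b rule: char_word.cases)
    case 1 with 3 show ?thesis by simp
  next
    case (2 r)
    with 3 q replicate_neq[of "(-1, Fin (2 + int q))" "(-1, Fin 2)" "p-1" "char_word as" "r-1"]
    show ?thesis by auto
  next
    case b: (3 r s bs)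
    then have "s \<ge> 1" "r \<ge> 1" using 3 by auto
    with "3.prems" b q replicate_split[of "(-1, Fin (2 + int q))" "(-1, Fin 2)" "(-1, Fin (2 + int s))" "p-1" "char_word as" "r-1" "char_word bs"]
    have "p = r" "q = s" "char_word as = char_word bs" by auto
    with 3 b show ?thesis by auto
  qed
qed

lemma ex_char_seq:
  "v \<in> lists alph_neg \<Longrightarrow> \<exists>a. is_char_seq v a"
proof (induction v)
  case Nil show ?case by (rule exI[of _ "[1]"]) (simp add: is_char_seq_def)
next
  case (Cons x v)
  then obtain a where a: "is_char_seq v a" by auto
  from Cons obtain d where d: "x = (-1, Fin d)" "d \<ge> 2" by (auto simp: alph_neg_def)
  from a obtain p as where pas: "a = p # as" by (cases a) (auto simp: is_char_seq_def)
  show ?case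
  proof (cases "d = 2")
    case True
    have "char_word (Suc p # as) = x # char_word (p # as)" if "p \<ge> 1"
      using that True d by (cases as; cases p) auto
    then show ?thesis using a pas by (intro exI[of _ "Suc p # as"]) (auto simp: is_char_seq_def)
  next
    case False
    then show ?thesis using a d by (intro exI[of _ "1 # nat (d - 2) # a"]) (auto simp: is_char_seq_def)
  qed
qed

lemma ex1_char_seq:
  assumes "v \<in> lists alph_neg"
  shows "\<exists>!a. is_char_seq v a"
  using ex_char_seq[OF assms] char_word_inj unfolding is_char_seq_def by blast

text \<open>By \<open>ex1_char_seq\<close>, this is well-defined for words over \<open>alph_neg\<close>.\<close>

definition char_seq :: "letter list \<Rightarrow> nat list" where
  "char_seq v = (THE a. is_char_seq v a)"

definition hat :: "letter list \<Rightarrow> letter list" where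
  "hat v = hat_word (char_seq v)"

definition alt_less :: "nat list \<Rightarrow> nat list \<Rightarrow> bool" where
  "alt_less a a' \<longleftrightarrow> length a = length a' \<and>
     (\<exists>j < length a. take j a = take j a' \<and> (-1)^j * int (a ! j) < (-1)^j * int (a' ! j))"

definition alt_le :: "nat list \<Rightarrow> nat list \<Rightarrow> bool" where
  "alt_le a a' \<longleftrightarrow> alt_less a a' \<or> a = a'"

definition FF :: "letter list set" where
  "FF = {v \<in> lists alph_neg. \<exists>l. length (char_seq v) = 2 * l + 1 \<and>
     (\<forall>j \<in> {1..l}.
        alt_less (factor (2*j) (2*l + 1) (char_seq v)) (factor 1 (2*l + 2 - 2*j) (char_seq v)) \<and>
        alt_le (factor (2*j + 1) (2*l + 1) (char_seq v)) (factor 1 (2*l + 1 - 2*j) (char_seq v)))}"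

definition zeta :: "letter list \<Rightarrow> real" where
  "zeta v = cf_value (periodic (v @ hat v)) + 1"

definition eta :: "letter list \<Rightarrow> real" where
  "eta v = cf_value (periodic (word_succ v)) + 1"

definition Gam_int :: "letter list \<Rightarrow> real set" where
  "Gam_int v = (if v = [] then {(sqrt 5 - 1) / 2<..1} else {zeta v<..<eta v})"

definition Gam :: "real set" where
  "Gam = {\<alpha>. 0 < \<alpha> \<and> \<alpha> \<le> 1 \<and> (\<exists>n \<ge> 1. (T \<alpha> ^^ n) (\<alpha> - 1) \<ge> 0 \<or> (T \<alpha> ^^ n) \<alpha> \<ge> 0)}"

text \<open>As \<open>Gam\<close> is the disjoint union of the intervals \<open>Gam_int v\<close>, \<open>v \<in> FF\<close>, the word
  in the following definition is unique for \<open>\<alpha> \<in> Gam\<close>.\<close>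

definition Gam_word :: "real \<Rightarrow> letter list" where
  "Gam_word \<alpha> = (THE v. v \<in> FF \<and> \<alpha> \<in> Gam_int v)"

definition k_lo :: "real \<Rightarrow> enat" where
  "k_lo \<alpha> = (if \<alpha> \<in> Gam then enat (length (Gam_word \<alpha>) + 1) else \<infinity>)"

definition k_up :: "real \<Rightarrow> enat" where
  "k_up \<alpha> = (if \<alpha> \<in> Gam then enat (length (hat (Gam_word \<alpha>)) + 1) else \<infinity>)"

definition U1 :: "real \<Rightarrow> letter list set" where
  "U1 \<alpha> = {prefix1 (b_lo \<alpha>) j | j. enat j < k_lo \<alpha>}"

definition U2 :: "real \<Rightarrow> letter list set" where
  "U2 \<alpha> = {prefix1 (b_up \<alpha>) j | j. 1 \<le> j \<and> enat j < k_up \<alpha>}"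

definition U3 :: "real \<Rightarrow> letter list set" where
  "U3 \<alpha> = {prefix1 (b_lo \<alpha>) (j - 1) @ [a] | j a. 1 \<le> j \<and> enat j < k_lo \<alpha> \<and> a \<in> alph_neg \<and>
     letter_less (b_lo \<alpha> j) a \<and> letter_le a (letter_W (b_up \<alpha> 1))}"

definition U4 :: "real \<Rightarrow> letter list set" where
  "U4 \<alpha> = {prefix1 (b_up \<alpha>) (j - 1) @ [a] | j a. 2 \<le> j \<and> enat j < k_up \<alpha> \<and> a \<in> alph_neg \<and>
     letter_less (b_up \<alpha> j) a \<and> letter_le a (letter_W (b_up \<alpha> 1))}"

definition LL :: "real \<Rightarrow> letter list set" where
  "LL \<alpha> = kstar (U3 \<alpha> \<union> (U1 \<alpha> @@ kstar (U2 \<alpha>) @@ U4 \<alpha>))"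

definition LL' :: "real \<Rightarrow> letter list set" where
  "LL' \<alpha> = LL \<alpha> @@ U1 \<alpha> @@ kstar (U2 \<alpha>)"

text \<open>For \<open>\<alpha> \<in> (0, 1]\<close> the digit of \<open>\<alpha>\<close> is the finite number \<open>d_int \<alpha> \<alpha>\<close>.\<close>

definition top_end :: "real \<Rightarrow> real" where
  "top_end \<alpha> = 1 / (of_int (d_int \<alpha> \<alpha>) + 1)"

definition \<Psi> :: "real \<Rightarrow> real set" where
  "\<Psi> \<alpha> = closure (\<Union>w \<in> LL \<alpha>. mobius_act (N w) ` {0..top_end \<alpha>})"

definition \<Psi>' :: "real \<Rightarrow> real set" where
  "\<Psi>' \<alpha> = closure (\<Union>w \<in> LL' \<alpha>. mobius_act (N w) ` {0..top_end \<alpha>})"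

definition CC :: "real \<Rightarrow> real set set" where
  "CC \<alpha> = {\<Psi> \<alpha>}
     \<union> {mobius_act (N (prefix1 (b_lo \<alpha>) j)) ` \<Psi> \<alpha> | j. 1 \<le> j \<and> enat j < k_lo \<alpha>}
     \<union> {mobius_act (N (prefix1 (b_up \<alpha>) j)) ` \<Psi>' \<alpha> | j. 1 \<le> j \<and> enat j < k_up \<alpha>}"

end

theory Submission
  imports Defs
begin

text \<open>Write a point \<open>(x, y)\<close> with \<open>x < 0\<close> as \<open>(u, z) = (x + 1, y / (1 - y))\<close>, and put \<open>(u, z) = (x, y)\<close>
  otherwise. In these coordinates, from a point with \<open>u < \<alpha>\<close> the planar map is one step of the natural extension of
  the Gauss map \<open>G\<close>; from a point with \<open>u \<ge> \<alpha>\<close> some iterate of it is two steps. So two orbits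
  within one orbit of the natural extension merge after any point with \<open>u < \<alpha>\<close>.
  This shows that the strips over \<open>[0, top_end \<alpha>]\<close> are filled, that a generic point lies in one
  cell only, and, on changing a last letter \<open>(-1, d)\<close> to \<open>(-1, d - 1)\<close>, that \<open>\<Psi>' \<alpha>\<close> is the image of
  \<open>\<Psi> \<alpha>\<close> under the transpose of \<open>E\<close>. The limit points outside the open cells form a null set
  because, by bounded distortion, the cells at each level occupy a fixed proportion of what remains.

  The parameter \<open>\<alpha>\<close> is outside \<open>Gam\<close> iff \<open>G\<^sup>n \<alpha> \<ge> \<alpha>\<close> for all \<open>n\<close>. For \<open>\<alpha>\<close> in the interval of a
  word \<open>v\<close>, the languages depend on \<open>v\<close> only, so the statements about the fibres may be proved for
  the rational number of the interval at which both endpoint orbits end in \<open>0\<close>.\<close>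

subsection \<open>Words and their inverse branches\<close>

text \<open>Two thresholds shape the argument. On the side of the past,
  \<open>top_end \<alpha>\<close> = 1/(D+1): the letters \<open>(-1, d)\<close> with d <= D+1 and
  \<open>(1, D)\<close> send [0,1] to the right of it, all others send [0,1] into
  [0, \<open>top_end \<alpha>\<close>]. At any other letter the past may be forgotten, so finitely
  many letters are recorded. On the side of the future, -\<open>kap\<close> = 1/(1+\<alpha>) - 1 has
  digit D+1 and the same image under T as \<alpha>; the endpoint orbits are followed as long as they
  stay at or left of it.

  The obstacle is the last recorded endpoint. It is right of -\<open>kap\<close> but may be
  negative, and points of its interval can then still use \<open>(-1, D+1)\<close>, which the
  automaton does not read there. If the last endpoint is 0, as at the rational parameter, the
  automaton is complete. The fibres are settled there, including the relation by E, and transferred;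
  at the original parameter that relation yields the symmetry y -> 1 - y, which trades
  \<open>(-1, D+1)\<close> for \<open>(1, D)\<close>. Boundary cases are avoided by working with
  irrational first coordinates and closing up at the end.\<close>

definition proper_letters :: "letter set" where
  "proper_letters = {(-1, Fin d) | d. d \<ge> 2} \<union> {(1, Fin d) | d. d \<ge> 1}"

fun bwd_letter :: "letter \<Rightarrow> real \<Rightarrow> real" where
  "bwd_letter (e, Fin d) y = 1 / (of_int d + of_int e * y)"
| "bwd_letter (e, Infty) y = 0"

text \<open>The newest letter is applied last, as in \<open>N\<close>. On [0,1] this replaces the
  matrices; \<open>fwd\<close> below is the inverse branch in the first coordinate, which nests in
  the opposite order.\<close>

fun bwd :: "letter list \<Rightarrow> real \<Rightarrow> real" where
  "bwd [] y = y"
| "bwd (a # w) y = bwd w (bwd_letter a y)"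

fun fwd :: "letter list \<Rightarrow> real \<Rightarrow> real" where
  "fwd [] x = x"
| "fwd ((e, Fin d) # w) x = of_int e / (of_int d + fwd w x)"
| "fwd ((e, Infty) # w) x = 0"

definition itin :: "real \<Rightarrow> real \<Rightarrow> nat \<Rightarrow> letter list" where
  "itin \<alpha> x n = map (\<lambda>i. letter_at \<alpha> ((T \<alpha> ^^ i) x)) [0..<n]"

lemma cf_fin_eq_fwd: "cf_fin w = fwd w 0"
  by (induction w rule: cf_fin.induct) auto

lemma bwd_append: "bwd (u @ v) y = bwd v (bwd u y)"
  by (induction u arbitrary: y) auto

lemma fwd_append: "fwd (u @ v) x = fwd u (fwd v x)"
  by (induction u x rule: fwd.induct) auto

lemma itin_0 [simp]: "itin \<alpha> x 0 = []"
  by (simp add: itin_def)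

lemma length_itin [simp]: "length (itin \<alpha> x n) = n"
  by (simp add: itin_def)

lemma itin_Suc: "itin \<alpha> x (Suc n) = itin \<alpha> x n @ [letter_at \<alpha> ((T \<alpha> ^^ n) x)]"
  by (simp add: itin_def)

lemma itin_add: "itin \<alpha> x (m + n) = itin \<alpha> x m @ itin \<alpha> ((T \<alpha> ^^ m) x) n"
proof (induction n)
  case (Suc n)
  have "(T \<alpha> ^^ (m + n)) x = (T \<alpha> ^^ n) ((T \<alpha> ^^ m) x)"
    by (metis add.commute comp_apply funpow_add)
  with Suc show ?case by (simp add: itin_Suc)
qed simp

lemma itin_Suc': "itin \<alpha> x (Suc n) = letter_at \<alpha> x # itin \<alpha> (T \<alpha> x) n"
  using itin_add[of \<alpha> x 1 n] by (simp add: itin_def)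

lemma itin_drop: "m \<le> n \<Longrightarrow> drop m (itin \<alpha> x n) = itin \<alpha> ((T \<alpha> ^^ m) x) (n - m)"
  using itin_add[of \<alpha> x m "n - m"] by simp

lemma itin_nth: "i < n \<Longrightarrow> itin \<alpha> x n ! i = letter_at \<alpha> ((T \<alpha> ^^ i) x)"
  by (simp add: itin_def)

lemma prefix1_b_lo: "prefix1 (b_lo \<alpha>) n = itin \<alpha> (\<alpha> - 1) n"
  by (rule nth_equalityI) (auto simp: prefix1_def itin_def b_lo_def nth_append simp del: upt_Suc)

lemma prefix1_b_up: "prefix1 (b_up \<alpha>) n = itin \<alpha> \<alpha> n"
  by (rule nth_equalityI) (auto simp: prefix1_def itin_def b_up_def nth_append simp del: upt_Suc)

lemma TT_eq: "TT \<alpha> (x, y) = (T \<alpha> x, bwd_letter (letter_at \<alpha> x) y)"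
  by (simp add: TT_def letter_at_def dig_def)

lemma TT_pow: "(TT \<alpha> ^^ n) (x, y) = ((T \<alpha> ^^ n) x, bwd (itin \<alpha> x n) y)"
proof (induction n)
  case (Suc n)
  then show ?case by (simp add: TT_eq itin_Suc bwd_append)
qed simp

text \<open>The window [\<alpha> - 1, \<alpha>) has length one, so d is the only integer that brings
  |1/x| into it. Orbits are computed below by exhibiting x in this form instead of evaluating
  floors.\<close>

lemma T_inverse_branch:
  assumes "e = 1 \<or> e = -1" "of_int d + x' > 0" "\<alpha> - 1 \<le> x'" "x' < \<alpha>" "x = of_int e / (of_int d + x')"
  shows "letter_at \<alpha> x = (e, Fin d)" "T \<alpha> x = x'"
proof -
  have x: "x \<noteq> 0" using assms by auto
  have abs: "\<bar>1 / x\<bar> = of_int d + x'" using assms by (auto simp: abs_if)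
  have d: "d_int \<alpha> x = d"
    unfolding d_int_def abs by (rule floor_unique) (use assms in auto)
  have "eps x = e" using assms by (auto simp: eps_def)
  then show "letter_at \<alpha> x = (e, Fin d)" using d x by (simp add: letter_at_def dig_def)
  show "T \<alpha> x = x'" using x d abs by (simp add: T_def)
qed

lemma T_range: "x \<noteq> 0 \<Longrightarrow> T \<alpha> x \<in> {\<alpha> - 1..<\<alpha>}"
  by (simp add: T_def d_int_def) linarith

lemma letter_at_inverse:
  assumes "x \<noteq> 0"
  obtains e d where "letter_at \<alpha> x = (e, Fin d)" "e = 1 \<or> e = -1" "x = of_int e / (of_int d + T \<alpha> x)"
    "of_int d + T \<alpha> x > 0" "of_int d + T \<alpha> x = 1 / \<bar>x\<bar>" "e = (if x > 0 then 1 else -1)"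
proof
  show "letter_at \<alpha> x = (eps x, Fin (d_int \<alpha> x))"
    using assms by (simp add: letter_at_def dig_def)
qed (use assms in \<open>auto simp: eps_def T_def\<close>)

section \<open>Digits on either side of the threshold -\<open>kap\<close>\<close>

locale alpha_expansion =
  fixes \<alpha> :: real
  assumes alpha_pos: "0 < \<alpha>" and alpha_le_1: "\<alpha> \<le> 1"
begin

abbreviation "D \<equiv> d_int \<alpha> \<alpha>"

definition kap :: real where "kap = \<alpha> / (1 + \<alpha>)"

lemma D_bounds: "of_int D + \<alpha> - 1 \<le> 1 / \<alpha>" "1 / \<alpha> < of_int D + \<alpha>"
  using alpha_pos by (simp_all add: d_int_def) linarith+

lemma D_ge_1: "D \<ge> 1"
proof -
  have "1 / \<alpha> \<ge> 1" using alpha_pos alpha_le_1 by simp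
  then show ?thesis using D_bounds alpha_le_1 by linarith
qed

lemma letter_alpha: "letter_at \<alpha> \<alpha> = (1, Fin D)"
  using alpha_pos by (simp add: letter_at_def dig_def eps_def)

lemma T_alpha: "T \<alpha> \<alpha> = 1 / \<alpha> - of_int D"
  using alpha_pos by (simp add: T_def)

lemma top_end_eq: "top_end \<alpha> = 1 / (of_int D + 1)"
  by (simp add: top_end_def)

lemma top_end_bounds: "0 < top_end \<alpha>" "top_end \<alpha> \<le> 1/2" "top_end \<alpha> < \<alpha>"
proof -
  show "0 < top_end \<alpha>" "top_end \<alpha> \<le> 1/2" using D_ge_1 by (auto simp: top_end_eq)
  have "1 < (of_int D + \<alpha>) * \<alpha>" using D_bounds(2) alpha_pos by (simp add: divide_simps)
  also have "\<dots> \<le> (of_int D + 1) * \<alpha>" using alpha_pos alpha_le_1 by simp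
  finally show "top_end \<alpha> < \<alpha>" using D_ge_1 by (simp add: top_end_eq divide_simps mult.commute)
qed

lemma kap_bounds: "0 < kap" "kap \<le> 1/2" "1 / kap = 1 + 1 / \<alpha>"
  using alpha_pos alpha_le_1 by (auto simp: kap_def field_simps)

lemma letter_pos:
  assumes "0 < x" "x \<le> \<alpha>"
  obtains d where "letter_at \<alpha> x = (1, Fin d)" "d \<ge> D" "T \<alpha> x = 1 / x - of_int d"
proof -
  have le: "1 / x \<ge> 1 / \<alpha>" using assms by (simp add: frac_le)
  have d: "d_int \<alpha> x \<ge> D" unfolding d_int_def
    by (rule floor_mono) (use le assms alpha_pos in auto)
  show ?thesis by (rule that[of "d_int \<alpha> x"]) (use assms d in \<open>auto simp: letter_at_def dig_def eps_def T_def\<close>)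
qed

lemma letter_neg:
  assumes "\<alpha> - 1 \<le> x" "x < 0"
  obtains d where "letter_at \<alpha> x = (-1, Fin d)" "d \<ge> 2" "T \<alpha> x = - 1 / x - of_int d"
proof -
  have a: "\<alpha> < 1" using assms by simp
  have "1 / (1 - \<alpha>) \<le> 1 / (- x)" using assms a by (intro frac_le) auto
  moreover have "1 / (1 - \<alpha>) \<ge> 1 + \<alpha>"
    using a alpha_pos by (simp add: field_simps)
  ultimately have "1 / (- x) \<ge> 1 + \<alpha>" by linarith
  then have "d_int \<alpha> x \<ge> 2" unfolding d_int_def
    using assms by (simp add: le_floor_iff abs_if)
  then show ?thesis by (intro that[of "d_int \<alpha> x"]) (use assms in \<open>auto simp: letter_at_def dig_def eps_def T_def\<close>)
qed

lemma letter_neg_big: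
  assumes "\<alpha> - 1 \<le> x" "x \<le> - kap"
  obtains d where "letter_at \<alpha> x = (-1, Fin d)" "2 \<le> d" "d \<le> D + 1" "T \<alpha> x = - 1 / x - of_int d"
proof -
  from assms kap_bounds have x: "x < 0" by linarith
  from letter_neg[OF assms(1) x] obtain d where d: "letter_at \<alpha> x = (-1, Fin d)" "d \<ge> 2" "T \<alpha> x = - 1 / x - of_int d" .
  have "1 / (-x) \<le> 1 / kap" using assms kap_bounds x by (intro frac_le) auto
  then have "-1 / x < 1 + of_int D + \<alpha>" using D_bounds kap_bounds by simp
  moreover have "T \<alpha> x \<ge> \<alpha> - 1" using T_range[of x \<alpha>] x by auto
  ultimately have "d < D + 2" using d by linarith
  with d that show ?thesis by auto
qed

text \<open>For d = D+1 the last conclusion reads T x > 1/\<alpha> - D = T \<alpha>: right of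
  -\<open>kap\<close> the letter \<open>(-1, D + 1)\<close> only reaches points that
  \<open>(1, D)\<close> reaches as well.\<close>

lemma letter_neg_small:
  assumes "\<alpha> - 1 \<le> x" "- kap < x" "x < 0"
  obtains d where "letter_at \<alpha> x = (-1, Fin d)" "D + 1 \<le> d" "T \<alpha> x = - 1 / x - of_int d" "T \<alpha> x > 1 / \<alpha> + 1 - of_int d"
proof -
  from letter_neg[OF assms(1,3)] obtain d where d: "letter_at \<alpha> x = (-1, Fin d)" "d \<ge> 2" "T \<alpha> x = - 1 / x - of_int d" .
  have "1 / (-x) > 1 / kap" using assms kap_bounds by (intro frac_less2) auto
  then have b: "-1 / x > 1 + 1 / \<alpha>" using kap_bounds by simp
  moreover have "T \<alpha> x < \<alpha>" using T_range[of x \<alpha>] assms by auto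
  ultimately have "d > D" using d D_bounds by linarith
  with d b that show ?thesis by auto
qed

lemma T_pow_range:
  assumes "x \<in> {\<alpha> - 1..<\<alpha>}"
  shows "(T \<alpha> ^^ n) x \<in> {\<alpha> - 1..<\<alpha>}"
proof (induction n)
  case (Suc n)
  have "T \<alpha> 0 = 0" by (simp add: T_def)
  then show ?case using T_range[of "(T \<alpha> ^^ n) x" \<alpha>] alpha_pos alpha_le_1
    by (cases "(T \<alpha> ^^ n) x = 0") auto
qed (use assms in simp)

end

lemma bwd_letter_range:
  assumes "a \<in> proper_letters" "0 \<le> y" "y \<le> 1"
  shows "bwd_letter a y \<in> {0..1}" "bwd_letter a y > 0"
  using assms by (auto simp: proper_letters_def)

lemma bwd_range:
  assumes "w \<in> lists proper_letters" "y \<in> {0..1}"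
  shows "bwd w y \<in> {0..1}"
  using assms(1,2)
proof (induction arbitrary: y)
  case (Cons a w)
  from bwd_letter_range(1)[of a y] Cons show ?case by auto
qed simp

text \<open>Only the inner denominator has to be nonzero: at a pole of M both sides are a division
  by 0 and agree.\<close>

lemma mobius_act_mult:
  assumes "A $ 2 $ 1 * y + A $ 2 $ 2 \<noteq> 0"
  shows "mobius_act (M ** A) y = mobius_act M (mobius_act A y)"
proof -
  define s where "s = A $ 2 $ 1 * y + A $ 2 $ 2"
  define r where "r = A $ 1 $ 1 * y + A $ 1 $ 2"
  have s: "s \<noteq> 0" using assms s_def by simp
  have "mobius_act (M ** A) y = (M $ 1 $ 1 * r + M $ 1 $ 2 * s) / (M $ 2 $ 1 * r + M $ 2 $ 2 * s)"
    by (simp add: mobius_act_def matrix_matrix_mult_def sum_2 r_def s_def algebra_simps)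
  also have "M $ 1 $ 1 * r + M $ 1 $ 2 * s = s * (M $ 1 $ 1 * (r / s) + M $ 1 $ 2)"
    using s by (simp add: distrib_left)
  also have "M $ 2 $ 1 * r + M $ 2 $ 2 * s = s * (M $ 2 $ 1 * (r / s) + M $ 2 $ 2)"
    using s by (simp add: distrib_left)
  also have "s * (M $ 1 $ 1 * (r / s) + M $ 1 $ 2) / (s * (M $ 2 $ 1 * (r / s) + M $ 2 $ 2))
    = mobius_act M (mobius_act A y)"
    using s by (simp add: mobius_act_def r_def s_def)
  finally show ?thesis .
qed

lemma mobius_act_N_eq_bwd:
  assumes "w \<in> lists proper_letters" "y \<in> {0..1}"
  shows "mobius_act (N w) y = bwd w y"
  using assms(1,2)
proof (induction arbitrary: y)
  case Nil
  then show ?case by (simp add: mobius_act_def mat_def)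
next
  case (Cons a w)
  obtain e d where a: "a = (e, Fin d)" "e = 1 \<and> d \<ge> 1 \<or> e = -1 \<and> d \<ge> 2"
    using Cons by (auto simp: proper_letters_def)
  have "N_letter a $ 2 $ 1 * y + N_letter a $ 2 $ 2 = - of_int e * (of_int e * y + of_int d)"
    using a by (simp add: algebra_simps)
  also have "\<dots> \<noteq> 0" using a Cons.prems by auto
  finally have "mobius_act (N w ** N_letter a) y = mobius_act (N w) (mobius_act (N_letter a) y)"
    by (rule mobius_act_mult)
  moreover have "mobius_act (N_letter a) y = bwd_letter a y"
    using a mobius_act_N_letter[of e d y] by auto
  moreover have "bwd_letter a y \<in> {0..1}"
    using bwd_letter_range[of a y] Cons by auto
  ultimately show ?case using Cons.IH by simp
qed

subsection \<open>Gauss coordinates\<close>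

definition gauss :: "real \<Rightarrow> real" where
  "gauss u = frac (1 / u)"

definition gauss2 :: "real \<times> real \<Rightarrow> real \<times> real" where
  "gauss2 = (\<lambda>(u, z). (gauss u, 1 / (of_int \<lfloor>1 / u\<rfloor> + z)))"

lemma gauss_rep: "1 / u = of_int \<lfloor>1 / u\<rfloor> + gauss u" "u = 1 / (of_int \<lfloor>1 / u\<rfloor> + gauss u)"
proof -
  show *: "1 / u = of_int \<lfloor>1 / u\<rfloor> + gauss u" by (simp add: gauss_def frac_def)
  show "u = 1 / (of_int \<lfloor>1 / u\<rfloor> + gauss u)" by (simp flip: *)
qed

lemma gauss_range: "0 \<le> gauss u" "gauss u < 1"
  by (auto simp: gauss_def frac_lt_1)

lemma gauss_digit_ge_1: "0 < u \<Longrightarrow> u \<le> 1 \<Longrightarrow> \<lfloor>1 / u\<rfloor> \<ge> 1"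
  by (simp add: le_floor_iff)

lemma gauss_inverse_branch:
  assumes "0 \<le> s" "s < 1" "u = 1 / (of_int c + s)"
  shows "\<lfloor>1 / u\<rfloor> = c" "gauss u = s"
proof -
  show c: "\<lfloor>1 / u\<rfloor> = c" using assms by (intro floor_unique) auto
  show "gauss u = s" using gauss_rep(1)[of u] c assms by simp
qed

lemma Rats_one_divide_iff: "1 / x \<in> \<rat> \<longleftrightarrow> x \<in> \<rat>" for x :: real
  by (metis Rats_1 Rats_divide divide_divide_eq_right div_by_1 mult_1)

lemma Rats_add_int_iff: "of_int c + x \<in> \<rat> \<longleftrightarrow> x \<in> \<rat>" for x :: real
  by (metis Rats_add Rats_diff Rats_of_int add_diff_cancel_left')

lemma gauss_Rats_iff: "gauss u \<in> \<rat> \<longleftrightarrow> u \<in> \<rat>"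
  by (metis Rats_add_int_iff Rats_one_divide_iff gauss_rep(1))

lemma gauss_pos: "u \<notin> \<rat> \<Longrightarrow> gauss u > 0"
  using gauss_range(1)[of u] gauss_Rats_iff[of u] by (metis Rats_0 less_eq_real_def)

lemma gauss2_range:
  assumes "u \<in> {0<..1}" "z \<in> {0..1}"
  shows "snd (gauss2 (u, z)) \<in> {0..1}" "fst (gauss2 (u, z)) \<in> {0..<1}" "snd (gauss2 (u, z)) > 0"
proof -
  define c where "c = \<lfloor>1 / u\<rfloor>"
  have "c \<ge> 1" unfolding c_def by (rule gauss_digit_ge_1) (use assms in auto)
  then have "1 \<le> of_int c + z" using assms by auto
  then show "snd (gauss2 (u, z)) \<in> {0..1}" "fst (gauss2 (u, z)) \<in> {0..<1}" "snd (gauss2 (u, z)) > 0"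
    using gauss_range[of u] by (auto simp: gauss2_def simp flip: c_def)
qed

lemma gauss2_range_open:
  assumes "u \<in> {0<..<1}" "u \<notin> \<rat>" "z \<in> {0<..<1}"
  shows "fst (gauss2 (u, z)) \<in> {0<..<1}" "fst (gauss2 (u, z)) \<notin> \<rat>" "snd (gauss2 (u, z)) \<in> {0<..<1}"
proof -
  define c where "c = \<lfloor>1 / u\<rfloor>"
  have "c \<ge> 1" unfolding c_def by (rule gauss_digit_ge_1) (use assms in auto)
  then have "1 < of_int c + z" using assms by auto
  then show "fst (gauss2 (u, z)) \<in> {0<..<1}" "fst (gauss2 (u, z)) \<notin> \<rat>" "snd (gauss2 (u, z)) \<in> {0<..<1}"
    using gauss_range[of u] gauss_pos[of u] assms by (auto simp: gauss2_def gauss_Rats_iff simp flip: c_def)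
qed

definition cusp_free :: "(real \<times> real) set" where
  "cusp_free = {(u, z). u \<in> {0<..<1} \<and> u \<notin> \<rat> \<and> z \<in> {0<..<1}}"

lemma gauss2_pow_cusp_free: "p \<in> cusp_free \<Longrightarrow> (gauss2 ^^ n) p \<in> cusp_free"
proof (induction n)
  case (Suc n)
  obtain u z where "(gauss2 ^^ n) p = (u, z)" by force
  with Suc gauss2_range_open[of u z] show ?case
    by (cases "gauss2 (u, z)") (auto simp: cusp_free_def)
qed simp

text \<open>As 0 < z < 1, the floor of the reciprocal of the new second coordinate is the digit just
  removed from u, so the step can be undone.\<close>

lemma gauss2_inj_on: "inj_on gauss2 cusp_free"
proof (rule inj_onI)
  fix p q assume p: "p \<in> cusp_free" and q: "q \<in> cusp_free" and eq: "gauss2 p = gauss2 q"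
  obtain u z u' z' where pq: "p = (u, z)" "q = (u', z')" by force
  have z: "0 < z" "z < 1" "0 < z'" "z' < 1" using p q pq by (auto simp: cusp_free_def)
  have "1 / (of_int \<lfloor>1 / u\<rfloor> + z) = 1 / (of_int \<lfloor>1 / u'\<rfloor> + z')" and g: "gauss u = gauss u'"
    using eq pq by (auto simp: gauss2_def)
  then have *: "of_int \<lfloor>1 / u\<rfloor> + z = of_int \<lfloor>1 / u'\<rfloor> + z'" by simp
  have "\<lfloor>of_int \<lfloor>1 / u\<rfloor> + z\<rfloor> = \<lfloor>1 / u\<rfloor>" "\<lfloor>of_int \<lfloor>1 / u'\<rfloor> + z'\<rfloor> = \<lfloor>1 / u'\<rfloor>"
    using z by (auto intro!: floor_unique)
  with * have c: "\<lfloor>1 / u\<rfloor> = \<lfloor>1 / u'\<rfloor>" by simp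
  have "u = u'" using c g gauss_rep(2) by metis
  with * c pq show "p = q" by simp
qed

lemma gauss2_pow_inj:
  assumes "p \<in> cusp_free" "q \<in> cusp_free" "(gauss2 ^^ n) p = (gauss2 ^^ n) q"
  shows "p = q"
  using assms(3)
proof (induction n)
  case (Suc n)
  then show ?case
    using inj_onD[OF gauss2_inj_on _ gauss2_pow_cusp_free[OF assms(1), of n] gauss2_pow_cusp_free[OF assms(2), of n]]
    by simp
qed simp

context alpha_expansion
begin

text \<open>The inverse passage from Gauss coordinates: a negative \<open>x\<close> corresponds to \<open>u = x + 1\<close>, with the
  second coordinate changed to \<open>z = y / (1 - y)\<close>.\<close>

definition fold_pt :: "real \<times> real \<Rightarrow> real \<times> real" where
  "fold_pt = (\<lambda>(u, z). if u < \<alpha> then (u, z) else (u - 1, z / (1 + z)))"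

lemma TT_inverse_branch:
  assumes "e = 1 \<or> e = -1" "of_int d + x' > 0" "\<alpha> - 1 \<le> x'" "x' < \<alpha>" "x = of_int e / (of_int d + x')"
  shows "TT \<alpha> (x, y) = (x', 1 / (of_int d + of_int e * y))"
  using T_inverse_branch[OF assms] by (simp add: TT_eq)

text \<open>If s >= \<alpha>, the window raises the digit to c+1 and the image is s - 1. In the
  second coordinate 1/(c+1+y) = w/(1+w) with w = 1/(c+y), which is the change built into
  \<open>fold_pt\<close>.\<close>

lemma fold_branch:
  assumes "0 \<le> s" "s < 1" "c + y > 0" "c + s > 0"
    "x = 1 / (of_int c + s)"
  shows "TT \<alpha> (x, y) = fold_pt (s, 1 / (of_int c + y))"
proof (cases "s < \<alpha>")
  case True
  then show ?thesis using assms alpha_pos alpha_le_1 TT_inverse_branch[of 1 c s x y]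
    by (simp add: fold_pt_def)
next
  case False
  have "TT \<alpha> (x, y) = (s - 1, 1 / (of_int (c + 1) + of_int 1 * y))"
    by (rule TT_inverse_branch) (use assms False alpha_pos alpha_le_1 in auto)
  also have "1 / (of_int (c + 1) + of_int 1 * y) = (1 / (c + y)) / (1 + 1 / (c + y))"
    using assms(3) by (simp add: field_simps)
  finally show ?thesis using False by (simp add: fold_pt_def)
qed

lemma TT_fold_below:
  assumes "0 < u" "u < \<alpha>" "0 \<le> z"
  shows "TT \<alpha> (u, z) = fold_pt (gauss2 (u, z))"
proof -
  have c: "\<lfloor>1 / u\<rfloor> \<ge> 1" using assms alpha_le_1 by (intro gauss_digit_ge_1) auto
  show ?thesis
    using fold_branch[of "gauss u" "\<lfloor>1 / u\<rfloor>" z u] gauss_range[of u] gauss_rep(2)[of u] c assms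
    by (simp add: gauss2_def)
qed

text \<open>As long as c > 1 the letter is \<open>(-1, 2)\<close>; it lowers c by one and adds 1 to
  z. At c = 1 the letter is \<open>(-1, b + 1)\<close> or \<open>(-1, b + 2)\<close>, with b the
  first digit of s, according to whether G s is below \<alpha>. So c steps of \<open>TT\<close>
  perform the two Gauss steps with digits c and b.\<close>

lemma TT_fold_above_aux:
  assumes "c \<ge> 1" "0 < s" "s < 1" "\<alpha> \<le> 1 / (real c + s)" "0 \<le> z"
  shows "(TT \<alpha> ^^ c) (1 / (real c + s) - 1, z / (1 + z)) = fold_pt (gauss2 (s, 1 / (real c + z)))
    \<and> (\<forall>i<c. fst ((TT \<alpha> ^^ i) (1 / (real c + s) - 1, z / (1 + z))) < 0)"
  using assms
proof (induction c arbitrary: z rule: dec_induct)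
  case base
  have *: "1 / (1 + s) - 1 = of_int (-1) / (1 + 1 / s)" using base by (simp add: field_simps)
  define b where "b = \<lfloor>1 / s\<rfloor>"
  have b: "b \<ge> 1" unfolding b_def by (rule gauss_digit_ge_1) (use base in auto)
  have s: "1 / s = of_int b + gauss s" using gauss_rep(1)[of s] by (simp add: b_def)
  have z: "1 + z > 0" using base by simp
  have "TT \<alpha> (1 / (1 + s) - 1, z / (1 + z)) = fold_pt (gauss s, 1 / (of_int b + 1 / (1 + z)))"
  proof (cases "gauss s < \<alpha>")
    case True
    have "TT \<alpha> (1 / (1 + s) - 1, z / (1 + z)) = (gauss s, 1 / (of_int (b + 1) + of_int (-1) * (z / (1 + z))))"
      by (rule TT_inverse_branch) (use b s True gauss_range[of s] alpha_pos alpha_le_1 * in auto)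
    also have "of_int (b + 1) + of_int (-1) * (z / (1 + z)) = of_int b + 1 / (1 + z)"
      using z by (simp add: field_simps)
    finally show ?thesis using True by (simp add: fold_pt_def)
  next
    case False
    have "TT \<alpha> (1 / (1 + s) - 1, z / (1 + z)) = (gauss s - 1, 1 / (of_int (b + 2) + of_int (-1) * (z / (1 + z))))"
      by (rule TT_inverse_branch) (use b s False gauss_range[of s] alpha_pos alpha_le_1 * in auto)
    also have "of_int (b + 2) + of_int (-1) * (z / (1 + z)) = 1 + (of_int b + 1 / (1 + z))"
      using z by (simp add: field_simps)
    also have "1 / (1 + (of_int b + 1 / (1 + z))) = (1 / (of_int b + 1 / (1 + z))) / (1 + 1 / (of_int b + 1 / (1 + z)))"
    proof -
      have "of_int b + 1 / (1 + z) > 0" using b z by (simp add: add_pos_pos)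
      then show ?thesis by (simp add: field_simps)
    qed
    finally show ?thesis using False by (simp add: fold_pt_def)
  qed
  then show ?case using base by (simp add: gauss2_def b_def)
next
  case (step c)
  have le: "\<alpha> \<le> 1 / (real c + s)"
  proof -
    have "1 / (real (Suc c) + s) \<le> 1 / (real c + s)" using step by (intro frac_le) auto
    with step.prems show ?thesis by linarith
  qed
  have x': "1 / (real c + s) - 1 < \<alpha>"
  proof -
    have "1 / (real c + s) \<le> 1" using step by simp
    then show ?thesis using alpha_pos by linarith
  qed
  have "TT \<alpha> (1 / (real (Suc c) + s) - 1, z / (1 + z))
     = (1 / (real c + s) - 1, 1 / (of_int 2 + of_int (-1) * (z / (1 + z))))"
  proof (rule TT_inverse_branch)
    have "real c + s > 0" using step by simp
    then show "1 / (real (Suc c) + s) - 1 = of_int (-1) / (of_int 2 + (1 / (real c + s) - 1))"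
      by (simp add: field_simps)
    have "1 / (real c + s) > 0" using \<open>real c + s > 0\<close> by simp
    then show "0 < of_int 2 + (1 / (real c + s) - 1)" by linarith
  qed (use le x' in auto)
  also have "1 / (of_int 2 + of_int (-1) * (z / (1 + z))) = (z + 1) / (1 + (z + 1))"
  proof -
    have "1 + z \<noteq> 0" "2 + z \<noteq> 0" "(2 + 2 * z) - z = 2 + z" using step.prems by auto
    then show ?thesis by (simp add: divide_simps) (simp add: algebra_simps)
  qed
  finally have 1: "TT \<alpha> (1 / (real (Suc c) + s) - 1, z / (1 + z)) = (1 / (real c + s) - 1, (z + 1) / (1 + (z + 1)))" .
  have neg: "1 / (real (Suc c) + s) - 1 < 0" using step by simp
  have IH: "(TT \<alpha> ^^ c) (1 / (real c + s) - 1, (z + 1) / (1 + (z + 1))) = fold_pt (gauss2 (s, 1 / (real c + (z + 1))))"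
     "\<forall>i<c. fst ((TT \<alpha> ^^ i) (1 / (real c + s) - 1, (z + 1) / (1 + (z + 1)))) < 0"
    using step.IH[of "z + 1"] step.prems le by auto
  show ?case
  proof (intro conjI allI impI)
    show "(TT \<alpha> ^^ Suc c) (1 / (real (Suc c) + s) - 1, z / (1 + z)) = fold_pt (gauss2 (s, 1 / (real (Suc c) + z)))"
      using IH(1) unfolding funpow_Suc_right o_apply 1 by (simp add: algebra_simps)
    fix i assume "i < Suc c"
    then show "fst ((TT \<alpha> ^^ i) (1 / (real (Suc c) + s) - 1, z / (1 + z))) < 0"
      using neg IH(2) 1 by (cases i) (simp_all add: funpow_Suc_right del: funpow.simps(2))
  qed
qed

lemma TT_fold_above:
  assumes "\<alpha> \<le> u" "u < 1" "u \<notin> \<rat>" "0 \<le> z"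
  obtains m where "m \<ge> 1" "(TT \<alpha> ^^ m) (fold_pt (u, z)) = fold_pt (gauss2 (gauss2 (u, z)))"
    "\<And>i. i < m \<Longrightarrow> fst ((TT \<alpha> ^^ i) (fold_pt (u, z))) < 0"
proof -
  have "\<lfloor>1 / u\<rfloor> \<ge> 1" by (rule gauss_digit_ge_1) (use assms alpha_pos in auto)
  then obtain c :: nat where "\<lfloor>1 / u\<rfloor> = int c" "int c \<ge> 1" by (metis nonneg_int_cases order_trans zero_le_one)
  then have c: "c \<ge> 1" "of_int \<lfloor>1 / u\<rfloor> = real c" by auto
  have u: "u = 1 / (real c + gauss u)" using gauss_rep(2)[of u] c by simp
  have *: "fold_pt (u, z) = (1 / (real c + gauss u) - 1, z / (1 + z))"
    using assms u by (simp add: fold_pt_def)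
  have **: "gauss2 (u, z) = (gauss u, 1 / (real c + z))"
    using c by (simp add: gauss2_def)
  have "\<alpha> \<le> 1 / (real c + gauss u)" using u assms by simp
  from TT_fold_above_aux[OF c(1) gauss_pos[OF assms(3)] gauss_range(2) this assms(4)] c(1) that[of c]
  show ?thesis unfolding * ** by blast
qed

text \<open>In Gauss coordinates the orbit of \<open>TT\<close> skips at most one step at a time and never skips
  the image of a point whose first coordinate is below \<open>\<alpha>\<close>; hence orbits merge there.\<close>

lemma TT_orbit_meets:
  assumes "u \<in> {0<..<1}" "u \<notin> \<rat>" "z \<in> {0..1}" "(gauss2 ^^ m) (u, z) = q" "fst q < \<alpha>"
  shows "\<exists>n\<ge>1. (TT \<alpha> ^^ n) (fold_pt (u, z)) = fold_pt (gauss2 q)"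
  using assms
proof (induction m arbitrary: u z rule: less_induct)
  case (less m)
  have fp: "fold_pt (u, z) = (u, z)" if "u < \<alpha>" using that by (simp add: fold_pt_def)
  obtain u1 z1 where g1: "gauss2 (u, z) = (u1, z1)" by force
  have r1: "u1 \<in> {0<..<1}" "u1 \<notin> \<rat>" "z1 \<in> {0..1}"
    using g1 gauss_range[of u] gauss_pos[of u] less.prems gauss2_range(1)[of u z] gauss_Rats_iff[of u]
    by (auto simp: gauss2_def)
  obtain u2 z2 where g2: "gauss2 (u1, z1) = (u2, z2)" by force
  have r2: "u2 \<in> {0<..<1}" "u2 \<notin> \<rat>" "z2 \<in> {0..1}"
    using g2 gauss_range[of u1] gauss_pos[of u1] r1 gauss2_range(1)[of u1 z1] gauss_Rats_iff[of u1]
    by (auto simp: gauss2_def)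
  show ?case
  proof (cases m)
    case 0
    with less.prems have "q = (u, z)" "u < \<alpha>" by auto
    then show ?thesis using TT_fold_below[of u z] fp less.prems
      by (intro exI[of _ 1]) auto
  next
    case (Suc m')
    have q1: "(gauss2 ^^ m') (u1, z1) = q" using less.prems Suc g1 by (simp add: funpow_Suc_right del: funpow.simps(2))
    show ?thesis
    proof (cases "u < \<alpha>")
      case True
      from less.IH[OF _ r1 q1 less.prems(5)] Suc
      obtain n where n: "n \<ge> 1" "(TT \<alpha> ^^ n) (fold_pt (u1, z1)) = fold_pt (gauss2 q)" by auto
      have "(TT \<alpha> ^^ Suc n) (fold_pt (u, z)) = fold_pt (gauss2 q)"
        using n TT_fold_below[of u z] True less.prems fp g1 by (simp add: funpow_Suc_right del: funpow.simps(2))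
      then show ?thesis by (intro exI[of _ "Suc n"]) simp
    next
      case False
      then obtain k where k: "k \<ge> 1" "(TT \<alpha> ^^ k) (fold_pt (u, z)) = fold_pt (gauss2 (gauss2 (u, z)))"
        using TT_fold_above[of u z] less.prems by auto
      show ?thesis
      proof (cases m')
        case 0
        with q1 g1 k show ?thesis by auto
      next
        case (Suc m'')
        have q2: "(gauss2 ^^ m'') (u2, z2) = q" using q1 Suc g2 by (simp add: funpow_Suc_right del: funpow.simps(2))
        from less.IH[OF _ r2 q2 less.prems(5)] Suc \<open>m = Suc m'\<close>
        obtain n where n: "n \<ge> 1" "(TT \<alpha> ^^ n) (fold_pt (u2, z2)) = fold_pt (gauss2 q)" by auto
        have "(TT \<alpha> ^^ (n + k)) (fold_pt (u, z)) = fold_pt (gauss2 q)"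
          using n k g1 g2 by (simp add: funpow_add)
        then show ?thesis using n by (intro exI[of _ "n + k"]) simp
      qed
    qed
  qed
qed

text \<open>Points of the orbit strictly inside a double step are negative, so a positive point
  belongs to the Gauss orbit, and there \<open>fold_pt\<close> leaves the coordinates
  unchanged.\<close>

lemma TT_orbit_gauss2:
  assumes "u \<in> {0<..<1}" "u \<notin> \<rat>" "z \<in> {0..1}" "(TT \<alpha> ^^ n) (fold_pt (u, z)) = (x, y)" "x > 0"
  shows "\<exists>m. (gauss2 ^^ m) (u, z) = (x, y)"
  using assms
proof (induction n arbitrary: u z rule: less_induct)
  case (less n)
  have fp: "fold_pt (u, z) = (u, z)" if "u < \<alpha>" using that by (simp add: fold_pt_def)
  obtain u1 z1 where g1: "gauss2 (u, z) = (u1, z1)" by force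
  have r1: "u1 \<in> {0<..<1}" "u1 \<notin> \<rat>" "z1 \<in> {0..1}"
    using g1 gauss_range[of u] gauss_pos[of u] less.prems gauss2_range(1)[of u z] gauss_Rats_iff[of u]
    by (auto simp: gauss2_def)
  obtain u2 z2 where g2: "gauss2 (u1, z1) = (u2, z2)" by force
  have r2: "u2 \<in> {0<..<1}" "u2 \<notin> \<rat>" "z2 \<in> {0..1}"
    using g2 gauss_range[of u1] gauss_pos[of u1] r1 gauss2_range(1)[of u1 z1] gauss_Rats_iff[of u1]
    by (auto simp: gauss2_def)
  show ?case
  proof (cases "u < \<alpha>")
    case True
    show ?thesis
    proof (cases n)
      case 0
      then show ?thesis using less.prems fp[OF True] by (intro exI[of _ 0]) simp
    next
      case (Suc n')
      have "(TT \<alpha> ^^ n') (fold_pt (u1, z1)) = (x, y)"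
        using less.prems Suc TT_fold_below[of u z] True fp g1 by (simp add: funpow_Suc_right del: funpow.simps(2))
      from less.IH[OF _ r1 this less.prems(5)] Suc obtain m where "(gauss2 ^^ m) (u1, z1) = (x, y)" by auto
      then show ?thesis using g1 by (intro exI[of _ "Suc m"]) (simp add: funpow_Suc_right del: funpow.simps(2))
    qed
  next
    case False
    then obtain k where k: "k \<ge> 1" "(TT \<alpha> ^^ k) (fold_pt (u, z)) = fold_pt (gauss2 (gauss2 (u, z)))"
       "\<And>i. i < k \<Longrightarrow> fst ((TT \<alpha> ^^ i) (fold_pt (u, z))) < 0"
      using TT_fold_above[of u z] less.prems by auto
    have "\<not> n < k" using k(3)[of n] less.prems by auto
    then have n: "n = (n - k) + k" by simp
    have "(TT \<alpha> ^^ (n - k)) (fold_pt (u2, z2)) = (x, y)"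
      using less.prems(4) k(2) g1 g2 by (subst (asm) n) (simp add: funpow_add)
    from less.IH[OF _ r2 this less.prems(5)] k(1) \<open>\<not> n < k\<close> obtain m where "(gauss2 ^^ m) (u2, z2) = (x, y)" by auto
    then show ?thesis using g1 g2 by (intro exI[of _ "Suc (Suc m)"]) (simp add: funpow_Suc_right del: funpow.simps(2))
  qed
qed

end

subsection \<open>The languages as an automaton\<close>

lemma kstar_Nil: "[] \<in> kstar A"
  unfolding kstar_def by (rule image_eqI[of _ _ "[]"]) auto

lemma kstar_snoc: "w \<in> kstar A \<Longrightarrow> u \<in> A \<Longrightarrow> w @ u \<in> kstar A"
proof -
  assume "w \<in> kstar A" "u \<in> A"
  then obtain ws where "ws \<in> lists A" "w = concat ws" by (auto simp: kstar_def)
  with \<open>u \<in> A\<close> show ?thesis unfolding kstar_def by (intro image_eqI[of _ _ "ws @ [u]"]) auto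
qed

lemma kstar_induct [consumes 1, case_names Nil snoc]:
  assumes "w \<in> kstar A" "P []" "\<And>w u. w \<in> kstar A \<Longrightarrow> P w \<Longrightarrow> u \<in> A \<Longrightarrow> P (w @ u)"
  shows "P w"
proof -
  obtain ws where "ws \<in> lists A" "w = concat ws" using assms(1) by (auto simp: kstar_def)
  then show ?thesis
  proof (induction ws arbitrary: w rule: rev_induct)
    case (snoc u ws)
    then have "concat ws \<in> kstar A" "P (concat ws)" "u \<in> A" by (auto simp: kstar_def)
    with assms(3) snoc.prems show ?case by auto
  qed (use assms(2) in simp)
qed

lemma conc_intro: "u \<in> A \<Longrightarrow> v \<in> B \<Longrightarrow> u @ v \<in> A @@ B"
  by (auto simp: conc_def)

context alpha_expansion
begin

definition orb :: "bool \<Rightarrow> nat \<Rightarrow> real" where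
  "orb c j = (T \<alpha> ^^ j) (if c then \<alpha> else \<alpha> - 1)"

definition klen :: "bool \<Rightarrow> enat" where
  "klen c = (if c then k_up \<alpha> else k_lo \<alpha>)"

lemma orb_Suc: "orb c (Suc j) = T \<alpha> (orb c j)"
  by (simp add: orb_def)

lemma orb_0: "orb False 0 = \<alpha> - 1" "orb True 0 = \<alpha>"
  by (simp_all add: orb_def)

text \<open>The automaton reading the words of \<open>LL' \<alpha>\<close>: a word in state \<open>(c, j)\<close> ends with the prefix of
  length \<open>j\<close> of the expansion of \<open>\<alpha> - 1\<close> (\<open>c = False\<close>) or of \<open>\<alpha>\<close> (\<open>c = True\<close>), and the image of
  its cylinder is the interval from \<open>orb c j\<close> to \<open>\<alpha>\<close>.\<close>

inductive acc :: "letter list \<Rightarrow> bool \<Rightarrow> nat \<Rightarrow> bool" where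
  acc_Nil: "acc [] False 0"
| acc_step: "acc w c j \<Longrightarrow> enat (Suc j) < klen c \<Longrightarrow> acc (w @ [letter_at \<alpha> (orb c j)]) c (Suc j)"
| acc_reset: "acc w c j \<Longrightarrow> enat (Suc j) < klen c \<Longrightarrow> 2 \<le> d \<Longrightarrow> d \<le> D + 1 \<Longrightarrow>
    letter_less (letter_at \<alpha> (orb c j)) (-1, Fin d) \<Longrightarrow> acc (w @ [(-1, Fin d)]) False 0"
| acc_plus: "acc w c j \<Longrightarrow> acc (w @ [(1, Fin D)]) True 1"

lemma acc_True_ge_1: "acc w c j \<Longrightarrow> c \<Longrightarrow> j \<ge> 1"
  by (induction rule: acc.induct) auto

end

text \<open>Common ground for all parameters: each endpoint before the last one, which has index k -
  1 or k' - 1, is at or left of -\<open>kap\<close>, so its digit is between 2 and D+1. On the upper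
  branch index 0 is exempt, since \<alpha> is positive.\<close>

locale alpha_struct = alpha_expansion +
  assumes lo_left: "enat (Suc j) < k_lo \<alpha> \<Longrightarrow> (T \<alpha> ^^ j) (\<alpha> - 1) \<le> - kap"
    and up_left: "1 \<le> j \<Longrightarrow> enat (Suc j) < k_up \<alpha> \<Longrightarrow> (T \<alpha> ^^ j) \<alpha> \<le> - kap"
    and k_lo_ge: "k_lo \<alpha> \<ge> 1" and k_up_ge: "k_up \<alpha> \<ge> 2"
begin

lemma klen_gt_0: "enat 0 < klen c"
proof -
  have "(0::enat) < 1" "(0::enat) < 2" by simp_all
  then show ?thesis using k_lo_ge k_up_ge by (auto simp: klen_def enat_0 intro: less_le_trans)
qed

lemma klen_up_gt_1: "enat 1 < klen True"
proof -
  have "enat 1 < 2" by (metis enat_ord_simps(2) numeral_eq_enat one_less_numeral_iff semiring_norm(76))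
  then show ?thesis using k_up_ge by (simp add: klen_def)
qed

lemma orb_range: "(c \<Longrightarrow> j \<ge> 1) \<Longrightarrow> orb c j \<in> {\<alpha> - 1..<\<alpha>}"
proof (cases c)
  case False
  then show ?thesis using T_pow_range[of "\<alpha> - 1" j] by (simp add: orb_def)
next
  case True
  moreover assume "c \<Longrightarrow> j \<ge> 1"
  ultimately obtain i where "j = Suc i" by (cases j) auto
  moreover have "T \<alpha> \<alpha> \<in> {\<alpha> - 1..<\<alpha>}" using T_range alpha_pos by auto
  ultimately show ?thesis using T_pow_range[of "T \<alpha> \<alpha>" i] True
    by (simp add: orb_def funpow_Suc_right del: funpow.simps(2))
qed

lemma orb_left: "(c \<Longrightarrow> j \<ge> 1) \<Longrightarrow> enat (Suc j) < klen c \<Longrightarrow> orb c j \<le> - kap"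
  using lo_left[of j] up_left[of j] by (cases c) (auto simp: orb_def klen_def)

lemma orb_letter:
  assumes "c \<Longrightarrow> j \<ge> 1" "enat (Suc j) < klen c"
  obtains d where "letter_at \<alpha> (orb c j) = (-1, Fin d)" "2 \<le> d" "d \<le> D + 1" "orb c (Suc j) = - 1 / orb c j - of_int d"
    "orb c j < 0"
proof -
  have "orb c j \<le> - kap" by (rule orb_left) (use assms in auto)
  moreover have "\<alpha> - 1 \<le> orb c j" using orb_range[of c j] assms by auto
  ultimately obtain d where "letter_at \<alpha> (orb c j) = (-1, Fin d)" "2 \<le> d" "d \<le> D + 1"
    "T \<alpha> (orb c j) = - 1 / orb c j - of_int d" "orb c j < 0"
    using letter_neg_big[of "orb c j"] kap_bounds(1) by force
  with that show ?thesis by (simp add: orb_Suc)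
qed

lemma acc_klen: "acc w c j \<Longrightarrow> enat j < klen c"
proof (induction rule: acc.induct)
  case acc_Nil
  then show ?case by (rule klen_gt_0)
next
  case acc_reset
  show ?case by (rule klen_gt_0)
next
  case acc_plus
  show ?case by (rule klen_up_gt_1)
qed

definition big_letters :: "letter set" where
  "big_letters = {(-1, Fin d) | d. 2 \<le> d \<and> d \<le> D + 1} \<union> {(1, Fin D)}"

lemma big_letters_finite: "finite big_letters"
proof -
  have "big_letters \<subseteq> (\<lambda>d. (-1, Fin d)) ` {2..D + 1} \<union> {(1, Fin D)}"
    by (auto simp: big_letters_def)
  then show ?thesis by (rule finite_subset) auto
qed

lemma big_letters_proper: "big_letters \<subseteq> proper_letters"
  using D_ge_1 by (auto simp: big_letters_def proper_letters_def)

lemma bwd_letter_big: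
  assumes "a \<in> big_letters" "0 \<le> y" "y \<le> 1"
  shows "top_end \<alpha> \<le> bwd_letter a y"
proof -
  consider d where "a = (-1, Fin d)" "2 \<le> d" "d \<le> D + 1" | "a = (1, Fin D)"
    using assms by (auto simp: big_letters_def)
  then show ?thesis
  proof cases
    case 1
    then have "0 < of_int d - y" "of_int d - y \<le> of_int D + 1" using assms by auto
    then show ?thesis using 1 by (simp add: top_end_eq frac_le)
  next
    case 2
    then have "of_int D + y \<le> of_int D + 1" "0 < of_int D + y" using assms D_ge_1 by auto
    then show ?thesis using 2 by (simp add: top_end_eq frac_le)
  qed
qed

lemma acc_big_letters: "acc w c j \<Longrightarrow> w \<in> lists big_letters"
proof (induction rule: acc.induct)
  case (acc_step w c j)
  then obtain d where "letter_at \<alpha> (orb c j) = (-1, Fin d)" "2 \<le> d" "d \<le> D + 1"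
    using orb_letter[of c j] acc_True_ge_1 by metis
  with acc_step show ?case by (auto simp: big_letters_def)
qed (auto simp: big_letters_def)

lemma acc_proper: "acc w c j \<Longrightarrow> w \<in> lists proper_letters"
  using acc_big_letters big_letters_proper by blast

lemma prefix1_lo_Suc: "prefix1 (b_lo \<alpha>) (Suc j) = prefix1 (b_lo \<alpha>) j @ [letter_at \<alpha> (orb False j)]"
  by (simp add: prefix1_b_lo itin_Suc orb_def)

lemma prefix1_up_Suc: "prefix1 (b_up \<alpha>) (Suc j) = prefix1 (b_up \<alpha>) j @ [letter_at \<alpha> (orb True j)]"
  by (simp add: prefix1_b_up itin_Suc orb_def)

lemma prefix1_0: "prefix1 b 0 = []"
  by (simp add: prefix1_def)

lemma acc_append_lo: "acc w False 0 \<Longrightarrow> enat j < klen False \<Longrightarrow> acc (w @ prefix1 (b_lo \<alpha>) j) False j"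
proof (induction j)
  case (Suc j)
  then have "enat j < klen False" by (meson enat_ord_simps(2) lessI less_trans)
  with Suc acc_step[of "w @ prefix1 (b_lo \<alpha>) j" False j] show ?case by (simp add: prefix1_lo_Suc)
qed (simp add: prefix1_0)

lemma acc_append_up: "acc w c i \<Longrightarrow> enat (Suc j) < klen True \<Longrightarrow> acc (w @ prefix1 (b_up \<alpha>) (Suc j)) True (Suc j)"
proof (induction j)
  case 0
  then show ?case using acc_plus[OF 0(1)] by (simp add: prefix1_up_Suc prefix1_0 orb_0 letter_alpha)
next
  case (Suc j)
  then have "enat (Suc j) < klen True" by (meson enat_ord_simps(2) lessI less_trans)
  with Suc acc_step[of "w @ prefix1 (b_up \<alpha>) (Suc j)" True "Suc j"] show ?case
    by (simp add: prefix1_up_Suc[of "Suc j"])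
qed

lemma letter_le_top_iff: "2 \<le> d \<Longrightarrow> letter_le (-1, Fin d) (letter_W (b_up \<alpha> (Suc 0))) \<longleftrightarrow> d \<le> D + 1"
proof -
  assume "2 \<le> d"
  then have "letter_le (-1, Fin d) (letter_W (b_up \<alpha> (Suc 0))) \<longleftrightarrow> real_of_int d \<le> real_of_int (D + 1)"
    using D_ge_1 by (simp add: b_up_def letter_alpha letter_le_def divide_simps)
  then show ?thesis by (simp only: of_int_le_iff)
qed

lemma letter_le_top_iff': "2 \<le> d \<Longrightarrow> letter_le (-1, Fin d) (letter_W (letter_at \<alpha> \<alpha>)) \<longleftrightarrow> d \<le> D + 1"
  using letter_le_top_iff[of d] by (simp add: b_up_def)

text \<open>The upper bound in the definition is \<open>(-1, D + 1)\<close>, the W-partner of the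
  first letter \<open>(1, D)\<close> of \<alpha>. Here j counts orbit points from 0 and is one less
  than in the definition.\<close>

lemma U3_iff: "u \<in> U3 \<alpha> \<longleftrightarrow> (\<exists>j d. enat (Suc j) < klen False \<and> 2 \<le> d \<and> d \<le> D + 1
    \<and> letter_less (letter_at \<alpha> (orb False j)) (-1, Fin d) \<and> u = prefix1 (b_lo \<alpha>) j @ [(-1, Fin d)])"
proof
  assume "u \<in> U3 \<alpha>"
  then obtain j d where *: "u = prefix1 (b_lo \<alpha>) (j - 1) @ [(-1, Fin d)]" "1 \<le> j" "enat j < k_lo \<alpha>" "2 \<le> d"
    "letter_less (b_lo \<alpha> j) (-1, Fin d)" "letter_le (-1, Fin d) (letter_W (b_up \<alpha> 1))"
    by (auto simp: U3_def alph_neg_def)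
  then have "enat (Suc (j - 1)) < klen False" by (simp add: klen_def)
  with * show "\<exists>j d. enat (Suc j) < klen False \<and> 2 \<le> d \<and> d \<le> D + 1
    \<and> letter_less (letter_at \<alpha> (orb False j)) (-1, Fin d) \<and> u = prefix1 (b_lo \<alpha>) j @ [(-1, Fin d)]"
    by (intro exI[of _ "j - 1"] exI[of _ d]) (auto simp: b_lo_def orb_def letter_le_top_iff)
next
  assume "\<exists>j d. enat (Suc j) < klen False \<and> 2 \<le> d \<and> d \<le> D + 1
    \<and> letter_less (letter_at \<alpha> (orb False j)) (-1, Fin d) \<and> u = prefix1 (b_lo \<alpha>) j @ [(-1, Fin d)]"
  then obtain j d where *: "enat (Suc j) < klen False" "2 \<le> d" "d \<le> D + 1"
    "letter_less (letter_at \<alpha> (orb False j)) (-1, Fin d)" "u = prefix1 (b_lo \<alpha>) j @ [(-1, Fin d)]" by auto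
  then show "u \<in> U3 \<alpha>" unfolding U3_def
    by (intro CollectI exI[of _ "Suc j"] exI[of _ "(-1, Fin d)"])
      (auto simp: b_lo_def orb_def klen_def letter_le_top_iff alph_neg_def)
qed

lemma U4_iff: "u \<in> U4 \<alpha> \<longleftrightarrow> (\<exists>j d. 1 \<le> j \<and> enat (Suc j) < klen True \<and> 2 \<le> d \<and> d \<le> D + 1
    \<and> letter_less (letter_at \<alpha> (orb True j)) (-1, Fin d) \<and> u = prefix1 (b_up \<alpha>) j @ [(-1, Fin d)])"
proof
  assume "u \<in> U4 \<alpha>"
  then obtain j d where *: "u = prefix1 (b_up \<alpha>) (j - 1) @ [(-1, Fin d)]" "2 \<le> j" "enat j < k_up \<alpha>" "2 \<le> d"
    "letter_less (b_up \<alpha> j) (-1, Fin d)" "letter_le (-1, Fin d) (letter_W (b_up \<alpha> 1))"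
    by (auto simp: U4_def alph_neg_def)
  then have "enat (Suc (j - 1)) < klen True" by (simp add: klen_def)
  with * show "\<exists>j d. 1 \<le> j \<and> enat (Suc j) < klen True \<and> 2 \<le> d \<and> d \<le> D + 1
    \<and> letter_less (letter_at \<alpha> (orb True j)) (-1, Fin d) \<and> u = prefix1 (b_up \<alpha>) j @ [(-1, Fin d)]"
    by (intro exI[of _ "j - 1"] exI[of _ d]) (auto simp: b_up_def orb_def letter_le_top_iff')
next
  assume "\<exists>j d. 1 \<le> j \<and> enat (Suc j) < klen True \<and> 2 \<le> d \<and> d \<le> D + 1
    \<and> letter_less (letter_at \<alpha> (orb True j)) (-1, Fin d) \<and> u = prefix1 (b_up \<alpha>) j @ [(-1, Fin d)]"
  then obtain j d where *: "1 \<le> j" "enat (Suc j) < klen True" "2 \<le> d" "d \<le> D + 1"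
    "letter_less (letter_at \<alpha> (orb True j)) (-1, Fin d)" "u = prefix1 (b_up \<alpha>) j @ [(-1, Fin d)]" by auto
  then show "u \<in> U4 \<alpha>" unfolding U4_def
    by (intro CollectI exI[of _ "Suc j"] exI[of _ "(-1, Fin d)"])
      (auto simp: b_up_def orb_def klen_def letter_le_top_iff' alph_neg_def)
qed

lemma U1_iff: "u \<in> U1 \<alpha> \<longleftrightarrow> (\<exists>j. enat j < klen False \<and> u = prefix1 (b_lo \<alpha>) j)"
  by (auto simp: U1_def klen_def)

lemma U2_iff: "u \<in> U2 \<alpha> \<longleftrightarrow> (\<exists>j. enat (Suc j) < klen True \<and> u = prefix1 (b_up \<alpha>) (Suc j))"
proof
  assume "u \<in> U2 \<alpha>"
  then obtain j where "u = prefix1 (b_up \<alpha>) j" "1 \<le> j" "enat j < klen True" by (auto simp: U2_def klen_def)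
  then show "\<exists>j. enat (Suc j) < klen True \<and> u = prefix1 (b_up \<alpha>) (Suc j)" by (cases j) auto
qed (auto simp: U2_def klen_def)

lemma acc_append_U1U2:
  assumes "acc w False 0" "u \<in> U1 \<alpha> @@ kstar (U2 \<alpha>)"
  shows "\<exists>c j. acc (w @ u) c j"
proof -
  obtain u1 u2 where u: "u = u1 @ u2" "u1 \<in> U1 \<alpha>" "u2 \<in> kstar (U2 \<alpha>)" using assms by (auto simp: conc_def)
  have 1: "\<exists>c j. acc (w @ u1) c j" using u(2) acc_append_lo[OF assms(1)] by (auto simp: U1_iff)
  have "\<exists>c j. acc (w @ u1 @ u2) c j" using u(3)
  proof (induction rule: kstar_induct)
    case Nil
    then show ?case using 1 by simp
  next
    case (snoc v u)
    then obtain j where j: "enat (Suc j) < klen True" "u = prefix1 (b_up \<alpha>) (Suc j)" by (auto simp: U2_iff)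
    from snoc obtain c i where "acc (w @ u1 @ v) c i" by auto
    from acc_append_up[OF this j(1)] j(2) show ?case by (metis append.assoc)
  qed
  with u show ?thesis by simp
qed

lemma acc_if_LL:
  assumes "w \<in> LL \<alpha>" shows "acc w False 0"
  using assms unfolding LL_def
proof (induction rule: kstar_induct)
  case Nil
  then show ?case by (rule acc_Nil)
next
  case (snoc w u)
  from \<open>u \<in> _\<close> consider "u \<in> U3 \<alpha>" | "u \<in> U1 \<alpha> @@ kstar (U2 \<alpha>) @@ U4 \<alpha>" by blast
  then show ?case
  proof cases
    case 1
    then obtain j d where *: "enat (Suc j) < klen False" "2 \<le> d" "d \<le> D + 1"
      "letter_less (letter_at \<alpha> (orb False j)) (-1, Fin d)" "u = prefix1 (b_lo \<alpha>) j @ [(-1, Fin d)]"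
      by (auto simp: U3_iff)
    have "enat j < klen False" using *(1) by (meson enat_ord_simps(2) lessI less_trans)
    from acc_reset[OF acc_append_lo[OF snoc.IH this] *(1-4)] *(5) show ?thesis by simp
  next
    case 2
    then obtain u1 u4 where u: "u = u1 @ u4" "u1 \<in> U1 \<alpha> @@ kstar (U2 \<alpha>)" "u4 \<in> U4 \<alpha>"
    proof -
      obtain a b c where "u = a @ b @ c" "a \<in> U1 \<alpha>" "b \<in> kstar (U2 \<alpha>)" "c \<in> U4 \<alpha>"
        using 2 unfolding conc_def[of "U1 \<alpha>"] conc_def[of "kstar (U2 \<alpha>)"] by blast
      then show thesis using that[of "a @ b" c] by (simp add: conc_intro)
    qed
    then obtain j d where *: "1 \<le> j" "enat (Suc j) < klen True" "2 \<le> d" "d \<le> D + 1"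
      "letter_less (letter_at \<alpha> (orb True j)) (-1, Fin d)" "u4 = prefix1 (b_up \<alpha>) j @ [(-1, Fin d)]"
      by (auto simp: U4_iff)
    obtain i where i: "j = Suc i" using *(1) by (cases j) auto
    have "enat j < klen True" using *(2) by (meson enat_ord_simps(2) lessI less_trans)
    moreover obtain c l where "acc (w @ u1) c l" using acc_append_U1U2[OF snoc.IH u(2)] by auto
    ultimately have "acc ((w @ u1) @ prefix1 (b_up \<alpha>) j) True j" using acc_append_up i by blast
    from acc_reset[OF this *(2-5)] *(6) u(1) show ?thesis by simp
  qed
qed

lemma LL_Nil: "[] \<in> LL \<alpha>"
  by (simp add: LL_def kstar_Nil)

lemma LL'_snoc_U2: "w \<in> LL' \<alpha> \<Longrightarrow> u \<in> U2 \<alpha> \<Longrightarrow> w @ u \<in> LL' \<alpha>"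
proof -
  assume "w \<in> LL' \<alpha>" "u \<in> U2 \<alpha>"
  then obtain w0 u1 u2 where "w = w0 @ u1 @ u2" "w0 \<in> LL \<alpha>" "u1 \<in> U1 \<alpha>" "u2 \<in> kstar (U2 \<alpha>)"
    by (auto simp: LL'_def conc_def)
  with kstar_snoc[of u2 "U2 \<alpha>" u] \<open>u \<in> U2 \<alpha>\<close>
  have "w0 @ u1 @ (u2 @ u) \<in> LL' \<alpha>" unfolding LL'_def by (intro conc_intro)
  with \<open>w = w0 @ u1 @ u2\<close> show ?thesis by simp
qed

lemma LL'_snoc_U4: "w \<in> LL' \<alpha> \<Longrightarrow> u \<in> U4 \<alpha> \<Longrightarrow> w @ u \<in> LL \<alpha>"
proof -
  assume "w \<in> LL' \<alpha>" "u \<in> U4 \<alpha>"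
  then obtain w0 u1 u2 where w: "w = w0 @ u1 @ u2" "w0 \<in> LL \<alpha>" "u1 \<in> U1 \<alpha>" "u2 \<in> kstar (U2 \<alpha>)"
    by (auto simp: LL'_def conc_def)
  then have "u1 @ u2 @ u \<in> U1 \<alpha> @@ kstar (U2 \<alpha>) @@ U4 \<alpha>" using \<open>u \<in> U4 \<alpha>\<close> by (intro conc_intro)
  then have "w0 @ (u1 @ u2 @ u) \<in> LL \<alpha>" using w(2) unfolding LL_def by (intro kstar_snoc) auto
  with w show ?thesis by simp
qed

lemma LL_snoc_U1: "w \<in> LL \<alpha> \<Longrightarrow> u \<in> U1 \<alpha> \<Longrightarrow> w @ u \<in> LL' \<alpha>"
proof -
  assume "w \<in> LL \<alpha>" "u \<in> U1 \<alpha>"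
  then have "w @ u @ [] \<in> LL' \<alpha>" unfolding LL'_def by (intro conc_intro kstar_Nil)
  then show ?thesis by simp
qed

text \<open>The prefix at the end of w is the part not yet assigned to a block. A reset completes it
  to a word of \<open>U3\<close> or \<open>U4\<close>; when \<open>(1, D)\<close> is read, a prefix
  of the lower expansion becomes a block of \<open>U1\<close>, one of the upper expansion a block of
  \<open>U2\<close>.\<close>

lemma LL_if_acc:
  assumes "acc w c j"
  shows "(\<not> c \<longrightarrow> (\<exists>w0\<in>LL \<alpha>. w = w0 @ prefix1 (b_lo \<alpha>) j)) \<and> (c \<longrightarrow> (\<exists>w0\<in>LL' \<alpha>. w = w0 @ prefix1 (b_up \<alpha>) j))"
  using assms
proof (induction rule: acc.induct)
  case acc_Nil
  show ?case using LL_Nil by (simp add: prefix1_0)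
next
  case (acc_step w c j)
  then show ?case by (auto simp: prefix1_lo_Suc prefix1_up_Suc)
next
  case (acc_reset w c j d)
  show ?case
  proof (cases c)
    case True
    with acc_reset obtain w0 where w0: "w0 \<in> LL' \<alpha>" "w = w0 @ prefix1 (b_up \<alpha>) j" by auto
    have "prefix1 (b_up \<alpha>) j @ [(-1, Fin d)] \<in> U4 \<alpha>"
      unfolding U4_iff using acc_reset True acc_True_ge_1[OF acc_reset(1)]
      by (intro exI[of _ j] exI[of _ d]) auto
    from LL'_snoc_U4[OF w0(1) this] w0 show ?thesis by (auto simp: prefix1_0)
  next
    case False
    with acc_reset obtain w0 where w0: "w0 \<in> LL \<alpha>" "w = w0 @ prefix1 (b_lo \<alpha>) j" by auto
    have "prefix1 (b_lo \<alpha>) j @ [(-1, Fin d)] \<in> U3 \<alpha>"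
      unfolding U3_iff using acc_reset False by (intro exI[of _ j] exI[of _ d]) auto
    then have "w0 @ (prefix1 (b_lo \<alpha>) j @ [(-1, Fin d)]) \<in> LL \<alpha>"
      using w0(1) unfolding LL_def by (intro kstar_snoc) auto
    with w0 show ?thesis by (auto simp: prefix1_0)
  qed
next
  case (acc_plus w c j)
  have "w \<in> LL' \<alpha>"
  proof (cases c)
    case True
    with acc_plus obtain w0 where w0: "w0 \<in> LL' \<alpha>" "w = w0 @ prefix1 (b_up \<alpha>) j" by auto
    obtain i where "j = Suc i" using acc_True_ge_1[OF acc_plus(1) True] by (cases j) auto
    then have "prefix1 (b_up \<alpha>) j \<in> U2 \<alpha>" using acc_klen[OF acc_plus(1)] True by (auto simp: U2_iff)
    then show ?thesis using LL'_snoc_U2 w0 by simp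
  next
    case False
    with acc_plus obtain w0 where w0: "w0 \<in> LL \<alpha>" "w = w0 @ prefix1 (b_lo \<alpha>) j" by auto
    have "prefix1 (b_lo \<alpha>) j \<in> U1 \<alpha>" using acc_klen[OF acc_plus(1)] False by (auto simp: U1_iff)
    then show ?thesis using LL_snoc_U1 w0 by simp
  qed
  then show ?case by (auto simp: prefix1_up_Suc prefix1_0 orb_0 letter_alpha)
qed

lemma LL_iff_acc: "w \<in> LL \<alpha> \<longleftrightarrow> acc w False 0"
  using acc_if_LL LL_if_acc[of w False 0] by (auto simp: prefix1_0)

lemma LL'_iff_acc: "w \<in> LL' \<alpha> \<longleftrightarrow> (\<exists>c j. acc w c j)"
proof
  assume "w \<in> LL' \<alpha>"
  then obtain w0 u where "w = w0 @ u" "w0 \<in> LL \<alpha>" "u \<in> U1 \<alpha> @@ kstar (U2 \<alpha>)"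
    unfolding LL'_def conc_def[of "LL \<alpha>"] by auto
  then show "\<exists>c j. acc w c j" using acc_append_U1U2[of w0 u] by (simp add: LL_iff_acc)
next
  assume "\<exists>c j. acc w c j"
  then obtain c j where a: "acc w c j" by auto
  show "w \<in> LL' \<alpha>"
  proof (cases c)
    case True
    with LL_if_acc[OF a] obtain w0 where w0: "w0 \<in> LL' \<alpha>" "w = w0 @ prefix1 (b_up \<alpha>) j" by auto
    obtain i where "j = Suc i" using acc_True_ge_1[OF a True] by (cases j) auto
    then have "prefix1 (b_up \<alpha>) j \<in> U2 \<alpha>" using acc_klen[OF a] True by (auto simp: U2_iff)
    then show ?thesis using LL'_snoc_U2 w0 by simp
  next
    case False
    with LL_if_acc[OF a] obtain w0 where w0: "w0 \<in> LL \<alpha>" "w = w0 @ prefix1 (b_lo \<alpha>) j" by auto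
    have "prefix1 (b_lo \<alpha>) j \<in> U1 \<alpha>" using acc_klen[OF a] False by (auto simp: U1_iff)
    then show ?thesis using LL_snoc_U1 w0 by simp
  qed
qed

lemma acc_lo_iff: "acc w False j \<longleftrightarrow> enat j < klen False \<and> (\<exists>w0\<in>LL \<alpha>. w = w0 @ prefix1 (b_lo \<alpha>) j)"
  using LL_if_acc[of w False j] acc_klen acc_append_lo by (auto simp: LL_iff_acc)

lemma acc_up_iff: "acc w True j \<longleftrightarrow> j \<ge> 1 \<and> enat j < klen True \<and> (\<exists>w0\<in>LL' \<alpha>. w = w0 @ prefix1 (b_up \<alpha>) j)"
proof
  assume "acc w True j"
  then show "j \<ge> 1 \<and> enat j < klen True \<and> (\<exists>w0\<in>LL' \<alpha>. w = w0 @ prefix1 (b_up \<alpha>) j)"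
    using LL_if_acc[of w True j] acc_klen acc_True_ge_1 by auto
next
  assume "j \<ge> 1 \<and> enat j < klen True \<and> (\<exists>w0\<in>LL' \<alpha>. w = w0 @ prefix1 (b_up \<alpha>) j)"
  then show "acc w True j" using acc_append_up by (cases j) (auto simp: LL'_iff_acc)
qed

section \<open>Cells and fibres of the automaton\<close>

definition cell :: "letter list \<Rightarrow> real set" where
  "cell w = bwd w ` {0..top_end \<alpha>}"

lemma cell_eq: "w \<in> lists proper_letters \<Longrightarrow> mobius_act (N w) ` {0..top_end \<alpha>} = cell w"
  unfolding cell_def using top_end_bounds by (intro image_cong) (auto simp: mobius_act_N_eq_bwd)

lemma cell_open_eq: "w \<in> lists proper_letters \<Longrightarrow> mobius_act (N w) ` {0<..<top_end \<alpha>} = bwd w ` {0<..<top_end \<alpha>}"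
  using top_end_bounds by (intro image_cong) (auto simp: mobius_act_N_eq_bwd)

definition fibre :: "bool \<Rightarrow> nat \<Rightarrow> real set" where
  "fibre c j = closure (\<Union>w\<in>{w. acc w c j}. cell w)"

lemma Psi_eq: "\<Psi> \<alpha> = fibre False 0"
  unfolding \<Psi>_def fibre_def using acc_proper
  by (intro arg_cong[of _ _ closure] SUP_cong) (auto simp: LL_iff_acc cell_eq)

lemma Psi'_eq: "\<Psi>' \<alpha> = closure (\<Union>w\<in>{w. \<exists>c j. acc w c j}. cell w)"
proof -
  have 1: "LL' \<alpha> = {w. \<exists>c j. acc w c j}" using LL'_iff_acc by blast
  have 2: "mobius_act (N w) ` {0..top_end \<alpha>} = cell w" if "w \<in> {w. \<exists>c j. acc w c j}" for w
    using that acc_proper cell_eq by blast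
  show ?thesis unfolding \<Psi>'_def 1 by (intro arg_cong[of _ _ closure] SUP_cong refl 2)
qed

end

subsection \<open>Visited points\<close>

lemma irrational_between: "a < b \<Longrightarrow> \<exists>x::real. a < x \<and> x < b \<and> x \<notin> \<rat>"
proof -
  assume "a < b"
  then have "uncountable {a<..<b}" by (simp add: uncountable_open_interval)
  then have "\<not> {a<..<b} \<subseteq> \<rat>" using countable_rat countable_subset by blast
  then show ?thesis by auto
qed

lemma bwd_letter_open:
  assumes "a \<in> proper_letters" "y \<in> {0<..<1}"
  shows "bwd_letter a y \<in> {0<..<1}"
proof -
  consider d where "a = (-1, Fin d)" "d \<ge> 2" | d where "a = (1, Fin d)" "d \<ge> 1"
    using assms by (auto simp: proper_letters_def)
  then show ?thesis
  proof cases
    case 1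
    then have "1 < of_int d - y" using assms by auto
    with 1 show ?thesis by simp
  next
    case 2
    then have "1 < of_int d + y" using assms by auto
    with 2 show ?thesis by simp
  qed
qed

lemma bwd_open:
  assumes "w \<in> lists proper_letters" "y \<in> {0<..<1}"
  shows "bwd w y \<in> {0<..<1}"
  using assms(1,2)
proof (induction arbitrary: y)
  case (Cons a w)
  from bwd_letter_open[of a y] Cons show ?case by auto
qed simp

lemma bwd_letter_Rats_iff:
  assumes "a \<in> proper_letters"
  shows "bwd_letter a y \<in> \<rat> \<longleftrightarrow> y \<in> \<rat>"
proof -
  consider d where "a = (-1, Fin d)" | d where "a = (1, Fin d)"
    using assms by (auto simp: proper_letters_def)
  then show ?thesis
  proof cases
    case 1
    then have "bwd_letter a y \<in> \<rat> \<longleftrightarrow> of_int d + - y \<in> \<rat>" by (simp add: Rats_one_divide_iff)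
    then show ?thesis by (metis Rats_add_int_iff Rats_minus_iff)
  next
    case 2
    then have "bwd_letter a y \<in> \<rat> \<longleftrightarrow> of_int d + y \<in> \<rat>" by (simp add: Rats_one_divide_iff)
    then show ?thesis by (metis Rats_add_int_iff)
  qed
qed

lemma bwd_Rats_iff: "w \<in> lists proper_letters \<Longrightarrow> bwd w y \<in> \<rat> \<longleftrightarrow> y \<in> \<rat>"
proof (induction arbitrary: y rule: lists.induct)
  case (Cons a w)
  from Cons.IH[of "bwd_letter a y"] bwd_letter_Rats_iff[OF Cons.hyps(1), of y] show ?case by simp
qed simp

lemma T_Rats_iff: "T \<alpha> x \<in> \<rat> \<longleftrightarrow> x \<in> \<rat>"
proof (cases "x = 0")
  case False
  then have "T \<alpha> x = of_int (- d_int \<alpha> x) + \<bar>1 / x\<bar>" by (simp add: T_def)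
  then have "T \<alpha> x \<in> \<rat> \<longleftrightarrow> \<bar>1 / x\<bar> \<in> \<rat>" by (metis Rats_add_int_iff)
  also have "\<dots> \<longleftrightarrow> x \<in> \<rat>" by (metis Rats_abs_iff Rats_one_divide_iff)
  finally show ?thesis .
qed (simp add: T_def)

lemma T_pow_Rats_iff: "(T \<alpha> ^^ n) x \<in> \<rat> \<longleftrightarrow> x \<in> \<rat>"
  by (induction n) (auto simp: T_Rats_iff)

text \<open>Going back in time is the Euclidean algorithm on z = p/q: the digit q div p moves in
  front of u, and the earlier second coordinate is (q mod p)/p, until it is 0.\<close>

lemma gauss2_reach_rational:
  assumes "u \<in> {0<..<1}" "u \<notin> \<rat>" "0 \<le> z" "z \<le> 1" "z \<in> \<rat>"
  shows "\<exists>m u0. u0 \<in> {0<..<1} \<and> u0 \<notin> \<rat> \<and> (gauss2 ^^ m) (u0, 0) = (u, z)"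
proof -
  have main: "\<exists>m u0. u0 \<in> {0<..<1} \<and> u0 \<notin> \<rat> \<and> (gauss2 ^^ m) (u0, 0) = (u, real p / real q)"
    if "p \<le> q" "q > 0" "u \<in> {0<..<1}" "u \<notin> \<rat>" for p q :: nat and u
    using that
  proof (induction p arbitrary: q u rule: less_induct)
    case (less p)
    show ?case
    proof (cases "p = 0")
      case True
      then show ?thesis using less.prems by (intro exI[of _ 0] exI[of _ u]) auto
    next
      case False
      define c where "c = q div p"
      have c: "c \<ge> 1" using False less.prems by (simp add: c_def div_greater_zero_iff Suc_le_eq)
      define v where "v = 1 / (real c + u)"
      have v: "v \<in> {0<..<1}" using c less.prems by (auto simp: v_def field_simps)
      have v': "v \<notin> \<rat>" using less.prems Rats_add_int_iff[of "int c" u] by (simp add: v_def Rats_one_divide_iff)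
      have q: "real q = real c * real p + real (q mod p)"
        unfolding c_def by (metis div_mult_mod_eq of_nat_add of_nat_mult)
      from less.IH[of "q mod p" p v] False v v'
      obtain m u0 where m: "u0 \<in> {0<..<1}" "u0 \<notin> \<rat>" "(gauss2 ^^ m) (u0, 0) = (v, real (q mod p) / real p)" by auto
      have "gauss2 (v, real (q mod p) / real p) = (u, 1 / (real c + real (q mod p) / real p))"
        using gauss_inverse_branch[of u v "int c"] less.prems by (simp add: gauss2_def v_def)
      also have "1 / (real c + real (q mod p) / real p) = real p / real q"
        using False q by (simp add: field_simps)
      finally show ?thesis using m by (intro exI[of _ "Suc m"] exI[of _ u0]) auto
    qed
  qed
  obtain a b :: nat where ab: "b \<noteq> 0" "\<bar>z\<bar> = real a / real b"
    using Rats_abs_nat_div_natE[OF assms(5)] by metis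
  with assms have z: "z = real a / real b" by simp
  with assms ab have "a \<le> b" by (simp add: divide_le_eq)
  with main[of a b u] assms z ab show ?thesis by auto
qed

context alpha_expansion
begin

definition visited :: "(real \<times> real) set" where
  "visited = {(TT \<alpha> ^^ n) (x, 0) | n x. x \<in> {\<alpha> - 1..<\<alpha>}}"

lemma Omega_eq: "\<Omega> \<alpha> = closure visited"
  by (simp add: \<Omega>_def visited_def)

lemma TT_visited: "p \<in> visited \<Longrightarrow> TT \<alpha> p \<in> visited"
proof -
  assume "p \<in> visited"
  then obtain n x where "p = (TT \<alpha> ^^ n) (x, 0)" "x \<in> {\<alpha> - 1..<\<alpha>}" unfolding visited_def by blast
  then have "TT \<alpha> p = (TT \<alpha> ^^ Suc n) (x, 0)" by simp
  with \<open>x \<in> {\<alpha> - 1..<\<alpha>}\<close> show ?thesis unfolding visited_def by blast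
qed

lemma TT_pow_visited: "p \<in> visited \<Longrightarrow> (TT \<alpha> ^^ n) p \<in> visited"
  by (induction n) (auto intro: TT_visited)

lemma fold_pt_visited_start: "u \<in> {0<..<1} \<Longrightarrow> fold_pt (u, 0) \<in> visited"
proof -
  assume "u \<in> {0<..<1}"
  then have "fst (fold_pt (u, 0)) \<in> {\<alpha> - 1..<\<alpha>}" "snd (fold_pt (u, 0)) = 0"
    using alpha_pos alpha_le_1 by (auto simp: fold_pt_def)
  then have "fold_pt (u, 0) = (TT \<alpha> ^^ 0) (fst (fold_pt (u, 0)), 0)" by (simp add: prod_eq_iff)
  with \<open>fst (fold_pt (u, 0)) \<in> {\<alpha> - 1..<\<alpha>}\<close> show ?thesis unfolding visited_def by blast
qed

text \<open>The Gauss orbit of a point with second coordinate 0 passes through (v, z). Since v <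
  \<alpha>, the folded orbit passes through the image of (v, z), even if it skips (v, z)
  itself.\<close>

lemma fold_pt_visited:
  assumes "u \<in> {0<..<1}" "u \<notin> \<rat>" "0 \<le> z" "z < 1" "z \<in> \<rat>" "1 / (of_int c + u) < \<alpha>" "c \<ge> 1"
  shows "fold_pt (u, 1 / (of_int c + z)) \<in> visited"
proof -
  define v where "v = 1 / (of_int c + u)"
  have "1 < of_int c + u" using assms by auto
  then have v: "v \<in> {0<..<1}" by (simp add: v_def)
  have v': "v \<notin> \<rat>" using assms by (simp add: v_def Rats_one_divide_iff Rats_add_int_iff)
  obtain m u0 where m: "u0 \<in> {0<..<1}" "u0 \<notin> \<rat>" "(gauss2 ^^ m) (u0, 0) = (v, z)"
    using gauss2_reach_rational[OF v v', of z] assms by (metis less_imp_le)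
  obtain n where "(TT \<alpha> ^^ n) (fold_pt (u0, 0)) = fold_pt (gauss2 (v, z))"
    using TT_orbit_meets[OF m(1,2) _ m(3)] assms v_def by auto
  moreover have "gauss2 (v, z) = (u, 1 / (of_int c + z))"
    using gauss_inverse_branch[of u v c] assms by (simp add: gauss2_def v_def)
  ultimately show ?thesis using TT_pow_visited[OF fold_pt_visited_start[OF m(1)], of n] by simp
qed

text \<open>The Gauss predecessor has first coordinate 1/(c + x), which is below \<alpha> by the
  last assumption. For x < 0 the unfolded first coordinate is x + 1 and the digit c - 1, so the sum
  in this denominator does not change.\<close>

lemma visited_if_prev_below:
  assumes x: "\<alpha> - 1 \<le> x" "x < \<alpha>" "x \<notin> \<rat>" and y: "0 < y" "y < 1" "y \<in> \<rat>"
    and c: "1 / \<alpha> < of_int \<lfloor>1 / y\<rfloor> + x"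
  shows "(x, y) \<in> visited"
proof -
  define c where "c = \<lfloor>1 / y\<rfloor>"
  define z where "z = frac (1 / y)"
  have z: "0 \<le> z" "z < 1" "1 / y = of_int c + z"
    by (auto simp: z_def frac_lt_1) (simp add: c_def frac_def)
  have yz: "y = 1 / (of_int c + z)" by (simp flip: z(3))
  have "1 / y \<in> \<rat>" using y by (simp add: Rats_one_divide_iff)
  then have zQ: "z \<in> \<rat>" unfolding z(3) by (simp add: Rats_add_int_iff)
  have a1: "1 / \<alpha> \<ge> 1" using alpha_pos alpha_le_1 by simp
  have lt: "1 / (of_int c + x) < \<alpha>"
  proof -
    have "0 < 1 / \<alpha>" using alpha_pos by simp
    with c have "1 / (of_int c + x) < 1 / (1 / \<alpha>)"
      unfolding c_def[symmetric] by (intro frac_less2) auto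
    then show ?thesis by simp
  qed
  show ?thesis
  proof (cases "x > 0")
    case True
    have "c \<ge> 1" unfolding c_def using y by (simp add: le_floor_iff)
    with fold_pt_visited[of x z c] True x z zQ lt yz alpha_le_1 show ?thesis by (simp add: fold_pt_def)
  next
    case False
    have "x \<noteq> 0" using x by auto
    then have x0: "x < 0" using False by simp
    have c1: "c - 1 \<ge> 1" using c a1 x0 unfolding c_def[symmetric] by linarith
    have xQ: "x + 1 \<notin> \<rat>" using x(3) Rats_add_int_iff[of 1 x] by (simp add: add.commute)
    have "fold_pt (x + 1, 1 / (of_int (c - 1) + z)) \<in> visited"
      by (rule fold_pt_visited) (use x x0 xQ z zQ lt c1 alpha_pos in auto)
    moreover have "1 / (of_int (c - 1) + z) / (1 + 1 / (of_int (c - 1) + z)) = y"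
    proof -
      have "of_int (c - 1) + z > 0" using c1 z by simp
      then have "1 / (of_int (c - 1) + z) / (1 + 1 / (of_int (c - 1) + z)) = 1 / (1 + (of_int (c - 1) + z))"
        by (simp add: field_simps)
      then show ?thesis using yz by simp
    qed
    ultimately show ?thesis using x by (simp add: fold_pt_def)
  qed
qed

end

section \<open>Pulling points back along accepted words\<close>

context alpha_struct
begin

lemma letter_less_neg_iff: "2 \<le> d \<Longrightarrow> 2 \<le> d' \<Longrightarrow> letter_less (-1, Fin d) (-1, Fin d') \<longleftrightarrow> d < d'"
proof -
  assume "2 \<le> d" "2 \<le> d'"
  then have "letter_less (-1, Fin d) (-1, Fin d') \<longleftrightarrow> real_of_int d < real_of_int d'"
    by (simp add: letter_less_def divide_simps)
  then show ?thesis by (simp only: of_int_less_iff)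
qed

text \<open>t -> -1/t increases on t > 0, so the preimage of x under digit d is right of
  \<open>orb c j\<close> once d + x exceeds d0 plus the next endpoint. A step (d = d0) and a reset
  (d > d0) are both instances.\<close>

lemma pull_negative:
  assumes "c \<Longrightarrow> j \<ge> 1" "enat (Suc j) < klen c" "letter_at \<alpha> (orb c j) = (-1, Fin d0)"
    "\<alpha> - 1 \<le> x" "x < \<alpha>" "2 \<le> d" "of_int d0 + orb c (Suc j) < of_int d + x"
  shows "letter_at \<alpha> (- 1 / (of_int d + x)) = (-1, Fin d)" "T \<alpha> (- 1 / (of_int d + x)) = x"
    "orb c j < - 1 / (of_int d + x)" "- 1 / (of_int d + x) < 0"
proof -
  obtain e where e: "letter_at \<alpha> (orb c j) = (-1, Fin e)" "2 \<le> e" "e \<le> D + 1"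
    "orb c (Suc j) = - 1 / orb c j - of_int e" "orb c j < 0"
    using orb_letter[of c j] assms by metis
  have d0: "e = d0" using e assms by simp
  have eq: "of_int d0 + orb c (Suc j) = - 1 / orb c j" using e d0 by simp
  have pos: "of_int d0 + orb c (Suc j) > 0" using eq e by (simp add: zero_less_divide_iff)
  have dx: "of_int d + x > 0" using assms alpha_pos by auto
  have orbeq: "orb c j = - 1 / (of_int d0 + orb c (Suc j))" using eq e by simp
  have "1 / (of_int d + x) < 1 / (of_int d0 + orb c (Suc j))"
    using assms pos dx by (intro divide_strict_left_mono) auto
  then show "orb c j < - 1 / (of_int d + x)" using orbeq by simp
  show "- 1 / (of_int d + x) < 0" using dx by simp
  show "letter_at \<alpha> (- 1 / (of_int d + x)) = (-1, Fin d)" "T \<alpha> (- 1 / (of_int d + x)) = x"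
    using T_inverse_branch[of "-1" d x \<alpha> "- 1 / (of_int d + x)"] assms dx by auto
qed

lemma pull_step:
  assumes "acc w c j" "enat (Suc j) < klen c" "orb c (Suc j) < x" "x < \<alpha>"
  obtains x1 where "letter_at \<alpha> x1 = letter_at \<alpha> (orb c j)" "T \<alpha> x1 = x" "orb c j < x1" "x1 < \<alpha>"
proof -
  have j: "c \<Longrightarrow> j \<ge> 1" using acc_True_ge_1[OF assms(1)] .
  obtain d where d: "letter_at \<alpha> (orb c j) = (-1, Fin d)" "2 \<le> d"
    using orb_letter[of c j] j assms by metis
  have "\<alpha> - 1 \<le> x" using orb_range[of c "Suc j"] assms by auto
  moreover have "of_int d + orb c (Suc j) < of_int d + x" using assms by simp
  ultimately have p: "letter_at \<alpha> (- 1 / (of_int d + x)) = (-1, Fin d)" "T \<alpha> (- 1 / (of_int d + x)) = x"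
    "orb c j < - 1 / (of_int d + x)" "- 1 / (of_int d + x) < 0"
    using pull_negative[OF j assms(2) d(1) _ assms(4) d(2)] by blast+
  have "- 1 / (of_int d + x) < \<alpha>" using p(4) alpha_pos by linarith
  with p d show ?thesis by (intro that[of "- 1 / (of_int d + x)"]) simp_all
qed

lemma pull_reset:
  assumes "acc w c j" "enat (Suc j) < klen c" "2 \<le> d" "letter_less (letter_at \<alpha> (orb c j)) (-1, Fin d)"
    "\<alpha> - 1 < x" "x < \<alpha>"
  obtains x1 where "letter_at \<alpha> x1 = (-1, Fin d)" "T \<alpha> x1 = x" "orb c j < x1" "x1 < \<alpha>"
proof -
  have j: "c \<Longrightarrow> j \<ge> 1" using acc_True_ge_1[OF assms(1)] .
  obtain d0 where d0: "letter_at \<alpha> (orb c j) = (-1, Fin d0)" "2 \<le> d0"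
    using orb_letter[of c j] j assms by metis
  have "d0 < d" using d0 assms letter_less_neg_iff by simp
  then have "real_of_int d0 + 1 \<le> of_int d" by linarith
  moreover have "orb c (Suc j) < \<alpha>" using orb_range[of c "Suc j"] by auto
  ultimately have *: "of_int d0 + orb c (Suc j) < of_int d + x" using assms by linarith
  have "\<alpha> - 1 \<le> x" using assms by simp
  note p = pull_negative[OF j assms(2) d0(1) this assms(6,3) *]
  have "- 1 / (of_int d + x) < \<alpha>" using p(4) alpha_pos by linarith
  with p show ?thesis by (intro that[of "- 1 / (of_int d + x)"]) blast+
qed

lemma visited_base:
  assumes "\<alpha> - 1 \<le> x" "x < \<alpha>" "x \<notin> \<rat>" "0 < y" "y < top_end \<alpha>" "y \<in> \<rat>"
  shows "(x, y) \<in> visited"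
proof (rule visited_if_prev_below)
  have "1 / y \<ge> of_int D + 1" using assms D_ge_1 by (simp add: top_end_eq field_simps)
  then have "\<lfloor>1 / y\<rfloor> \<ge> D + 1" by (simp add: le_floor_iff)
  then show "1 / \<alpha> < of_int \<lfloor>1 / y\<rfloor> + x" using D_bounds(2) assms(1) by linarith
  show "y < 1" using assms top_end_bounds by linarith
qed (use assms in auto)

text \<open>Right of T \<alpha> the Gauss predecessor 1/(D + x) is below \<alpha>, whatever the
  earlier past y is. This is the source of the filled interval [1/(D+1), 1/D].\<close>

lemma visited_base_plus:
  assumes "T \<alpha> \<alpha> < x" "x < \<alpha>" "x \<notin> \<rat>" "0 < y" "y < 1" "y \<in> \<rat>"
  shows "(x, 1 / (of_int D + y)) \<in> visited"
proof (rule visited_if_prev_below)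
  have "\<lfloor>of_int D + y\<rfloor> = D" using assms by (intro floor_unique) auto
  then show "1 / \<alpha> < of_int \<lfloor>1 / (1 / (of_int D + y))\<rfloor> + x" using assms T_alpha by simp
  have "T \<alpha> \<alpha> \<ge> \<alpha> - 1" using T_range[of \<alpha> \<alpha>] alpha_pos by auto
  then show "\<alpha> - 1 \<le> x" using assms by simp
  have "of_int D + y > 1" using D_ge_1 assms by auto
  then show "0 < 1 / (of_int D + y)" "1 / (of_int D + y) < 1" by auto
  show "1 / (of_int D + y) \<in> \<rat>" using assms by (simp add: Rats_one_divide_iff Rats_add_int_iff)
qed (use assms in auto)

text \<open>Pulling x back along the last letter stays in the interval of the preceding state, so
  one inducts on the word. At a letter \<open>(1, D)\<close> the induction stops, because
  \<open>visited_base_plus\<close> covers every earlier past.\<close>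

lemma visited_acc:
  assumes "acc w c j" "orb c j < x" "x < \<alpha>" "x \<notin> \<rat>" "0 < t" "t < top_end \<alpha>" "t \<in> \<rat>"
  shows "(x, bwd w t) \<in> visited"
  using assms(1-4)
proof (induction arbitrary: x rule: acc.induct)
  case acc_Nil
  then show ?case using visited_base[of x t] assms by (simp add: orb_0)
next
  case (acc_step w c j)
  from pull_step[OF acc_step(1,2,4,5)] obtain x1 where
    x1: "letter_at \<alpha> x1 = letter_at \<alpha> (orb c j)" "T \<alpha> x1 = x" "orb c j < x1" "x1 < \<alpha>" by metis
  then have "x1 \<notin> \<rat>" using acc_step.prems T_Rats_iff by metis
  then have "TT \<alpha> (x1, bwd w t) \<in> visited" using acc_step.IH x1 by (intro TT_visited)
  then show ?case using x1 by (simp add: TT_eq bwd_append)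
next
  case (acc_reset w c j d)
  have "\<alpha> - 1 < x" using acc_reset.prems by (simp add: orb_0)
  from pull_reset[OF acc_reset(1,2,3,5) this acc_reset.prems(2)] obtain x1 where
    x1: "letter_at \<alpha> x1 = (-1, Fin d)" "T \<alpha> x1 = x" "orb c j < x1" "x1 < \<alpha>" by metis
  then have "x1 \<notin> \<rat>" using acc_reset.prems T_Rats_iff by metis
  then have "TT \<alpha> (x1, bwd w t) \<in> visited" using acc_reset.IH x1 by (intro TT_visited)
  then show ?case using x1 by (simp add: TT_eq bwd_append)
next
  case (acc_plus w c j)
  have "t \<in> {0<..<1}" using assms top_end_bounds by auto
  then have "bwd w t \<in> {0<..<1}" "bwd w t \<in> \<rat>"
    using bwd_open[of w t] bwd_Rats_iff[of w t] acc_proper[OF acc_plus(1)] assms by auto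
  then have "(x, 1 / (of_int D + bwd w t)) \<in> visited"
    using acc_plus.prems by (intro visited_base_plus) (auto simp: orb_def)
  then show ?case by (simp add: bwd_append)
qed

end

text \<open>A last state, if there is one, has the interval [0, \<alpha>], so no negative point is
  left whose letter the automaton could miss.\<close>

locale alpha_good = alpha_struct +
  assumes final_orb: "enat j < klen c \<Longrightarrow> \<not> enat (Suc j) < klen c \<Longrightarrow> orb c j = 0"
begin

lemma acc_orb_cases:
  assumes "acc w c j"
  shows "enat (Suc j) < klen c \<or> orb c j = 0"
  using final_orb[of j c] acc_klen[OF assms] by blast

lemma acc_orb_le: "acc w c j \<Longrightarrow> orb c j \<le> 0"
  using acc_orb_cases[of w c j] orb_left[of c j] acc_True_ge_1[of w c j] kap_bounds by force

text \<open>For negative x right of the endpoint, -1/x is at least the same expression at the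
  endpoint; as both images lie in a window of length one, the digit of x is at least that of the
  endpoint. Equality is a step, a larger digit a reset.\<close>

lemma acc_extend_big:
  assumes "acc w c j" "orb c j \<le> x" "x < \<alpha>" "x \<notin> \<rat>" "letter_at \<alpha> x \<in> big_letters"
  shows "\<exists>c' j'. acc (w @ [letter_at \<alpha> x]) c' j' \<and> orb c' j' \<le> T \<alpha> x"
proof -
  have x0: "x \<noteq> 0" using assms by auto
  have j: "c \<Longrightarrow> j \<ge> 1" using acc_True_ge_1[OF assms(1)] .
  have range: "\<alpha> - 1 \<le> x" using orb_range[of c j] j assms by auto
  show ?thesis
  proof (cases "x > 0")
    case True
    then obtain d where d: "letter_at \<alpha> x = (1, Fin d)" "T \<alpha> x = 1 / x - of_int d"
      using letter_pos[of x] assms by auto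
    with assms have "d = D" by (auto simp: big_letters_def)
    have "1 / \<alpha> \<le> 1 / x" using True assms by (simp add: frac_le)
    then have "orb True 1 \<le> T \<alpha> x" using d \<open>d = D\<close> T_alpha by (simp add: orb_def)
    then show ?thesis using acc_plus[OF assms(1)] d \<open>d = D\<close> by auto
  next
    case False
    with x0 have neg: "x < 0" by simp
    then obtain d where d: "letter_at \<alpha> x = (-1, Fin d)" "2 \<le> d" "T \<alpha> x = - 1 / x - of_int d"
      using letter_neg[of x] range by auto
    with assms have dD: "d \<le> D + 1" by (auto simp: big_letters_def)
    have k: "enat (Suc j) < klen c" using acc_orb_cases[OF assms(1)] assms(2) neg by auto
    obtain d0 where d0: "letter_at \<alpha> (orb c j) = (-1, Fin d0)" "2 \<le> d0"
      "orb c (Suc j) = - 1 / orb c j - of_int d0" "orb c j < 0"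
      using orb_letter[of c j] j k by metis
    have "1 / (- orb c j) \<le> 1 / (- x)" using neg assms d0 by (intro frac_le) auto
    then have le: "of_int d0 + orb c (Suc j) \<le> of_int d + T \<alpha> x" using d d0 by simp
    have Tx: "T \<alpha> x \<in> {\<alpha> - 1..<\<alpha>}" using T_range x0 by auto
    have "orb c (Suc j) \<ge> \<alpha> - 1" using orb_range[of c "Suc j"] by auto
    then have "real_of_int d0 < of_int d + 1" using le Tx by auto
    then have "d0 \<le> d" by linarith
    show ?thesis
    proof (cases "d0 = d")
      case True
      then have "orb c (Suc j) \<le> T \<alpha> x" using le by simp
      moreover have "acc (w @ [letter_at \<alpha> x]) c (Suc j)" using acc_step[OF assms(1) k] True d(1) d0(1) by simp
      ultimately show ?thesis by blast
    next
      case False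
      then have "letter_less (letter_at \<alpha> (orb c j)) (-1, Fin d)"
        using \<open>d0 \<le> d\<close> d d0 letter_less_neg_iff by simp
      from acc_reset[OF assms(1) k d(2) dD this] have "acc (w @ [letter_at \<alpha> x]) False 0" using d(1) by simp
      moreover have "orb False 0 \<le> T \<alpha> x" using Tx by (simp add: orb_0)
      ultimately show ?thesis by blast
    qed
  qed
qed

end

context alpha_expansion
begin

lemma small_letter:
  assumes "\<alpha> - 1 \<le> x" "x < \<alpha>" "x \<noteq> 0" "0 \<le> y" "y \<le> 1"
    "letter_at \<alpha> x \<notin> {(-1, Fin d) | d. 2 \<le> d \<and> d \<le> D + 1} \<union> {(1, Fin D)}"
  shows "bwd_letter (letter_at \<alpha> x) y \<in> {0..top_end \<alpha>}"
proof (cases "x > 0")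
  case True
  then obtain d where d: "letter_at \<alpha> x = (1, Fin d)" "d \<ge> D"
    using letter_pos[of x] assms by auto
  with assms have "d > D" by force
  then have "of_int D + 1 \<le> of_int d + y" using assms by linarith
  then show ?thesis using d D_ge_1 assms by (simp add: top_end_eq frac_le)
next
  case False
  with assms have neg: "x < 0" by simp
  then obtain d where d: "letter_at \<alpha> x = (-1, Fin d)" "2 \<le> d"
    using letter_neg[of x] assms by auto
  with assms have "d \<ge> D + 2" by force
  then have "of_int D + 1 \<le> of_int d - y" using assms by linarith
  then show ?thesis using d D_ge_1 assms by (simp add: top_end_eq frac_le)
qed

end

context alpha_good
begin

text \<open>A letter outside \<open>big_letters\<close> lands in
  [0, \<open>top_end \<alpha>\<close>], so its result becomes the parameter of the empty word and
  the history starts afresh in the initial state.\<close>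

lemma acc_extend:
  assumes "acc w c j" "orb c j \<le> x" "x < \<alpha>" "x \<notin> \<rat>" "t \<in> {0..top_end \<alpha>}"
  shows "\<exists>w' c' j' t'. acc w' c' j' \<and> orb c' j' \<le> T \<alpha> x \<and> t' \<in> {0..top_end \<alpha>}
     \<and> bwd_letter (letter_at \<alpha> x) (bwd w t) = bwd w' t'"
proof (cases "letter_at \<alpha> x \<in> big_letters")
  case True
  from acc_extend_big[OF assms(1-4) True] obtain c' j' where
    "acc (w @ [letter_at \<alpha> x]) c' j'" "orb c' j' \<le> T \<alpha> x" by auto
  then show ?thesis using assms
    by (intro exI[of _ "w @ [letter_at \<alpha> x]"] exI[of _ c'] exI[of _ j'] exI[of _ t]) (auto simp: bwd_append)
next
  case False
  have "\<alpha> - 1 \<le> x" using orb_range[of c j] acc_True_ge_1[OF assms(1)] assms by auto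
  moreover have "bwd w t \<in> {0..1}" using bwd_range[of w t] acc_proper[OF assms(1)] assms top_end_bounds by auto
  moreover have "x \<noteq> 0" using assms by auto
  ultimately have "bwd_letter (letter_at \<alpha> x) (bwd w t) \<in> {0..top_end \<alpha>}"
    using small_letter[of x "bwd w t"] False assms by (auto simp: big_letters_def)
  moreover have "\<alpha> - 1 \<le> T \<alpha> x" using T_range[of x] \<open>x \<noteq> 0\<close> by auto
  ultimately show ?thesis
    by (intro exI[of _ "[]"] exI[of _ False] exI[of _ 0] exI[of _ "bwd_letter (letter_at \<alpha> x) (bwd w t)"])
      (auto simp: orb_0 acc_Nil)
qed

lemma acc_orbit:
  assumes "\<alpha> - 1 \<le> x" "x < \<alpha>" "x \<notin> \<rat>" "t \<in> {0..top_end \<alpha>}"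
  shows "\<exists>w c j t'. acc w c j \<and> orb c j \<le> (T \<alpha> ^^ n) x \<and> t' \<in> {0..top_end \<alpha>}
     \<and> bwd (itin \<alpha> x n) t = bwd w t'"
proof (induction n)
  case 0
  then show ?case using assms by (intro exI[of _ "[]"] exI[of _ False] exI[of _ 0] exI[of _ t]) (auto simp: orb_0 acc_Nil)
next
  case (Suc n)
  then obtain w c j t' where *: "acc w c j" "orb c j \<le> (T \<alpha> ^^ n) x" "t' \<in> {0..top_end \<alpha>}"
     "bwd (itin \<alpha> x n) t = bwd w t'" by auto
  have "(T \<alpha> ^^ n) x < \<alpha>" using T_pow_range[of x n] assms by auto
  moreover have "(T \<alpha> ^^ n) x \<notin> \<rat>" using assms T_pow_Rats_iff by metis
  ultimately show ?case using acc_extend[OF *(1,2) _ _ *(3)] *(4) by (simp add: itin_Suc bwd_append)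
qed

lemma visited_in_cell:
  assumes "(x, y) \<in> visited" "x \<notin> \<rat>"
  shows "\<exists>w c j. acc w c j \<and> orb c j \<le> x \<and> y \<in> cell w"
proof -
  obtain n x0 where n: "(TT \<alpha> ^^ n) (x0, 0) = (x, y)" "\<alpha> - 1 \<le> x0" "x0 < \<alpha>"
    using assms by (auto simp: visited_def)
  then have "(T \<alpha> ^^ n) x0 = x" "y = bwd (itin \<alpha> x0 n) 0" by (auto simp: TT_pow)
  moreover have "x0 \<notin> \<rat>" using calculation assms T_pow_Rats_iff by metis
  moreover from this obtain w c j t where "acc w c j" "orb c j \<le> (T \<alpha> ^^ n) x0" "t \<in> {0..top_end \<alpha>}"
    "bwd (itin \<alpha> x0 n) 0 = bwd w t"
    using acc_orbit[of x0 0 n] n top_end_bounds by auto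
  ultimately show ?thesis unfolding cell_def by blast
qed

lemma acc_itin:
  assumes "\<alpha> - 1 \<le> x" "x < \<alpha>" "x \<notin> \<rat>" "itin \<alpha> x n \<in> lists big_letters"
  shows "\<exists>c j. acc (itin \<alpha> x n) c j \<and> orb c j \<le> (T \<alpha> ^^ n) x"
  using assms(4)
proof (induction n)
  case 0
  then show ?case using assms by (intro exI[of _ False] exI[of _ 0]) (auto simp: orb_0 acc_Nil)
next
  case (Suc n)
  then obtain c j where *: "acc (itin \<alpha> x n) c j" "orb c j \<le> (T \<alpha> ^^ n) x" by (auto simp: itin_Suc)
  have "(T \<alpha> ^^ n) x < \<alpha>" using T_pow_range[of x n] assms by auto
  moreover have "(T \<alpha> ^^ n) x \<notin> \<rat>" using assms T_pow_Rats_iff by metis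
  ultimately show ?case using acc_extend_big[OF *] Suc.prems by (simp add: itin_Suc)
qed

text \<open>Each accepted word is the itinerary of an actual point. At a letter
  \<open>(1, D)\<close> the preimage is positive while endpoints of states are at most 0, so it lies
  in the interval of the preceding state whichever that is.\<close>

lemma acc_pull:
  assumes "acc w c j" "orb c j < x" "x < \<alpha>" "x \<notin> \<rat>"
  obtains x0 where "\<alpha> - 1 \<le> x0" "x0 < \<alpha>" "x0 \<notin> \<rat>" "(T \<alpha> ^^ length w) x0 = x" "itin \<alpha> x0 (length w) = w"
proof -
  have *: "\<exists>x0. \<alpha> - 1 \<le> x0 \<and> x0 < \<alpha> \<and> (T \<alpha> ^^ length w) x0 = x \<and> itin \<alpha> x0 (length w) = w"
    using assms(1-3)
  proof (induction arbitrary: x rule: acc.induct)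
    case acc_Nil
    then show ?case by (intro exI[of _ x]) (auto simp: orb_0)
  next
    case (acc_step w c j)
    from pull_step[OF acc_step(1,2,4,5)] obtain x1 where
      x1: "letter_at \<alpha> x1 = letter_at \<alpha> (orb c j)" "T \<alpha> x1 = x" "orb c j < x1" "x1 < \<alpha>" by metis
    from acc_step.IH[OF x1(3,4)] x1 show ?case by (auto simp: itin_Suc)
  next
    case (acc_reset w c j d)
    have "\<alpha> - 1 < x" using acc_reset.prems by (simp add: orb_0)
    from pull_reset[OF acc_reset(1,2,3,5) this acc_reset.prems(2)] obtain x1 where
      x1: "letter_at \<alpha> x1 = (-1, Fin d)" "T \<alpha> x1 = x" "orb c j < x1" "x1 < \<alpha>" by metis
    from acc_reset.IH[OF x1(3,4)] x1 show ?case by (auto simp: itin_Suc)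
  next
    case (acc_plus w c j)
    have Tx: "T \<alpha> \<alpha> < x" using acc_plus.prems by (simp add: orb_def)
    then have lt: "1 / \<alpha> < of_int D + x" using T_alpha by simp
    have pos: "of_int D + x > 0" using lt alpha_pos by (meson less_trans zero_less_divide_1_iff)
    have "\<alpha> - 1 \<le> x" using Tx T_range[of \<alpha> \<alpha>] alpha_pos by auto
    then have x1: "letter_at \<alpha> (1 / (of_int D + x)) = (1, Fin D)" "T \<alpha> (1 / (of_int D + x)) = x"
      using T_inverse_branch[of 1 D x \<alpha> "1 / (of_int D + x)"] pos acc_plus.prems by auto
    have "1 / (of_int D + x) > 0" using pos by simp
    then have "orb c j < 1 / (of_int D + x)" using acc_orb_le[OF acc_plus(1)] by linarith
    moreover have "1 / (of_int D + x) < \<alpha>" using lt pos alpha_pos by (simp add: field_simps)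
    ultimately show ?case using acc_plus.IH[of "1 / (of_int D + x)"] x1 by (auto simp: itin_Suc)
  qed
  then obtain x0 where "\<alpha> - 1 \<le> x0" "x0 < \<alpha>" "(T \<alpha> ^^ length w) x0 = x" "itin \<alpha> x0 (length w) = w" by auto
  then show ?thesis using that[of x0] assms(4) T_pow_Rats_iff by metis
qed

lemma acc_orb_less: "acc w c j \<Longrightarrow> orb c j < \<alpha>"
  using acc_orb_le[of w c j] alpha_pos by linarith

text \<open>A suffix is the itinerary of a later point on an orbit that realises the word, and
  itineraries in big letters are accepted. Dynamics is used because dropping letters changes the
  state of the automaton.\<close>

lemma acc_drop:
  assumes "acc w c j"
  shows "\<exists>c' j'. acc (drop m w) c' j'"
proof (cases "m \<le> length w")
  case True
  obtain x where x: "orb c j < x" "x < \<alpha>" "x \<notin> \<rat>" using irrational_between[OF acc_orb_less[OF assms]] by auto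
  obtain x0 where x0: "\<alpha> - 1 \<le> x0" "x0 < \<alpha>" "x0 \<notin> \<rat>" "(T \<alpha> ^^ length w) x0 = x" "itin \<alpha> x0 (length w) = w"
    using acc_pull[OF assms x] .
  have "drop m w = itin \<alpha> ((T \<alpha> ^^ m) x0) (length w - m)" using itin_drop[OF True, of \<alpha> x0] x0 by simp
  moreover have "drop m w \<in> lists big_letters" using acc_big_letters[OF assms] by (auto dest: in_set_dropD)
  moreover have "(T \<alpha> ^^ m) x0 \<in> {\<alpha> - 1..<\<alpha>}" using T_pow_range[of x0 m] x0 by auto
  moreover have "(T \<alpha> ^^ m) x0 \<notin> \<rat>" using x0 T_pow_Rats_iff by metis
  ultimately show ?thesis using acc_itin[of "(T \<alpha> ^^ m) x0" "length w - m"] by auto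
next
  case False
  then show ?thesis using acc_Nil by auto
qed

end

subsection \<open>Disjointness of the cells\<close>

lemma Rats_closure_interval: "a < b \<Longrightarrow> {a..b} \<subseteq> closure ({a<..<b} \<inter> \<rat>)" for a b :: real
proof -
  assume "a < b"
  have "{a<..<b} \<subseteq> closure ({a<..<b} \<inter> \<rat>)"
    using open_Int_closure_subset[of "{a<..<b}" \<rat>] Rats_closure_real by auto
  then have "closure {a<..<b} \<subseteq> closure ({a<..<b} \<inter> \<rat>)" by (simp add: closure_minimal)
  with \<open>a < b\<close> show ?thesis by simp
qed

lemma bwd_letter_interval:
  assumes "a \<in> proper_letters" "0 \<le> l" "l < r" "r \<le> 1"
  shows "\<exists>l' r'. 0 \<le> l' \<and> l' < r' \<and> r' \<le> 1 \<and> bwd_letter a ` {l<..<r} = {l'<..<r'} \<and> bwd_letter a ` {l..r} = {l'..r'}"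
proof -
  consider d where "a = (-1, Fin d)" "d \<ge> 2" | d where "a = (1, Fin d)" "d \<ge> 1"
    using assms by (auto simp: proper_letters_def)
  then show ?thesis
  proof cases
    case 1
    have pos: "of_int d - y \<ge> 1" if "y \<le> 1" for y :: real using that 1 by auto
    have inv: "z = 1 / (of_int d - (of_int d - 1 / z))" for z :: real by simp
    have "(\<lambda>y. 1 / (of_int d - y)) ` {l<..<r} = {1 / (of_int d - l)<..<1 / (of_int d - r)}"
    proof (intro equalityI subsetI)
      fix z assume "z \<in> (\<lambda>y. 1 / (of_int d - y)) ` {l<..<r}"
      then obtain y where "z = 1 / (of_int d - y)" "l < y" "y < r" by auto
      then show "z \<in> {1 / (of_int d - l)<..<1 / (of_int d - r)}"
        using pos[of y] pos[of l] pos[of r] assms by (auto intro!: frac_less2)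
    next
      fix z assume z: "z \<in> {1 / (of_int d - l)<..<1 / (of_int d - r)}"
      moreover have "0 < 1 / (of_int d - l)" using pos[of l] assms by simp
      ultimately have z0: "z > 0" by (meson greaterThanLessThan_iff less_trans)
      have "1 / z < of_int d - l" "of_int d - r < 1 / z"
        using z z0 pos[of l] pos[of r] assms by (auto simp: field_simps)
      with inv[of z] show "z \<in> (\<lambda>y. 1 / (of_int d - y)) ` {l<..<r}" by (intro image_eqI[of _ _ "of_int d - 1 / z"]) auto
    qed
    moreover have "(\<lambda>y. 1 / (of_int d - y)) ` {l..r} = {1 / (of_int d - l)..1 / (of_int d - r)}"
    proof (intro equalityI subsetI)
      fix z assume "z \<in> (\<lambda>y. 1 / (of_int d - y)) ` {l..r}"
      then obtain y where "z = 1 / (of_int d - y)" "l \<le> y" "y \<le> r" by auto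
      then show "z \<in> {1 / (of_int d - l)..1 / (of_int d - r)}"
        using pos[of y] pos[of l] pos[of r] assms by (auto intro!: frac_le)
    next
      fix z assume z: "z \<in> {1 / (of_int d - l)..1 / (of_int d - r)}"
      moreover have "0 < 1 / (of_int d - l)" using pos[of l] assms by simp
      ultimately have z0: "z > 0" by (meson atLeastAtMost_iff less_le_trans)
      have "1 / z \<le> of_int d - l" "of_int d - r \<le> 1 / z"
        using z z0 pos[of l] pos[of r] assms by (auto simp: field_simps)
      with inv[of z] show "z \<in> (\<lambda>y. 1 / (of_int d - y)) ` {l..r}" by (intro image_eqI[of _ _ "of_int d - 1 / z"]) auto
    qed
    moreover have "0 \<le> 1 / (of_int d - l)" "1 / (of_int d - l) < 1 / (of_int d - r)" "1 / (of_int d - r) \<le> 1"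
      using pos[of l] pos[of r] assms by (auto intro!: frac_less2)
    ultimately show ?thesis using 1 by auto
  next
    case 2
    have pos: "of_int d + y \<ge> 1" if "0 \<le> y" for y :: real using that 2 by auto
    have inv: "z = 1 / (of_int d + (1 / z - of_int d))" for z :: real by simp
    have pos': "of_int d + r > 1" using assms 2 by auto
    have "(\<lambda>y. 1 / (of_int d + y)) ` {l<..<r} = {1 / (of_int d + r)<..<1 / (of_int d + l)}"
    proof (intro equalityI subsetI)
      fix z assume "z \<in> (\<lambda>y. 1 / (of_int d + y)) ` {l<..<r}"
      then obtain y where "z = 1 / (of_int d + y)" "l < y" "y < r" by auto
      then show "z \<in> {1 / (of_int d + r)<..<1 / (of_int d + l)}"
        using pos[of y] pos[of l] pos' assms by (auto intro!: frac_less2)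
    next
      fix z assume z: "z \<in> {1 / (of_int d + r)<..<1 / (of_int d + l)}"
      moreover have "0 < 1 / (of_int d + r)" using pos' by simp
      ultimately have z0: "z > 0" by (meson greaterThanLessThan_iff less_trans)
      have "1 / z < of_int d + r" "of_int d + l < 1 / z"
        using z z0 pos[of l] pos' assms by (auto simp: field_simps)
      with inv[of z] show "z \<in> (\<lambda>y. 1 / (of_int d + y)) ` {l<..<r}" by (intro image_eqI[of _ _ "1 / z - of_int d"]) auto
    qed
    moreover have "(\<lambda>y. 1 / (of_int d + y)) ` {l..r} = {1 / (of_int d + r)..1 / (of_int d + l)}"
    proof (intro equalityI subsetI)
      fix z assume "z \<in> (\<lambda>y. 1 / (of_int d + y)) ` {l..r}"
      then obtain y where "z = 1 / (of_int d + y)" "l \<le> y" "y \<le> r" by auto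
      then show "z \<in> {1 / (of_int d + r)..1 / (of_int d + l)}"
        using pos[of y] pos[of l] pos' assms by (auto intro!: frac_le)
    next
      fix z assume z: "z \<in> {1 / (of_int d + r)..1 / (of_int d + l)}"
      moreover have "0 < 1 / (of_int d + r)" using pos' by simp
      ultimately have z0: "z > 0" by (meson atLeastAtMost_iff less_le_trans)
      have "1 / z \<le> of_int d + r" "of_int d + l \<le> 1 / z"
        using z z0 pos[of l] pos' assms by (auto simp: field_simps)
      with inv[of z] show "z \<in> (\<lambda>y. 1 / (of_int d + y)) ` {l..r}" by (intro image_eqI[of _ _ "1 / z - of_int d"]) auto
    qed
    moreover have "0 \<le> 1 / (of_int d + r)" "1 / (of_int d + r) < 1 / (of_int d + l)" "1 / (of_int d + l) \<le> 1"
      using pos[of l] pos' assms by (auto intro!: frac_less2)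
    ultimately show ?thesis using 2 by auto
  qed
qed

lemma bwd_interval:
  assumes "w \<in> lists proper_letters" "0 \<le> l" "l < r" "r \<le> 1"
  obtains l' r' where "0 \<le> l'" "l' < r'" "r' \<le> 1" "bwd w ` {l<..<r} = {l'<..<r'}" "bwd w ` {l..r} = {l'..r'}"
proof -
  have "\<exists>l' r'. 0 \<le> l' \<and> l' < r' \<and> r' \<le> 1 \<and> bwd w ` {l<..<r} = {l'<..<r'} \<and> bwd w ` {l..r} = {l'..r'}"
    using assms
  proof (induction arbitrary: l r rule: lists.induct)
    case Nil
    then show ?case by auto
  next
    case (Cons a w)
    from bwd_letter_interval[OF Cons.hyps(1) Cons.prems] obtain l1 r1 where
      1: "0 \<le> l1" "l1 < r1" "r1 \<le> 1" "bwd_letter a ` {l<..<r} = {l1<..<r1}" "bwd_letter a ` {l..r} = {l1..r1}" by auto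
    have "bwd (a # w) ` A = bwd w ` (bwd_letter a ` A)" for A by (simp add: image_image)
    with Cons.IH[OF 1(1-3)] 1(4,5) show ?case by simp
  qed
  with that show thesis by auto
qed

lemma bwd_letter_contract:
  assumes "a \<in> proper_letters" "y \<in> {0<..<1}" "y' \<in> {0<..<1}" "y \<noteq> y'"
  shows "\<bar>bwd_letter a y - bwd_letter a y'\<bar> < \<bar>y - y'\<bar>"
proof -
  obtain e d where a: "a = (e, Fin d)" "e = 1 \<or> e = -1" and pos: "of_int d + of_int e * y > 1" "of_int d + of_int e * y' > 1"
    using assms by (auto simp: proper_letters_def)
  define p q where "p = of_int d + of_int e * y" and "q = of_int d + of_int e * y'"
  have pq: "p > 1" "q > 1" using pos p_def q_def by auto
  then have 1: "p * q > 1" by (simp add: less_1_mult)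
  have "bwd_letter a y - bwd_letter a y' = (q - p) / (p * q)"
  proof -
    have "bwd_letter a y = 1 / p" "bwd_letter a y' = 1 / q" by (simp_all add: a p_def q_def)
    then show ?thesis using pq by (simp add: diff_frac_eq mult.commute)
  qed
  then have "\<bar>bwd_letter a y - bwd_letter a y'\<bar> = \<bar>y - y'\<bar> / (p * q)"
  proof -
    have "q - p = of_int e * (y' - y)" by (simp add: p_def q_def algebra_simps)
    then have "\<bar>q - p\<bar> = \<bar>y - y'\<bar>" using a(2) by auto
    then show ?thesis using \<open>bwd_letter a y - bwd_letter a y' = (q - p) / (p * q)\<close> 1 by (simp add: abs_divide)
  qed
  also have "\<dots> < \<bar>y - y'\<bar>" using 1 assms(4) by (simp add: field_simps)
  finally show ?thesis .
qed

lemma bwd_letter_inj: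
  assumes "a \<in> proper_letters" "y \<in> {0..1}" "y' \<in> {0..1}" "bwd_letter a y = bwd_letter a y'"
  shows "y = y'"
  using assms by (auto simp: proper_letters_def)

lemma bwd_contract:
  assumes "w \<in> lists proper_letters" "w \<noteq> []" "y \<in> {0<..<1}" "y' \<in> {0<..<1}" "y \<noteq> y'"
  shows "\<bar>bwd w y - bwd w y'\<bar> < \<bar>y - y'\<bar>"
  using assms
proof (induction arbitrary: y y' rule: lists.induct)
  case (Cons a w)
  have 1: "bwd_letter a y \<in> {0<..<1}" "bwd_letter a y' \<in> {0<..<1}"
    using Cons bwd_letter_open by blast+
  have 2: "bwd_letter a y \<noteq> bwd_letter a y'"
    using bwd_letter_inj[OF Cons.hyps(1), of y y'] Cons.prems by auto
  have 3: "\<bar>bwd_letter a y - bwd_letter a y'\<bar> < \<bar>y - y'\<bar>"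
    using bwd_letter_contract Cons by blast
  show ?case
  proof (cases "w = []")
    case False
    from Cons.IH[OF False 1 2] 3 show ?thesis by simp
  qed (use 3 in simp)
qed simp

text \<open>A nonempty word strictly contracts distances in (0,1), so it has at most one fixed point
  there, and there are countably many words. A second coordinate outside this set can never recur
  together with its first coordinate.\<close>

lemma countable_fixed_points:
  "countable {z. z \<in> {0<..<1} \<and> (\<exists>v \<in> lists proper_letters. v \<noteq> [] \<and> bwd v z = z)}"
proof -
  have "proper_letters \<subseteq> (\<lambda>(e, d). (e, Fin d)) ` UNIV" by (auto simp: proper_letters_def)
  then have "countable proper_letters" using countable_subset by (metis countableI_type countable_image)
  then have "countable (\<Union>v \<in> lists proper_letters - {[]}. {z. z \<in> {0<..<1} \<and> bwd v z = z})"
  proof (intro countable_UN countable_lists countable_Diff)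
    fix v assume v: "v \<in> lists proper_letters - {[]}"
    have "z = z'" if "z \<in> {0<..<1}" "bwd v z = z" "z' \<in> {0<..<1}" "bwd v z' = z'" for z z'
      using bwd_contract[of v z z'] v that by auto
    then have "finite {z. z \<in> {0<..<1} \<and> bwd v z = z}"
      by (cases "\<exists>z. z \<in> {0<..<1} \<and> bwd v z = z") (auto intro: finite_subset[of _ "{_}"])
    then show "countable {z. z \<in> {0<..<1} \<and> bwd v z = z}" by (rule countable_finite)
  qed
  then show ?thesis by (rule countable_subset[rotated]) auto
qed

context alpha_expansion
begin

lemma letter_at_proper:
  assumes "\<alpha> - 1 \<le> x" "x < \<alpha>" "x \<noteq> 0"
  shows "letter_at \<alpha> x \<in> proper_letters"
proof (cases "x > 0")
  case True
  with assms obtain d where "letter_at \<alpha> x = (1, Fin d)" "d \<ge> D" by (auto intro: letter_pos[of x])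
  then show ?thesis using D_ge_1 by (auto simp: proper_letters_def)
next
  case False
  with assms have "x < 0" by simp
  with assms obtain d where "letter_at \<alpha> x = (-1, Fin d)" "d \<ge> 2" by (auto intro: letter_neg[of x])
  then show ?thesis by (auto simp: proper_letters_def)
qed

lemma itin_proper:
  assumes "\<alpha> - 1 \<le> x" "x < \<alpha>" "x \<notin> \<rat>"
  shows "itin \<alpha> x n \<in> lists proper_letters"
proof (induction n)
  case (Suc n)
  have "(T \<alpha> ^^ n) x \<in> {\<alpha> - 1..<\<alpha>}" using T_pow_range[of x n] assms by auto
  moreover have "(T \<alpha> ^^ n) x \<notin> \<rat>" using assms T_pow_Rats_iff by metis
  then have "(T \<alpha> ^^ n) x \<noteq> 0" by auto
  ultimately show ?case using Suc letter_at_proper by (auto simp: itin_Suc)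
qed simp

text \<open>Below \<open>top_end \<alpha>\<close> the integer part e of 1/t is at least D+1, so 1/(e
  + x) is in (0, \<alpha>) for every x of the window. The result is a starting point at which folded
  and Gauss coordinates coincide.\<close>

lemma gauss_predecessor:
  assumes "\<alpha> - 1 \<le> x" "x < \<alpha>" "x \<notin> \<rat>" "0 < t" "t < top_end \<alpha>" "t \<notin> \<rat>"
  obtains p where "p \<in> cusp_free" "fst p < \<alpha>" "fst p > 0" "TT \<alpha> p = (x, t)"
proof -
  define e where "e = \<lfloor>1 / t\<rfloor>"
  define s where "s = frac (1 / t)"
  have t: "1 / t = of_int e + s" by (simp add: e_def s_def frac_def)
  have "1 / t \<ge> of_int D + 1" using assms D_ge_1 by (simp add: top_end_eq field_simps)
  then have e: "e \<ge> D + 1" unfolding e_def by (simp add: le_floor_iff)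
  have "1 / t \<notin> \<rat>" using assms by (simp add: Rats_one_divide_iff)
  then have sQ: "s \<notin> \<rat>" unfolding t by (simp add: Rats_add_int_iff)
  moreover have "0 \<le> s" "s < 1" by (auto simp: s_def frac_lt_1)
  ultimately have s: "0 < s" "s < 1" by (auto simp: less_le)
  have "of_int e \<ge> real_of_int D + 1" using e by linarith
  then have big: "of_int e + x > 1 / \<alpha>" using D_bounds(2) assms by linarith
  have a1: "0 < 1 / \<alpha>" using alpha_pos by simp
  define u where "u = 1 / (of_int e + x)"
  have ex: "0 < of_int e + x" using a1 big by (rule less_trans)
  have u: "0 < u" "u < \<alpha>"
  proof -
    show "0 < u" using ex by (simp add: u_def)
    have "1 / (of_int e + x) < 1 / (1 / \<alpha>)" using a1 big by (intro frac_less2) auto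
    then show "u < \<alpha>" by (simp add: u_def)
  qed
  have uQ: "u \<notin> \<rat>" using assms by (simp add: u_def Rats_one_divide_iff Rats_add_int_iff)
  have "TT \<alpha> (u, s) = (x, 1 / (of_int e + of_int 1 * s))"
    by (rule TT_inverse_branch) (use assms ex u_def in auto)
  also have "1 / (of_int e + of_int 1 * s) = t" by (simp flip: t)
  finally show ?thesis using that[of "(u, s)"] u uQ s alpha_le_1 by (auto simp: cusp_free_def)
qed

lemma TT_pow_Suc: "TT \<alpha> p = q \<Longrightarrow> (TT \<alpha> ^^ Suc n) p = (TT \<alpha> ^^ n) q"
  by (simp add: funpow_Suc_right del: funpow.simps(2))

lemma fold_pt_below: "fst p < \<alpha> \<Longrightarrow> fold_pt p = p"
  by (cases p) (simp add: fold_pt_def)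

end

context alpha_good
begin

lemma bwd_last_big:
  assumes "v \<in> lists big_letters" "v \<noteq> []" "t \<in> {0..1}"
  shows "top_end \<alpha> \<le> bwd v t"
proof -
  obtain u a where v: "v = u @ [a]" using assms(2) by (metis append_butlast_last_id)
  have "bwd u t \<in> {0..1}" using bwd_range[of u t] assms v big_letters_proper by auto
  with bwd_letter_big[of a "bwd u t"] assms v show ?thesis by (simp add: bwd_append)
qed

text \<open>Two cells through the same generic point have pasts that merge at a point with first
  coordinate below \<open>\<alpha>\<close>; the shorter past is then a suffix of the longer one, and the
  remaining prefix would have to consist of letters that lead out of \<open>[0, top_end \<alpha>]\<close>.\<close>

lemma same_cell_aux:
  assumes w: "itin \<alpha> x0 n \<in> lists big_letters" and w': "itin \<alpha> x0' n' \<in> lists big_letters"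
    and p: "p \<in> cusp_free" "fst p < \<alpha>" "fst p > 0" "TT \<alpha> p = (x0, t)"
    and p': "p' \<in> cusp_free" "fst p' < \<alpha>" "fst p' > 0" "TT \<alpha> p' = (x0', t')"
    and m: "(gauss2 ^^ m) p = (x, z)" "(gauss2 ^^ m') p' = (x, z)" "m \<le> m'"
    and n: "(TT \<alpha> ^^ n) (x0, t) = (x, z)" "(TT \<alpha> ^^ n') (x0', t') = (x, z)"
    and t: "t < top_end \<alpha>" "t' \<in> {0..1}"
    and gen: "\<And>j. j > 0 \<Longrightarrow> (TT \<alpha> ^^ j) (x, z) \<noteq> (x, z)"
  shows "itin \<alpha> x0 n = itin \<alpha> x0' n'"
proof -
  have "(gauss2 ^^ m) ((gauss2 ^^ (m' - m)) p') = (gauss2 ^^ m') p'"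
    using m(3) by (metis comp_apply funpow_add le_add_diff_inverse)
  then have "(gauss2 ^^ m) p = (gauss2 ^^ m) ((gauss2 ^^ (m' - m)) p')" using m by simp
  then have pp: "p = (gauss2 ^^ (m' - m)) p'"
    using gauss2_pow_inj[OF p(1) gauss2_pow_cusp_free[OF p'(1)]] by metis
  obtain u' z' where p'_eq: "p' = (u', z')" by force
  have "\<exists>k\<ge>1. (TT \<alpha> ^^ k) (fold_pt (u', z')) = fold_pt (gauss2 p)"
    by (rule TT_orbit_meets) (use p'(1) p'_eq pp p(2) in \<open>auto simp: cusp_free_def\<close>)
  then obtain i where i: "(TT \<alpha> ^^ Suc i) p' = fold_pt (gauss2 p)"
    using fold_pt_below[OF p'(2)] p'_eq by (metis One_nat_def Suc_le_D)
  have "fold_pt (gauss2 p) = TT \<alpha> p"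
    using TT_fold_below[of "fst p" "snd p"] p by (auto simp: cusp_free_def)
  then have i: "(TT \<alpha> ^^ i) (x0', t') = (x0, t)" using i p(4) TT_pow_Suc[OF p'(4)] by metis
  have ni: "(TT \<alpha> ^^ (n + i)) (x0', t') = (x, z)" using i n by (simp add: funpow_add)
  \<comment> \<open>Both numbers are times at which the orbit of (x0', t') is at (x, z), a point
    that never recurs.\<close>
  have eq: "n + i = n'"
  proof (rule ccontr)
    assume ne: "n + i \<noteq> n'"
    have *: False if "a < b" "(TT \<alpha> ^^ a) (x0', t') = (x, z)" "(TT \<alpha> ^^ b) (x0', t') = (x, z)" for a b
    proof -
      have "(TT \<alpha> ^^ (b - a)) (x, z) = (TT \<alpha> ^^ (b - a + a)) (x0', t')" unfolding funpow_add using that by simp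
      also have "b - a + a = b" using that by simp
      also have "(TT \<alpha> ^^ b) (x0', t') = (x, z)" using that by simp
      finally show False using gen[of "b - a"] that by simp
    qed
    show False using ne *[OF _ ni n(2)] *[OF _ n(2) ni] by linarith
  qed
  have x0: "(T \<alpha> ^^ i) x0' = x0" "bwd (itin \<alpha> x0' i) t' = t" using i by (auto simp: TT_pow)
  have split: "itin \<alpha> x0' n' = itin \<alpha> x0' i @ itin \<alpha> x0 n"
    using itin_add[of \<alpha> x0' i n] x0 eq by (simp add: add.commute)
  then have "itin \<alpha> x0' i \<in> lists big_letters" using w' by auto
  then have "itin \<alpha> x0' i = []" using bwd_last_big[of "itin \<alpha> x0' i" t'] x0(2) t by fastforce
  with split show ?thesis by simp
qed

text \<open>Open cells that meet share an interval, which contains an irrational z fixed by no word.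
  The two cells give two histories of the same point over z, and such histories must
  coincide.\<close>

lemma cells_disjoint:
  assumes "acc w c j" "acc w' c' j'" "w \<noteq> w'"
  shows "bwd w ` {0<..<top_end \<alpha>} \<inter> bwd w' ` {0<..<top_end \<alpha>} = {}"
proof (rule ccontr)
  assume "bwd w ` {0<..<top_end \<alpha>} \<inter> bwd w' ` {0<..<top_end \<alpha>} \<noteq> {}"
  then obtain z0 where z0: "z0 \<in> bwd w ` {0<..<top_end \<alpha>}" "z0 \<in> bwd w' ` {0<..<top_end \<alpha>}" by auto
  have top: "0 < top_end \<alpha>" "top_end \<alpha> \<le> 1" using top_end_bounds by auto
  obtain l r where lr: "0 \<le> l" "l < r" "r \<le> 1" "bwd w ` {0<..<top_end \<alpha>} = {l<..<r}"
    using bwd_interval[OF acc_proper[OF assms(1)] _ top] by (metis order_refl)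
  obtain l' r' where lr': "0 \<le> l'" "l' < r'" "r' \<le> 1" "bwd w' ` {0<..<top_end \<alpha>} = {l'<..<r'}"
    using bwd_interval[OF acc_proper[OF assms(2)] _ top] by (metis order_refl)
  define F where "F = {z. z \<in> {0<..<1} \<and> (\<exists>v \<in> lists proper_letters. v \<noteq> [] \<and> bwd v z = (z::real))}"
  have "max l l' < min r r'" using z0 lr lr' by auto
  then have "uncountable {max l l'<..<min r r'}" by (simp only: uncountable_open_interval)
  moreover have "countable (F \<union> \<rat>)" using countable_fixed_points countable_rat by (simp add: F_def)
  ultimately have "\<not> {max l l'<..<min r r'} \<subseteq> F \<union> \<rat>" using countable_subset by blast
  then obtain z where "z \<in> {max l l'<..<min r r'}" "z \<notin> F \<union> \<rat>" by blast
  then have z: "z \<in> {l<..<r}" "z \<in> {l'<..<r'}" "z \<notin> F" "z \<notin> \<rat>" by auto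
  have z01: "z \<in> {0<..<1}" using z lr by auto
  obtain t t' where t: "z = bwd w t" "0 < t" "t < top_end \<alpha>" and t': "z = bwd w' t'" "0 < t'" "t' < top_end \<alpha>"
  proof -
    have "z \<in> bwd w ` {0<..<top_end \<alpha>}" "z \<in> bwd w' ` {0<..<top_end \<alpha>}" using z lr(4) lr'(4) by blast+
    then obtain t t' where "z = bwd w t" "t \<in> {0<..<top_end \<alpha>}" "z = bwd w' t'" "t' \<in> {0<..<top_end \<alpha>}" by blast
    then show thesis using that[of t t'] by auto
  qed
  have tQ: "t \<notin> \<rat>" "t' \<notin> \<rat>" 
    using z(4) t(1) t'(1) bwd_Rats_iff[OF acc_proper[OF assms(1)], of t] bwd_Rats_iff[OF acc_proper[OF assms(2)], of t'] by auto
  \<comment> \<open>Positivity puts x right of both endpoints, which are at most 0, and makes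
    \<open>TT_orbit_gauss2\<close> applicable.\<close>
  obtain x where x: "0 < x" "x < \<alpha>" "x \<notin> \<rat>" using irrational_between[OF alpha_pos] by auto
  have o: "orb c j < x" "orb c' j' < x" using acc_orb_le[OF assms(1)] acc_orb_le[OF assms(2)] x by linarith+
  obtain x0 where x0: "\<alpha> - 1 \<le> x0" "x0 < \<alpha>" "x0 \<notin> \<rat>" "(T \<alpha> ^^ length w) x0 = x" "itin \<alpha> x0 (length w) = w"
    using acc_pull[OF assms(1) o(1) x(2,3)] .
  obtain x0' where x0': "\<alpha> - 1 \<le> x0'" "x0' < \<alpha>" "x0' \<notin> \<rat>" "(T \<alpha> ^^ length w') x0' = x" "itin \<alpha> x0' (length w') = w'"
    using acc_pull[OF assms(2) o(2) x(2,3)] .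
  obtain p where p: "p \<in> cusp_free" "fst p < \<alpha>" "fst p > 0" "TT \<alpha> p = (x0, t)"
    using gauss_predecessor[OF x0(1-3) t(2,3) tQ(1)] .
  obtain p' where p': "p' \<in> cusp_free" "fst p' < \<alpha>" "fst p' > 0" "TT \<alpha> p' = (x0', t')"
    using gauss_predecessor[OF x0'(1-3) t'(2,3) tQ(2)] .
  have n: "(TT \<alpha> ^^ length w) (x0, t) = (x, z)" "(TT \<alpha> ^^ length w') (x0', t') = (x, z)"
    using x0 x0' t t' by (auto simp: TT_pow)
  have gm: "\<exists>m. (gauss2 ^^ m) q = (x, z)" if "q \<in> cusp_free" "fst q < \<alpha>" "(TT \<alpha> ^^ k) q = (x, z)" for q k
  proof -
    obtain u y where q: "q = (u, y)" by force
    show ?thesis unfolding q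
      by (rule TT_orbit_gauss2[of u y k x z]) (use that x q fold_pt_below[of q] in \<open>auto simp: cusp_free_def\<close>)
  qed
  obtain m where m: "(gauss2 ^^ m) p = (x, z)"
    using gm[OF p(1,2), of "Suc (length w)"] TT_pow_Suc[OF p(4)] n(1) by auto
  obtain m' where m': "(gauss2 ^^ m') p' = (x, z)"
    using gm[OF p'(1,2), of "Suc (length w')"] TT_pow_Suc[OF p'(4)] n(2) by auto
  have gen: "(TT \<alpha> ^^ k) (x, z) \<noteq> (x, z)" if "k > 0" for k
  proof
    assume "(TT \<alpha> ^^ k) (x, z) = (x, z)"
    then have "bwd (itin \<alpha> x k) z = z" by (simp add: TT_pow)
    moreover have "itin \<alpha> x k \<in> lists proper_letters" using itin_proper[of x k] x alpha_le_1 by simp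
    moreover have "itin \<alpha> x k \<noteq> []" using that by (metis length_0_conv length_itin less_numeral_extra(3))
    ultimately have "z \<in> F" using z01 unfolding F_def by blast
    then show False using z by simp
  qed
  have big: "itin \<alpha> x0 (length w) \<in> lists big_letters" "itin \<alpha> x0' (length w') \<in> lists big_letters"
    using x0(5) x0'(5) acc_big_letters assms by metis+
  have "itin \<alpha> x0 (length w) = itin \<alpha> x0' (length w')"
  proof (cases "m \<le> m'")
    case True
    show ?thesis
      by (rule same_cell_aux[OF big p p' m m' True n t(3)]) (use t' top gen in auto)
  next
    case False
    then have "m' \<le> m" by simp
    show ?thesis
      by (rule same_cell_aux[OF big(2,1) p' p m' m \<open>m' \<le> m\<close> n(2,1) t'(3), symmetric]) (use t top gen in auto)
  qed
  then show False using x0 x0' assms(3) by metis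
qed

end

subsection \<open>The relation between the two fibres\<close>

lemma continuous_on_bwd_letter: "a \<in> proper_letters \<Longrightarrow> continuous_on {0..1} (bwd_letter a)"
proof -
  assume a: "a \<in> proper_letters"
  then obtain e d where ed: "a = (e, Fin d)" "\<And>y. y \<in> {0..1} \<Longrightarrow> of_int d + of_int e * y > (0::real) \<or> y = 0 \<and> d > 0"
    by (auto simp: proper_letters_def)
  have "continuous_on {0..1} (\<lambda>y. 1 / (of_int d + of_int e * y :: real))"
    by (intro continuous_intros) (use ed(2) in force)
  moreover have "bwd_letter a = (\<lambda>y. 1 / (of_int d + of_int e * y))" using ed by auto
  ultimately show ?thesis by simp
qed

lemma continuous_on_bwd: "w \<in> lists proper_letters \<Longrightarrow> continuous_on {0..1} (bwd w)"
proof (induction rule: lists.induct)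
  case (Cons a w)
  have "bwd (a # w) = bwd w \<circ> bwd_letter a" by auto
  moreover have "bwd_letter a ` {0..1} \<subseteq> {0..1}" using bwd_letter_range(1)[OF Cons.hyps(1)] by force
  ultimately show ?case using continuous_on_bwd_letter[OF Cons.hyps(1)] Cons.IH
    by (metis continuous_on_compose continuous_on_subset)
qed (simp add: continuous_on_id)

lemma image_closure_compact:
  fixes f :: "real \<Rightarrow> real"
  assumes "continuous_on K f" "compact K" "A \<subseteq> K"
  shows "f ` closure A = closure (f ` A)"
proof (rule antisym)
  have cA: "closure A \<subseteq> K" using assms by (simp add: closure_minimal compact_imp_closed)
  show "f ` closure A \<subseteq> closure (f ` A)"
    by (rule image_closure_subset[OF _ closed_closure closure_subset])
      (use assms cA in \<open>auto intro: continuous_on_subset\<close>)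
  have "compact (closure A)" using cA assms(2) by (metis closed_closure compact_Int_closed inf.absorb2)
  then have "compact (f ` closure A)" using assms cA by (meson compact_continuous_image continuous_on_subset)
  then show "closure (f ` A) \<subseteq> f ` closure A"
    by (intro closure_minimal image_mono closure_subset compact_imp_closed)
qed

lemma fwd_gt_minus_1:
  assumes "w \<in> lists proper_letters" "x > -1"
  shows "fwd w x > -1"
  using assms(1)
proof (induction rule: lists.induct)
  case (Cons a w)
  consider d where "a = (-1, Fin d)" "d \<ge> 2" | d where "a = (1, Fin d)" "d \<ge> 1"
    using Cons.hyps by (auto simp: proper_letters_def)
  then show ?case
  proof cases
    case 1
    then have "of_int d + fwd w x > 1" using Cons.IH by auto
    then show ?thesis using 1 by (simp add: field_simps)
  next
    case 2
    then have "of_int d + fwd w x > 0" using Cons.IH by auto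
    then have "0 < 1 / (of_int d + fwd w x)" by simp
    moreover have "fwd (a # w) x = 1 / (of_int d + fwd w x)" using 2 by simp
    ultimately show ?thesis by linarith
  qed
qed (use assms in simp)

text \<open>Duality of the two actions: the pole of \<open>bwd w\<close> is determined by \<open>fwd w 0\<close>.\<close>

lemma bwd_formula:
  assumes "w \<in> lists proper_letters"
  shows "\<exists>B K. \<forall>y\<in>{0..1}. bwd w y = B + K * (y / (1 + fwd w 0 * y))"
  using assms
proof (induction rule: lists.induct)
  case Nil
  show ?case by (intro exI[of _ 0] exI[of _ 1]) simp
next
  case (Cons a w)
  from Cons.IH obtain B K where BK: "\<And>y. y \<in> {0..1} \<Longrightarrow> bwd w y = B + K * (y / (1 + fwd w 0 * y))" by auto
  define x where "x = fwd w 0"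
  have x: "x > -1" using fwd_gt_minus_1[OF Cons.hyps(2), of 0] by (simp add: x_def)
  obtain e d where a: "a = (e, Fin d)" "e = 1 \<and> d \<ge> 1 \<or> e = -1 \<and> d \<ge> 2"
    using Cons.hyps by (auto simp: proper_letters_def)
  have dx: "of_int d + x > 0" using a x by auto
  show ?case
  proof (intro exI ballI)
    fix y :: real assume y: "y \<in> {0..1}"
    have ex: "of_int d + of_int e * y + x > 0" using a y x by auto
    have q: "of_int d + of_int e * y > 0" using a y by auto
    have "bwd (a # w) y = B + K * ((1 / (of_int d + of_int e * y)) / (1 + x * (1 / (of_int d + of_int e * y))))"
      using BK[of "bwd_letter a y"] bwd_letter_range(1)[OF Cons.hyps(1), of y] y a by (simp add: x_def)
    also have "(1 / (of_int d + of_int e * y)) / (1 + x * (1 / (of_int d + of_int e * y))) = 1 / (of_int d + of_int e * y + x)"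
      using q ex by (simp add: field_simps)
    also have "\<dots> = 1 / (of_int d + x) - (of_int e / (of_int d + x)\<^sup>2) * (y / (1 + fwd (a # w) 0 * y))"
    proof -
      have 1: "fwd (a # w) 0 = of_int e / (of_int d + x)" using a by (simp add: x_def)
      define s where "s = of_int d + x"
      have s: "s > 0" "s + of_int e * y > 0" using dx ex by (auto simp: s_def algebra_simps)
      have "y / (1 + of_int e / s * y) = s * y / (s + of_int e * y)" using s by (simp add: field_simps)
      then have "1 / s - (of_int e / s\<^sup>2) * (y / (1 + of_int e / s * y)) = 1 / s - of_int e * y / (s * (s + of_int e * y))"
        using s by (simp add: power2_eq_square)
      also have "\<dots> = 1 / (s + of_int e * y)"
      proof -
        define q where "q = s + of_int e * y"
        have "of_int e * y = q - s" "q > 0" using s by (auto simp: q_def)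
        then show ?thesis using s unfolding q_def[symmetric] by (simp add: diff_divide_distrib)
      qed
      finally show ?thesis unfolding 1 s_def by (simp add: algebra_simps)
    qed
    finally show "bwd (a # w) y = (B + K / (of_int d + x)) + (- K * of_int e / (of_int d + x)\<^sup>2) * (y / (1 + fwd (a # w) 0 * y))"
      by (simp add: algebra_simps)
  qed
qed

section \<open>Fibres as Moebius images, and the members of \<open>CC\<close>\<close>

context alpha_struct
begin

lemma cell_subset: "acc w c j \<Longrightarrow> cell w \<subseteq> {0..1}"
  using bwd_range[OF acc_proper] top_end_bounds unfolding cell_def by force

lemma cells_subset: "(\<Union>w\<in>{w. acc w c j}. cell w) \<subseteq> {0..1}"
  using cell_subset by blast

lemma fibre_subset: "fibre c j \<subseteq> {0..1}"
  unfolding fibre_def by (intro closure_minimal cells_subset) auto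

lemma Psi'_subset: "\<Psi>' \<alpha> \<subseteq> {0..1}"
  unfolding Psi'_eq by (intro closure_minimal) (use cell_subset in auto)

lemma cell_subset_fibre: "acc w c j \<Longrightarrow> cell w \<subseteq> fibre c j"
  unfolding fibre_def by (rule subset_trans[OF _ closure_subset]) auto

lemma cell_subset_Psi': "acc w c j \<Longrightarrow> cell w \<subseteq> \<Psi>' \<alpha>"
  unfolding Psi'_eq by (rule subset_trans[OF _ closure_subset]) auto

lemma fibre_subset_Psi': "fibre c j \<subseteq> \<Psi>' \<alpha>"
  unfolding fibre_def Psi'_eq by (intro closure_mono) auto

lemma prefix1_lo_proper: "enat j < klen False \<Longrightarrow> prefix1 (b_lo \<alpha>) j \<in> lists proper_letters"
  using acc_proper[OF acc_append_lo[OF acc_Nil]] by simp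

lemma prefix1_up_proper: "enat j < klen True \<Longrightarrow> prefix1 (b_up \<alpha>) j \<in> lists proper_letters"
proof (cases j)
  case (Suc i)
  assume "enat j < klen True"
  then show ?thesis using acc_proper[OF acc_append_up[OF acc_Nil, of i]] Suc by simp
qed (simp add: prefix1_0)

lemma mobius_image_eq:
  assumes "w \<in> lists proper_letters" "A \<subseteq> {0..1}"
  shows "mobius_act (N w) ` A = bwd w ` A"
  using mobius_act_N_eq_bwd[OF assms(1)] assms(2) by (intro image_cong) auto

lemma cell_append: "cell (w @ v) = bwd v ` cell w"
  by (simp add: cell_def image_image bwd_append)

lemma image_fibre_lo:
  assumes "enat j < klen False"
  shows "mobius_act (N (prefix1 (b_lo \<alpha>) j)) ` \<Psi> \<alpha> = fibre False j"
proof -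
  have "mobius_act (N (prefix1 (b_lo \<alpha>) j)) ` \<Psi> \<alpha> = bwd (prefix1 (b_lo \<alpha>) j) ` fibre False 0"
    unfolding Psi_eq using prefix1_lo_proper[OF assms] fibre_subset by (rule mobius_image_eq)
  also have "\<dots> = closure (bwd (prefix1 (b_lo \<alpha>) j) ` (\<Union>w\<in>{w. acc w False 0}. cell w))"
    unfolding fibre_def
    by (rule image_closure_compact[OF continuous_on_bwd[OF prefix1_lo_proper[OF assms]] compact_Icc cells_subset])
  also have "bwd (prefix1 (b_lo \<alpha>) j) ` (\<Union>w\<in>{w. acc w False 0}. cell w) = (\<Union>w\<in>{w. acc w False j}. cell w)"
  proof -
    have "{w. acc w False j} = (\<lambda>w. w @ prefix1 (b_lo \<alpha>) j) ` {w. acc w False 0}"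
      using assms by (auto simp: acc_lo_iff[of _ j] LL_iff_acc)
    then show ?thesis by (simp add: image_UN cell_append)
  qed
  finally show ?thesis by (simp add: fibre_def)
qed

lemma image_fibre_up:
  assumes "enat j < klen True" "1 \<le> j"
  shows "mobius_act (N (prefix1 (b_up \<alpha>) j)) ` \<Psi>' \<alpha> = fibre True j"
proof -
  have "mobius_act (N (prefix1 (b_up \<alpha>) j)) ` \<Psi>' \<alpha> = bwd (prefix1 (b_up \<alpha>) j) ` \<Psi>' \<alpha>"
    using prefix1_up_proper[OF assms(1)] Psi'_subset by (rule mobius_image_eq)
  also have "\<dots> = closure (bwd (prefix1 (b_up \<alpha>) j) ` (\<Union>w\<in>{w. \<exists>c j. acc w c j}. cell w))"
    unfolding Psi'_eq
    by (rule image_closure_compact[OF continuous_on_bwd[OF prefix1_up_proper[OF assms(1)]] compact_Icc])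
      (use cell_subset in blast)
  also have "bwd (prefix1 (b_up \<alpha>) j) ` (\<Union>w\<in>{w. \<exists>c j. acc w c j}. cell w) = (\<Union>w\<in>{w. acc w True j}. cell w)"
  proof -
    have "{w. acc w True j} = (\<lambda>w. w @ prefix1 (b_up \<alpha>) j) ` {w. \<exists>c j. acc w c j}"
      unfolding acc_up_iff[of _ j] LL'_iff_acc[symmetric] using assms by auto
    then show ?thesis by (simp add: image_UN cell_append)
  qed
  finally show ?thesis by (simp add: fibre_def)
qed

lemma CC_eq: "CC \<alpha> = {fibre c j | c j. enat j < klen c \<and> (c \<longrightarrow> 1 \<le> j)}"
proof -
  have "{mobius_act (N (prefix1 (b_lo \<alpha>) j)) ` \<Psi> \<alpha> | j. 1 \<le> j \<and> enat j < k_lo \<alpha>}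
    = {fibre False j | j. 1 \<le> j \<and> enat j < k_lo \<alpha>}"
    using image_fibre_lo by (auto simp: klen_def)
  moreover have "{mobius_act (N (prefix1 (b_up \<alpha>) j)) ` \<Psi>' \<alpha> | j. 1 \<le> j \<and> enat j < k_up \<alpha>}
    = {fibre True j | j. 1 \<le> j \<and> enat j < k_up \<alpha>}"
    using image_fibre_up by (auto simp: klen_def)
  ultimately have "CC \<alpha> = {fibre False 0} \<union> {fibre False j | j. 1 \<le> j \<and> enat j < k_lo \<alpha>}
      \<union> {fibre True j | j. 1 \<le> j \<and> enat j < k_up \<alpha>}"
    unfolding CC_def Psi_eq[symmetric] by simp
  also have "\<dots> = {fibre c j | c j. enat j < klen c \<and> (c \<longrightarrow> 1 \<le> j)}" (is "?L = ?R")
  proof (intro equalityI subsetI)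
    fix Y assume "Y \<in> ?L"
    then consider "Y = fibre False 0" | j where "Y = fibre False j" "enat j < klen False"
      | j where "Y = fibre True j" "enat j < klen True" "1 \<le> j"
      by (auto simp: klen_def)
    then show "Y \<in> ?R" using klen_gt_0[of False] by cases blast+
  next
    fix Y assume "Y \<in> ?R"
    then obtain c j where *: "Y = fibre c j" "enat j < klen c" "c \<longrightarrow> 1 \<le> j" by auto
    show "Y \<in> ?L"
    proof (cases c)
      case True
      with * show ?thesis by (auto simp: klen_def)
    next
      case False
      with * show ?thesis by (cases "j = 0") (auto simp: klen_def)
    qed
  qed
  finally show ?thesis .
qed

lemma closure_Union_CC: "closure (\<Union>(CC \<alpha>)) = \<Psi>' \<alpha>"
proof (rule antisym)
  show "closure (\<Union>(CC \<alpha>)) \<subseteq> \<Psi>' \<alpha>"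
    by (intro closure_minimal) (use fibre_subset_Psi' in \<open>auto simp: CC_eq Psi'_eq\<close>)
  show "\<Psi>' \<alpha> \<subseteq> closure (\<Union>(CC \<alpha>))"
    unfolding Psi'_eq
  proof (intro closure_mono UN_least)
    fix w assume "w \<in> {w. \<exists>c j. acc w c j}"
    then obtain c j where a: "acc w c j" by auto
    have "cell w \<subseteq> fibre c j" by (rule cell_subset_fibre[OF a])
    moreover have "fibre c j \<in> CC \<alpha>" unfolding CC_eq using acc_klen[OF a] acc_True_ge_1[OF a] by auto
    ultimately show "cell w \<subseteq> \<Union>(CC \<alpha>)" by auto
  qed
qed

lemma acc_snocD:
  assumes "acc (w @ [a]) c' j'"
  obtains c j where "acc w c j" "enat (Suc j) < klen c" "a = letter_at \<alpha> (orb c j)" "c' = c" "j' = Suc j"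
  | c j d where "acc w c j" "enat (Suc j) < klen c" "a = (-1, Fin d)" "2 \<le> d" "d \<le> D + 1"
      "letter_less (letter_at \<alpha> (orb c j)) a" "\<not> c'" "j' = 0"
  | c j where "acc w c j" "a = (1, Fin D)" c' "j' = 1"
  using assms
proof (cases rule: acc.cases)
  case (acc_step w' j)
  with that(1)[of c' j] show ?thesis by auto
next
  case (acc_reset w' c j d)
  with that(2)[of c j d] show ?thesis by auto
next
  case (acc_plus w' c j)
  with that(3)[of c j] show ?thesis by auto
qed simp

text \<open>The automaton is deterministic: a last letter equal to that of the endpoint is a step, a
  strictly larger negative one a reset, and a positive one starts the upper branch.\<close>

lemma acc_unique: "acc w c j \<Longrightarrow> acc w c' j' \<Longrightarrow> c = c' \<and> j = j'"
proof (induction w arbitrary: c j c' j' rule: rev_induct)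
  case Nil
  have "\<not> c \<and> j = 0" if "acc [] c j" for c j
    using that by (cases rule: acc.cases) auto
  with Nil show ?case by blast
next
  case (snoc a w)
  have neg: "\<exists>d. letter_at \<alpha> (orb c j) = (-1, Fin d)" if "acc w c j" "enat (Suc j) < klen c" for c j
    using orb_letter[of c j] that acc_True_ge_1[OF that(1)] by metis
  have irrefl: "\<not> letter_less b b" for b by (simp add: letter_less_def)
  from snoc.prems(1) show ?case
  proof (cases rule: acc_snocD)
    case (1 c1 j1)
    note A = this
    from snoc.prems(2) show ?thesis
    proof (cases rule: acc_snocD)
      case (1 c2 j2)
      with A snoc.IH[OF A(1) 1(1)] show ?thesis by simp
    next
      case (2 c2 j2 d)
      with A snoc.IH[OF A(1) 2(1)] irrefl[of a] show ?thesis by simp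
    next
      case (3 c2 j2)
      with A neg[of c1 j1] show ?thesis by auto
    qed
  next
    case (2 c1 j1 d1)
    note A = this
    from snoc.prems(2) show ?thesis
    proof (cases rule: acc_snocD)
      case (1 c2 j2)
      with A snoc.IH[OF A(1) 1(1)] irrefl[of a] show ?thesis by simp
    next
      case (2 c2 j2 d)
      with A show ?thesis by simp
    next
      case (3 c2 j2)
      with A show ?thesis by simp
    qed
  next
    case (3 c1 j1)
    note A = this
    from snoc.prems(2) show ?thesis
    proof (cases rule: acc_snocD)
      case (1 c2 j2)
      with A neg[of c2 j2] show ?thesis by auto
    next
      case (2 c2 j2 d)
      with A show ?thesis by simp
    next
      case (3 c2 j2)
      with A show ?thesis by simp
    qed
  qed
qed

definition open_cell :: "letter list \<Rightarrow> real set" where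
  "open_cell w = bwd w ` {0<..<top_end \<alpha>}"

lemma cell_interval:
  assumes "acc w c j"
  obtains l r where "0 \<le> l" "l < r" "r \<le> 1" "open_cell w = {l<..<r}" "cell w = {l..r}"
proof -
  have "0 < top_end \<alpha>" "top_end \<alpha> \<le> 1" using top_end_bounds by auto
  from bwd_interval[OF acc_proper[OF assms] order_refl this] that show ?thesis
    unfolding open_cell_def cell_def by blast
qed

lemma open_open_cell: "acc w c j \<Longrightarrow> open (open_cell w)"
  by (metis cell_interval open_greaterThanLessThan)

lemma closure_open_cell: "acc w c j \<Longrightarrow> closure (open_cell w) = cell w"
  by (metis cell_interval closure_greaterThanLessThan)

text \<open>Over a fixed irrational x right of T \<alpha>, \<open>visited_base_plus\<close> reaches
  a dense set of this interval. If visited points lie in cells, closing up fills the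
  interval.\<close>

lemma gap_subset_Psi':
  assumes incl: "\<And>x y. (x, y) \<in> visited \<Longrightarrow> x \<notin> \<rat> \<Longrightarrow> y \<in> (\<Union>w\<in>{w. \<exists>c j. acc w c j}. cell w)"
  shows "{1 / (of_int D + 1)..1 / of_int D} \<subseteq> \<Psi>' \<alpha>"
proof -
  have "T \<alpha> \<alpha> < \<alpha>" using T_range[of \<alpha> \<alpha>] alpha_pos by auto
  then obtain x where x: "T \<alpha> \<alpha> < x" "x < \<alpha>" "x \<notin> \<rat>"
    using irrational_between by blast
  define f :: "real \<Rightarrow> real" where "f = (\<lambda>y. 1 / (of_int D + y))"
  have D: "real_of_int D \<ge> 1" using D_ge_1 by simp
  have "f ` ({0<..<1} \<inter> \<rat>) \<subseteq> \<Psi>' \<alpha>"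
  proof clarify
    fix y :: real assume y: "y \<in> {0<..<1}" "y \<in> \<rat>"
    then have "(x, f y) \<in> visited" using visited_base_plus[OF x] by (simp add: f_def)
    then have "f y \<in> (\<Union>w\<in>{w. \<exists>c j. acc w c j}. cell w)" using incl x(3) by simp
    then show "f y \<in> \<Psi>' \<alpha>" unfolding Psi'_eq by (rule subsetD[OF closure_subset])
  qed
  then have "f ` closure ({0<..<1} \<inter> \<rat>) \<subseteq> \<Psi>' \<alpha>"
  proof (rule image_closure_subset[rotated 2])
    have "closure ({0<..<1} \<inter> \<rat>) \<subseteq> {0..1::real}" by (intro closure_minimal) auto
    moreover have "continuous_on {0..1} f" unfolding f_def by (intro continuous_intros) (use D in auto)
    ultimately show "continuous_on (closure ({0<..<1} \<inter> \<rat>)) f" by (rule continuous_on_subset[rotated])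
  qed (simp add: Psi'_eq)
  moreover have "{1 / (of_int D + 1)..1 / of_int D} \<subseteq> f ` {0..1}"
  proof
    fix z assume z: "z \<in> {1 / (real_of_int D + 1)..1 / of_int D}"
    have "0 < 1 / (real_of_int D + 1)" using D by simp
    with z have z0: "z > 0" by (meson atLeastAtMost_iff less_le_trans)
    have "1 / z \<le> of_int D + 1" "of_int D \<le> 1 / z" using z z0 D by (auto simp: field_simps)
    moreover have "z = f (1 / z - of_int D)" by (simp add: f_def)
    ultimately show "z \<in> f ` {0..1}" by (intro image_eqI[of _ _ "1 / z - of_int D"]) auto
  qed
  ultimately show ?thesis using Rats_closure_interval[of 0 1] by (meson image_mono order_trans zero_less_one)
qed

end

context alpha_good
begin

lemma plus_interval_subset: "{1 / (of_int D + 1)..1 / of_int D} \<subseteq> \<Psi>' \<alpha>"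
proof (rule gap_subset_Psi')
  fix x y assume "(x, y) \<in> visited" "x \<notin> \<rat>"
  then have "\<exists>w c j. acc w c j \<and> orb c j \<le> x \<and> y \<in> cell w" by (rule visited_in_cell)
  then show "y \<in> (\<Union>w\<in>{w. \<exists>c j. acc w c j}. cell w)" by auto
qed

text \<open>The map \<open>y \<mapsto> y / (1 - y)\<close> turns a final letter \<open>(-1, d)\<close> into \<open>(-1, d - 1)\<close>, and
  \<open>[0, top_end \<alpha>]\<close> into \<open>[0, 1 / D]\<close>.\<close>

lemma tE_Psi: "\<Psi>' \<alpha> = mobius_act (transpose E_mat) ` \<Psi> \<alpha>"
  and Psi_subset: "\<Psi> \<alpha> \<subseteq> {0..1/2}"
proof -
  define g :: "real \<Rightarrow> real" where "g = (\<lambda>y. y / (1 - y))"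
  have D: "real_of_int D \<ge> 1" using D_ge_1 by simp
  have g: "mobius_act (transpose E_mat) = g" by (auto simp: mobius_act_tE g_def)
  have inv: "g (y / (1 + y)) = y" if "0 \<le> y" for y using that by (simp add: g_def field_simps)
  define A where "A = (\<Union>w\<in>{w. acc w False 0}. cell w)"
  have neg: "\<exists>d0. letter_at \<alpha> (orb c j) = (-1, Fin d0) \<and> 2 \<le> d0 \<and> d0 \<le> D + 1"
    if "acc w c j" "enat (Suc j) < klen c" for w c j
    using orb_letter[of c j] that acc_True_ge_1[OF that(1)] by metis
  \<comment> \<open>A word in the initial state is empty or ends with a reset; then its last digit d
    exceeds the digit d0 of the endpoint, which leaves room to lower it by one.\<close>
  have A_cases: "z \<in> cell [] \<or> (\<exists>w c j d0 d t. acc w c j \<and> enat (Suc j) < klen c \<and> letter_at \<alpha> (orb c j) = (-1, Fin d0)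
      \<and> 2 \<le> d0 \<and> d0 < d \<and> d \<le> D + 1 \<and> t \<in> {0..top_end \<alpha>} \<and> z = 1 / (of_int d - bwd w t))" if zA: "z \<in> A" for z
  proof -
    obtain w where w: "acc w False 0" "z \<in> cell w" using zA A_def by auto
    show ?thesis
    proof (cases w rule: rev_cases)
      case (snoc v a)
      from w(1)[unfolded snoc] show ?thesis
      proof (cases rule: acc_snocD)
        case (2 c j d)
        obtain d0 where d0: "letter_at \<alpha> (orb c j) = (-1, Fin d0)" "2 \<le> d0" using neg[OF 2(1,2)] by auto
        then have "d0 < d" using 2 letter_less_neg_iff by simp
        moreover obtain t where "t \<in> {0..top_end \<alpha>}" "z = bwd w t" using w(2) by (auto simp: cell_def)
        then have "t \<in> {0..top_end \<alpha>}" "z = 1 / (of_int d - bwd v t)" using snoc 2(3) by (auto simp: bwd_append)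
        ultimately show ?thesis using 2 d0 by blast
      qed auto
    qed (use w in auto)
  qed
  have A_half: "A \<subseteq> {0..1/2}"
  proof
    fix z assume "z \<in> A"
    from A_cases[OF this] show "z \<in> {0..1/2}"
    proof (elim disjE exE conjE)
      assume "z \<in> cell []"
      then show ?thesis using top_end_bounds by (auto simp: cell_def)
    next
      fix w c j d0 d t
      assume *: "acc w c j" "2 \<le> d0" "d0 < d" "t \<in> {0..top_end \<alpha>}" "z = 1 / (of_int d - bwd w t)"
      have "bwd w t \<in> {0..1}" using bwd_range[OF acc_proper[OF *(1)], of t] * top_end_bounds by auto
      then have "of_int d - bwd w t \<ge> 2" using * by auto
      then show ?thesis unfolding *(5) using frac_le[of 1 1 2 "of_int d - bwd w t"] by simp
    qed
  qed
  have cont: "continuous_on {0..1/2} g" unfolding g_def by (intro continuous_intros) auto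
  have img: "g ` \<Psi> \<alpha> = closure (g ` A)"
    unfolding Psi_eq fibre_def A_def[symmetric]
    by (rule image_closure_compact[OF cont compact_Icc A_half])
  have incl: "g ` A \<subseteq> \<Psi>' \<alpha>"
  proof clarify
    fix z assume "z \<in> A"
    from A_cases[OF this] show "g z \<in> \<Psi>' \<alpha>"
    proof (elim disjE exE conjE)
      assume "z \<in> cell []"
      then have z: "0 \<le> z" "z \<le> top_end \<alpha>" by (auto simp: cell_def)
      then have "z * (of_int D + 1) \<le> 1" using D by (simp add: top_end_eq field_simps)
      moreover have z1: "z < 1" using z top_end_bounds by simp
      ultimately have gz: "0 \<le> g z" "g z \<le> 1 / of_int D"
        using z D by (auto simp: g_def field_simps)
      show ?thesis
      proof (cases "g z \<le> top_end \<alpha>")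
        case True
        then have "g z \<in> cell []" using gz by (simp add: cell_def)
        then show ?thesis using cell_subset_Psi'[OF acc_Nil] by auto
      next
        case False
        then show ?thesis using plus_interval_subset gz top_end_eq by auto
      qed
    next
      fix w c j d0 d t
      assume *: "acc w c j" "enat (Suc j) < klen c" "letter_at \<alpha> (orb c j) = (-1, Fin d0)" "2 \<le> d0" "d0 < d"
        "d \<le> D + 1" "t \<in> {0..top_end \<alpha>}" "z = 1 / (of_int d - bwd w t)"
      have "bwd w t \<in> {0..1}" using bwd_range[OF acc_proper[OF *(1)], of t] * top_end_bounds by auto
      then have pos: "of_int d - bwd w t \<ge> 2" using * by auto
      have "g (1 / p) = 1 / (p - 1)" if "p \<ge> 2" for p :: real using that by (simp add: g_def divide_simps)
      from this[OF pos] have gz: "g z = bwd (w @ [(-1, Fin (d - 1))]) t"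
        using *(8) by (simp add: bwd_append algebra_simps)
      \<comment> \<open>With the lowered digit the word is still accepted: the letter either equals
        that of the endpoint, a step, or still exceeds it, a reset.\<close>
      have "\<exists>c' j'. acc (w @ [(-1, Fin (d - 1))]) c' j'"
      proof (cases "d0 = d - 1")
        case True
        then show ?thesis using acc_step[OF *(1,2)] *(3) by auto
      next
        case False
        then have "letter_less (letter_at \<alpha> (orb c j)) (-1, Fin (d - 1))"
          using * letter_less_neg_iff[of d0 "d - 1"] by simp
        then show ?thesis using acc_reset[OF *(1,2), of "d - 1"] * by auto
      qed
      moreover have "g z \<in> cell (w @ [(-1, Fin (d - 1))])" unfolding gz cell_def using * by (intro imageI)
      ultimately show ?thesis using cell_subset_Psi' by (meson subsetD)
    qed
  qed
  have low: "z \<in> g ` A" if "0 \<le> z" "z \<le> 1 / of_int D" for z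
  proof -
    have "z / (1 + z) \<le> top_end \<alpha>" using that D by (simp add: top_end_eq field_simps)
    then have "z / (1 + z) \<in> cell []" using that by (simp add: cell_def)
    then have "z / (1 + z) \<in> A" using acc_Nil by (auto simp: A_def)
    then show ?thesis using inv[OF that(1)] by (metis image_eqI)
  qed
  have "(\<Union>w\<in>{w. \<exists>c j. acc w c j}. cell w) \<subseteq> g ` A"
  proof clarify
    fix z w c' j' assume a: "acc w c' j'" and z: "z \<in> cell w"
    have neg_case: "z \<in> g ` A" if nc: "acc v c j" "enat (Suc j) < klen c" "letter_at \<alpha> (orb c j) = (-1, Fin d0)" "2 \<le> d0"
      "d0 \<le> d" "d \<le> D + 1" "w = v @ [(-1, Fin d)]" for v c j d0 d
    proof -
      obtain t where t: "t \<in> {0..top_end \<alpha>}" "z = 1 / (of_int d - bwd v t)"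
        using z nc(7) by (auto simp: cell_def bwd_append)
      have v: "bwd v t \<in> {0..1}" using bwd_range[OF acc_proper[OF nc(1)], of t] t top_end_bounds by auto
      then have pos: "of_int d - bwd v t \<ge> 1" using nc by auto
      show ?thesis
      \<comment> \<open>The digit D+1 cannot be raised, but then z <= 1/D, and z is already the
        image of a point in the cell of the empty word.\<close>
      proof (cases "d = D + 1")
        case True
        then have "z \<le> 1 / of_int D" "0 \<le> z" using t v pos D by (auto simp: frac_le)
        then show ?thesis using low by simp
      next
        case False
        have "letter_less (letter_at \<alpha> (orb c j)) (-1, Fin (d + 1))"
          using nc letter_less_neg_iff[of d0 "d + 1"] by simp
        then have "acc (v @ [(-1, Fin (d + 1))]) False 0" using acc_reset[OF nc(1,2), of "d + 1"] nc False by auto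
        moreover have "bwd (v @ [(-1, Fin (d + 1))]) t \<in> cell (v @ [(-1, Fin (d + 1))])" using t by (simp add: cell_def)
        ultimately have "1 / (of_int d + 1 - bwd v t) \<in> A" unfolding A_def by (auto simp: bwd_append)
        moreover have "g (1 / (of_int d + 1 - bwd v t)) = z"
        proof -
          have "g (1 / (p + 1)) = 1 / p" if "p \<ge> 1" for p :: real using that by (simp add: g_def divide_simps)
          from this[OF pos] show ?thesis using t by (simp add: algebra_simps)
        qed
        ultimately show ?thesis by blast
      qed
    qed
    show "z \<in> g ` A"
    proof (cases w rule: rev_cases)
      case Nil
      then have "0 \<le> z" "z \<le> top_end \<alpha>" using z by (auto simp: cell_def)
      moreover have "top_end \<alpha> \<le> 1 / of_int D" using D by (simp add: top_end_eq frac_le)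
      ultimately show ?thesis using low by simp
    next
      case (snoc v a')
      from a[unfolded snoc] show ?thesis
      proof (cases rule: acc_snocD)
        case (1 c j)
        then show ?thesis using neg[OF 1(1,2)] neg_case[OF 1(1,2)] snoc by auto
      next
        case (2 c j d)
        obtain d0 where d0: "letter_at \<alpha> (orb c j) = (-1, Fin d0)" "2 \<le> d0" using neg[OF 2(1,2)] by auto
        then have "d0 < d" using 2 letter_less_neg_iff by simp
        then show ?thesis using neg_case[OF 2(1,2) d0, of d] 2 snoc by auto
      next
        case (3 c j)
        obtain t where t: "t \<in> {0..top_end \<alpha>}" "z = 1 / (of_int D + bwd v t)"
          using z snoc 3 by (auto simp: cell_def bwd_append)
        have "bwd v t \<in> {0..1}" using bwd_range[OF acc_proper[OF 3(1)], of t] t top_end_bounds by auto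
        then have "z \<le> 1 / of_int D" "0 \<le> z" using t D by (auto simp: frac_le)
        then show ?thesis using low by simp
      qed
    qed
  qed
  then have "\<Psi>' \<alpha> \<subseteq> closure (g ` A)" unfolding Psi'_eq by (rule closure_mono)
  moreover have "closure (g ` A) \<subseteq> \<Psi>' \<alpha>" using incl by (intro closure_minimal) (auto simp: Psi'_eq)
  ultimately show "\<Psi>' \<alpha> = mobius_act (transpose E_mat) ` \<Psi> \<alpha>" unfolding g img by blast
  show "\<Psi> \<alpha> \<subseteq> {0..1/2}"
    unfolding Psi_eq fibre_def A_def[symmetric] using A_half by (intro closure_minimal) auto
qed

lemma open_cell_disjoint:
  assumes "acc w c j" "acc w' c' j'" "w \<noteq> w'"
  shows "open_cell w \<inter> cell w' = {}"
  using open_Int_closure_eq_empty[OF open_open_cell[OF assms(1)], of "open_cell w'"] cells_disjoint[OF assms]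
    closure_open_cell[OF assms(2)]
  by (simp add: open_cell_def)

lemma cells_separated:
  assumes "w \<in> LL' \<alpha>"
  shows "mobius_act (N w) ` {0<..<top_end \<alpha>}
        \<inter> closure (\<Union>w' \<in> LL' \<alpha> - {w}. mobius_act (N w') ` {0..top_end \<alpha>}) = {}"
proof -
  obtain c j where w: "acc w c j" using assms LL'_iff_acc by auto
  have "mobius_act (N w') ` {0..top_end \<alpha>} = cell w'" if w': "w' \<in> LL' \<alpha> - {w}" for w'
  proof -
    obtain c' j' where "acc w' c' j'" using w' LL'_iff_acc by auto
    then show ?thesis by (intro cell_eq acc_proper)
  qed
  moreover have "open_cell w \<inter> cell w' = {}" if w': "w' \<in> LL' \<alpha> - {w}" for w'
  proof -
    obtain c' j' where "acc w' c' j'" using w' LL'_iff_acc by auto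
    then show ?thesis using open_cell_disjoint[OF w] w' by auto
  qed
  ultimately have "open_cell w \<inter> (\<Union>w' \<in> LL' \<alpha> - {w}. mobius_act (N w') ` {0..top_end \<alpha>}) = {}"
    by auto
  then show ?thesis
    using open_Int_closure_eq_empty[OF open_open_cell[OF w]] cell_open_eq[OF acc_proper[OF w]]
    by (simp add: open_cell_def)
qed

end

subsection \<open>Null sets\<close>

lemma fmeasurable_lborelD: "A \<in> fmeasurable lborel \<Longrightarrow> A \<in> sets borel"
  using fmeasurableD[of A lborel] by simp

context alpha_good
begin

text \<open>Pulling back for closed intervals, valid at rational points too. It is applied at x = 0,
  where it keeps the pole of \<open>bwd w\<close> a fixed distance away from [0,1].\<close>

lemma fwd_acc_range:
  assumes "acc w c j" "orb c j \<le> x" "x \<le> \<alpha>"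
  shows "\<alpha> - 1 \<le> fwd w x \<and> fwd w x \<le> \<alpha>"
  using assms
proof (induction arbitrary: x rule: acc.induct)
  case acc_Nil
  then show ?case by (simp add: orb_0)
next
  case (acc_step w c j)
  have j: "c \<Longrightarrow> j \<ge> 1" using acc_True_ge_1[OF acc_step(1)] .
  obtain d where d: "letter_at \<alpha> (orb c j) = (-1, Fin d)" "orb c (Suc j) = - 1 / orb c j - of_int d" "orb c j < 0"
    using orb_letter[of c j] j acc_step(2) by metis
  have p: "of_int d + orb c (Suc j) > 0" using d by (simp add: zero_less_divide_iff)
  have "1 / (of_int d + x) \<le> 1 / (of_int d + orb c (Suc j))" using p acc_step.prems by (intro frac_le) auto
  then have 1: "orb c j \<le> - 1 / (of_int d + x)" using d by simp
  have "0 < 1 / (of_int d + x)" using p acc_step.prems by simp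
  then have "- (1 / (of_int d + x)) \<le> \<alpha>" using alpha_pos by linarith
  then have "- 1 / (of_int d + x) \<le> \<alpha>" by simp
  from acc_step.IH[OF 1 this] d show ?case by (simp add: fwd_append)
next
  case (acc_reset w c j d)
  have j: "c \<Longrightarrow> j \<ge> 1" using acc_True_ge_1[OF acc_reset(1)] .
  obtain d0 where d0: "letter_at \<alpha> (orb c j) = (-1, Fin d0)" "2 \<le> d0" "orb c (Suc j) = - 1 / orb c j - of_int d0" "orb c j < 0"
    using orb_letter[of c j] j acc_reset(2) by metis
  have "d0 < d" using d0 acc_reset letter_less_neg_iff by simp
  then have "real_of_int d0 + 1 \<le> of_int d" by linarith
  moreover have "orb c (Suc j) < \<alpha>" using orb_range[of c "Suc j"] by auto
  ultimately have le: "of_int d0 + orb c (Suc j) \<le> of_int d + x" using acc_reset.prems by (simp add: orb_0)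
  have p: "of_int d0 + orb c (Suc j) > 0" using d0 by (simp add: zero_less_divide_iff)
  have "1 / (of_int d + x) \<le> 1 / (of_int d0 + orb c (Suc j))" using p le by (intro frac_le) auto
  then have 1: "orb c j \<le> - 1 / (of_int d + x)" using d0 by simp
  have "0 < 1 / (of_int d + x)" using p le by simp
  then have "- (1 / (of_int d + x)) \<le> \<alpha>" using alpha_pos by linarith
  then have "- 1 / (of_int d + x) \<le> \<alpha>" by simp
  from acc_reset.IH[OF 1 this] show ?case by (simp add: fwd_append)
next
  case (acc_plus w c j)
  have Tx: "1 / \<alpha> \<le> of_int D + x" using acc_plus.prems T_alpha by (simp add: orb_def)
  have "0 < 1 / \<alpha>" using alpha_pos by simp
  then have pos: "0 < of_int D + x" using Tx by linarith
  have "1 / (of_int D + x) \<le> 1 / (1 / \<alpha>)" using \<open>0 < 1 / \<alpha>\<close> Tx by (intro frac_le) simp_all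
  then have le: "1 / (of_int D + x) \<le> \<alpha>" "0 < 1 / (of_int D + x)" using pos by simp_all
  have o: "orb c j \<le> 1 / (of_int D + x)" using acc_orb_le[OF acc_plus(1)] le by linarith
  from acc_plus.IH[OF o le(1)] show ?case by (simp add: fwd_append)
qed

definition words :: "nat \<Rightarrow> letter list set" where
  "words n = {w. length w = n \<and> (\<exists>c j. acc w c j)}"

lemma finite_words: "finite (words n)"
proof (rule finite_subset)
  show "words n \<subseteq> {w. set w \<subseteq> big_letters \<and> length w = n}"
    using acc_big_letters by (auto simp: words_def in_lists_conv_set)
  show "finite {w. set w \<subseteq> big_letters \<and> length w = n}"
    using big_letters_finite by (rule finite_lists_length_eq)
qed

lemma wordsD: "w \<in> words n \<Longrightarrow> \<exists>c j. acc w c j"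
  by (simp add: words_def)

definition hull_cell :: "letter list \<Rightarrow> real set" where
  "hull_cell w = bwd w ` {0..1}"

lemma hull_cell_interval:
  assumes "acc w c j"
  obtains l r where "0 \<le> l" "l < r" "r \<le> 1" "hull_cell w = {l..r}"
  using bwd_interval[OF acc_proper[OF assms] order_refl zero_less_one order_refl] that
  unfolding hull_cell_def by metis

lemma cell_subset_hull_cell: "cell w \<subseteq> hull_cell w"
  unfolding cell_def hull_cell_def using top_end_bounds by (intro image_mono) auto

lemma open_cell_subset_cell: "open_cell w \<subseteq> cell w"
  unfolding cell_def open_cell_def by (intro image_mono) auto

text \<open>A lower bound for the ratio of a cell to its hull. Up to a translation and a factor K,
  \<open>bwd w\<close> is y/(1 + x y) with x between \<alpha> - 1 and 1. The hull has length at most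
  |K|/\<alpha>, and the cell, with t = \<open>top_end \<alpha>\<close>, at least |K| t/2.\<close>

definition gap_ratio :: real where
  "gap_ratio = \<alpha> * top_end \<alpha> / 2"

lemma gap_ratio_bounds: "0 < gap_ratio" "gap_ratio < 1"
proof -
  show "0 < gap_ratio" using alpha_pos top_end_bounds by (simp add: gap_ratio_def)
  have "\<alpha> * top_end \<alpha> \<le> 1 * 1" using alpha_pos alpha_le_1 top_end_bounds by (intro mult_mono) auto
  then show "gap_ratio < 1" by (simp add: gap_ratio_def)
qed

lemma open_cell_measure:
  assumes "acc w c j"
  shows "gap_ratio * measure lborel (hull_cell w) \<le> measure lborel (open_cell w)"
proof -
  define x where "x = fwd w 0"
  define t where "t = top_end \<alpha>"
  have t: "0 < t" "t \<le> 1" using top_end_bounds by (auto simp: t_def)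
  \<comment> \<open>The point 0 lies in the interval of every state, as the left ends are at most
    0.\<close>
  have x: "1 + x \<ge> \<alpha>" "x \<le> 1"
    using fwd_acc_range[OF assms acc_orb_le[OF assms]] alpha_pos alpha_le_1 by (auto simp: x_def)
  obtain B K where BK: "\<And>y. y \<in> {0..1} \<Longrightarrow> bwd w y = B + K * (y / (1 + x * y))"
    using bwd_formula[OF acc_proper[OF assms]] unfolding x_def by blast
  obtain l r where lr: "l < r" "hull_cell w = {l..r}" using hull_cell_interval[OF assms] by metis
  obtain l' r' where lr': "l' < r'" "open_cell w = {l'<..<r'}" "cell w = {l'..r'}" using cell_interval[OF assms] by metis
  have x1: "1 + x > 0" using x(1) alpha_pos by linarith
  have pos: "1 + x * y > 0" "y / (1 + x * y) \<le> 1 / (1 + x)" "0 \<le> y / (1 + x * y)" if y: "y \<in> {0..1}" for y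
  proof -
    have "1 + x * y = (1 - y) + (1 + x) * y" by (simp add: algebra_simps)
    moreover have "(1 - y) + (1 + x) * y > 0"
      using y x1 by (cases "y = 0") (auto intro: add_nonneg_pos)
    ultimately show p: "1 + x * y > 0" by simp
    show "y / (1 + x * y) \<le> 1 / (1 + x)" using p x1 y by (simp add: divide_simps algebra_simps)
    show "0 \<le> y / (1 + x * y)" using p y by simp
  qed
  have "r - l \<le> \<bar>K\<bar> / (1 + x)"
  proof -
    have "l \<in> hull_cell w" "r \<in> hull_cell w" using lr by auto
    then obtain y1 y2 where y: "y1 \<in> {0..1}" "y2 \<in> {0..1}" "l = bwd w y1" "r = bwd w y2" by (auto simp: hull_cell_def)
    have "r - l = K * (y2 / (1 + x * y2) - y1 / (1 + x * y1))" using y BK by (simp add: algebra_simps)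
    also have "\<dots> \<le> \<bar>K\<bar> * \<bar>y2 / (1 + x * y2) - y1 / (1 + x * y1)\<bar>" by (metis abs_ge_self abs_mult)
    also have "\<dots> \<le> \<bar>K\<bar> * (1 / (1 + x))" using pos[OF y(1)] pos[OF y(2)] by (intro mult_left_mono) auto
    finally show ?thesis by simp
  qed
  moreover have "r' - l' \<ge> \<bar>K\<bar> * (t / (1 + x * t))"
  proof -
    have "bwd w 0 \<in> cell w" "bwd w t \<in> cell w" using t by (auto simp: cell_def t_def)
    then have "\<bar>bwd w t - bwd w 0\<bar> \<le> r' - l'" using lr' by auto
    moreover have "bwd w t - bwd w 0 = K * (t / (1 + x * t))" using BK[of t] BK[of 0] t by simp
    ultimately have "\<bar>K\<bar> * \<bar>t / (1 + x * t)\<bar> \<le> r' - l'" by (simp only: abs_mult)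
    moreover have "\<bar>t / (1 + x * t)\<bar> = t / (1 + x * t)" using pos(3)[of t] t by (intro abs_of_nonneg) auto
    ultimately show ?thesis by (simp only:)
  qed
  moreover have "gap_ratio * (\<bar>K\<bar> / (1 + x)) \<le> \<bar>K\<bar> * (t / (1 + x * t))"
  proof -
    have "gap_ratio / (1 + x) \<le> t / 2"
      using x(1) x1 t by (simp add: gap_ratio_def t_def[symmetric] divide_simps mult_right_mono)
    also have "\<dots> \<le> t / (1 + x * t)"
    proof -
      have "x * t \<le> 1 * t" using x t by (intro mult_right_mono) auto
      then have "x * t \<le> 1" using t by linarith
      then show ?thesis using pos(1)[of t] t by (intro frac_le) auto
    qed
    finally have "\<bar>K\<bar> * (gap_ratio / (1 + x)) \<le> \<bar>K\<bar> * (t / (1 + x * t))" by (intro mult_left_mono) auto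
    then show ?thesis by (simp add: mult.commute)
  qed
  moreover have "gap_ratio * (r - l) \<le> gap_ratio * (\<bar>K\<bar> / (1 + x))"
    using \<open>r - l \<le> \<bar>K\<bar> / (1 + x)\<close> gap_ratio_bounds(1) by (intro mult_left_mono) auto
  ultimately show ?thesis using lr lr' by simp
qed

definition hulls :: "nat \<Rightarrow> real set" where
  "hulls n = (\<Union>w\<in>words n. hull_cell w)"

definition remainder :: "nat \<Rightarrow> real set" where
  "remainder n = hulls n - (\<Union>m<n. \<Union>w\<in>words m. open_cell w)"

lemma hull_cell_meas: "w \<in> words n \<Longrightarrow> hull_cell w \<in> fmeasurable lborel"
  using wordsD hull_cell_interval by (metis fmeasurable_compact compact_Icc)

lemma open_cell_meas: "w \<in> words n \<Longrightarrow> open_cell w \<in> fmeasurable lborel"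
proof -
  assume "w \<in> words n"
  then obtain l r where "open_cell w = {l<..<r}" using wordsD cell_interval by metis
  moreover have "box l r \<in> fmeasurable lborel" by (rule fmeasurable_box)
  ultimately show ?thesis by simp
qed

lemma hulls_meas: "hulls n \<in> fmeasurable lborel"
  unfolding hulls_def using finite_words hull_cell_meas by (intro fmeasurable.finite_UN) auto

lemma remainder_meas: "remainder n \<in> fmeasurable lborel"
  unfolding remainder_def using finite_words open_cell_meas hulls_meas
  by (intro fmeasurable.Diff fmeasurable.finite_UN) auto

text \<open>The first letter is applied first, so deleting it enlarges the hull, and
  \<open>acc_drop\<close> keeps the shorter word accepted.\<close>

lemma hulls_Suc: "hulls (Suc n) \<subseteq> hulls n"
proof
  fix z assume "z \<in> hulls (Suc n)"
  then obtain w c j where w: "length w = Suc n" "acc w c j" "z \<in> hull_cell w" by (auto simp: hulls_def words_def)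
  then obtain a v where v: "w = a # v" by (cases w) auto
  have "\<exists>c j. acc v c j" using acc_drop[OF w(2), of 1] v by simp
  then have "v \<in> words n" using w v by (simp add: words_def)
  moreover have "a \<in> proper_letters" using acc_proper[OF w(2)] v by auto
  then have "bwd_letter a ` {0..1} \<subseteq> {0..1}" using bwd_letter_range(1) by fastforce
  then have "hull_cell w \<subseteq> hull_cell v" unfolding hull_cell_def v by (auto simp: image_subset_iff)
  ultimately show "z \<in> hulls n" using w unfolding hulls_def by blast
qed

lemma open_cell_words_disjoint:
  "w \<in> words n \<Longrightarrow> w' \<in> words m \<Longrightarrow> w \<noteq> w' \<Longrightarrow> open_cell w \<inter> open_cell w' = {}"
  using wordsD cells_disjoint unfolding open_cell_def by metis

text \<open>The open cells of level n are disjoint from each other and from those of lower levels,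
  lie in \<open>remainder n\<close> and are missing from \<open>remainder (Suc n)\<close>. Each has
  at least the fraction \<open>gap_ratio\<close> of its hull, and the hulls cover
  \<open>remainder n\<close>.\<close>

lemma remainder_decay: "measure lborel (remainder (Suc n)) \<le> (1 - gap_ratio) * measure lborel (remainder n)"
proof -
  define G where "G = (\<Union>w\<in>words n. open_cell w)"
  have G: "G \<in> fmeasurable lborel"
    unfolding G_def using finite_words open_cell_meas by (intro fmeasurable.finite_UN) auto
  have "measure lborel (remainder n) \<le> measure lborel (hulls n)"
    using hulls_meas fmeasurable_lborelD[OF remainder_meas[of n]]
    by (intro measure_mono_fmeasurable) (auto simp: remainder_def)
  also have "\<dots> \<le> (\<Sum>w\<in>words n. measure lborel (hull_cell w))"
    unfolding hulls_def using finite_words hull_cell_meas by (intro measure_UNION_le) (auto intro: fmeasurable_lborelD)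
  finally have "gap_ratio * measure lborel (remainder n) \<le> gap_ratio * (\<Sum>w\<in>words n. measure lborel (hull_cell w))"
    using gap_ratio_bounds by (intro mult_left_mono) auto
  also have "\<dots> \<le> (\<Sum>w\<in>words n. measure lborel (open_cell w))"
    unfolding sum_distrib_left using wordsD open_cell_measure by (intro sum_mono) metis
  also have "\<dots> = measure lborel G"
    unfolding G_def using finite_words open_cell_meas open_cell_words_disjoint
    by (intro measure_finite_Union[symmetric])
      (auto simp: disjoint_family_on_def intro: fmeasurable_lborelD dest: fmeasurableD2)
  finally have 1: "gap_ratio * measure lborel (remainder n) \<le> measure lborel G" .
  have "remainder (Suc n) \<inter> G = {}" by (auto simp: remainder_def G_def)
  then have "measure lborel (remainder (Suc n)) + measure lborel G = measure lborel (remainder (Suc n) \<union> G)"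
    using G remainder_meas by (intro measure_Union[symmetric]) (auto intro: fmeasurable_lborelD dest: fmeasurableD2)
  also have "\<dots> \<le> measure lborel (remainder n)"
  proof (rule measure_mono_fmeasurable)
    have "G \<subseteq> hulls n" unfolding G_def hulls_def
      using open_cell_subset_cell cell_subset_hull_cell by (intro UN_mono) auto
    moreover have "G \<inter> (\<Union>m<n. \<Union>w\<in>words m. open_cell w) = {}"
    proof -
      have "open_cell w \<inter> open_cell v = {}" if "w \<in> words n" "v \<in> words m" "m < n" for w v m
        using that open_cell_words_disjoint[OF that(1,2)] by (force simp: words_def)
      then have "\<And>m z. m < n \<Longrightarrow> z \<in> G \<Longrightarrow> z \<notin> (\<Union>w\<in>words m. open_cell w)" unfolding G_def by blast
      then show ?thesis by blast
    qed
    moreover have "remainder (Suc n) \<subseteq> remainder n"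
    proof -
      have "(\<Union>m<n. \<Union>w\<in>words m. open_cell w) \<subseteq> (\<Union>m<Suc n. \<Union>w\<in>words m. open_cell w)" by (intro UN_mono) auto
      then show ?thesis unfolding remainder_def using hulls_Suc by (intro Diff_mono) auto
    qed
    ultimately show "remainder (Suc n) \<union> G \<subseteq> remainder n" by (simp add: remainder_def) blast
    show "remainder (Suc n) \<union> G \<in> sets lborel" using G remainder_meas by (auto intro: fmeasurable_lborelD)
  qed (rule remainder_meas)
  finally show ?thesis using 1 by (simp add: algebra_simps)
qed

lemma remainder_Inter_null: "(\<Inter>n. remainder n) \<in> null_sets lborel"
proof -
  define Z where "Z = (\<Inter>n. remainder n)"
  define C where "C = measure lborel (remainder 0)"
  have le: "measure lborel (remainder n) \<le> (1 - gap_ratio) ^ n * C" for n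
  proof (induction n)
    case (Suc n)
    have "measure lborel (remainder (Suc n)) \<le> (1 - gap_ratio) * measure lborel (remainder n)" by (rule remainder_decay)
    also have "\<dots> \<le> (1 - gap_ratio) * ((1 - gap_ratio) ^ n * C)" using Suc gap_ratio_bounds by (intro mult_left_mono) auto
    finally show ?case by simp
  qed (simp add: C_def)
  have Zm: "Z \<in> sets lborel" unfolding Z_def using remainder_meas by (intro sets.countable_INT) (auto intro: fmeasurable_lborelD)
  have Zn: "measure lborel Z \<le> (1 - gap_ratio) ^ n * C" for n
  proof -
    have "measure lborel Z \<le> measure lborel (remainder n)"
      using Zm remainder_meas by (intro measure_mono_fmeasurable) (auto simp: Z_def)
    with le[of n] show ?thesis by linarith
  qed
  have "(\<lambda>n. (1 - gap_ratio) ^ n * C) \<longlonglongrightarrow> 0 * C"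
    using gap_ratio_bounds by (intro tendsto_mult LIMSEQ_power_zero tendsto_const) auto
  then have "measure lborel Z \<le> 0" using Zn LIMSEQ_le_const[of _ "0 * C" "measure lborel Z"] by auto
  then have "measure lborel Z = 0" by (simp add: measure_nonneg order_antisym)
  moreover have "Z \<in> fmeasurable lborel"
    using remainder_meas[of 0] _ Zm by (rule fmeasurableI2) (auto simp: Z_def)
  ultimately show ?thesis unfolding Z_def[symmetric] using Zm
    by (metis emeasure_eq_measure2 ennreal_0 null_setsI)
qed

lemma cell_closed: "acc w c j \<Longrightarrow> closed (cell w)"
  by (metis cell_interval closed_atLeastAtMost)

text \<open>The cell of a long word lies in the hull of its last n letters. For fixed n the
  right-hand side is a finite union of closed sets, so it also contains the closure.\<close>

lemma Psi'_cover: "\<Psi>' \<alpha> \<subseteq> (\<Union>m<n. \<Union>w\<in>words m. cell w) \<union> hulls n"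
  unfolding Psi'_eq
proof (rule closure_minimal)
  have "closed (\<Union>w\<in>words m. cell w)" for m
    using finite_words cell_closed wordsD by (intro closed_UN) (auto, metis)
  moreover have "closed (hulls n)"
    unfolding hulls_def using finite_words hull_cell_interval wordsD
    by (intro closed_UN) (auto, metis closed_atLeastAtMost)
  ultimately show "closed ((\<Union>m<n. \<Union>w\<in>words m. cell w) \<union> hulls n)" by (intro closed_Un closed_UN) auto
  show "(\<Union>w\<in>{w. \<exists>c j. acc w c j}. cell w) \<subseteq> (\<Union>m<n. \<Union>w\<in>words m. cell w) \<union> hulls n"
  proof clarify
    fix z w c j assume w: "acc w c j" "z \<in> cell w" "z \<notin> hulls n"
    show "z \<in> (\<Union>m<n. \<Union>w\<in>words m. cell w)"
    proof (cases "length w < n")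
      case True
      then show ?thesis using w by (auto simp: words_def)
    next
      case False
      define v where "v = drop (length w - n) w"
      define u where "u = take (length w - n) w"
      have uv: "w = u @ v" by (simp add: u_def v_def)
      have "v \<in> words n" using acc_drop[OF w(1)] False by (auto simp: words_def v_def)
      moreover have "u \<in> lists proper_letters" using acc_proper[OF w(1)] uv by auto
      then have "bwd u y \<in> {0..1}" if "y \<in> {0..top_end \<alpha>}" for y
        using that bwd_range[of u y] top_end_bounds by auto
      then have "cell w \<subseteq> hull_cell v" unfolding cell_def hull_cell_def uv by (auto simp: bwd_append)
      ultimately show ?thesis using w unfolding hulls_def by blast
    qed
  qed
qed

text \<open>A point of \<open>\<Psi>' \<alpha>\<close> outside all open cells is an end point of a
  cell, of which there are countably many, or it lies in every remainder.\<close>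

lemma Psi'_diff_open_cells_null:
  "\<Psi>' \<alpha> - (\<Union>w\<in>{w. \<exists>c j. acc w c j}. open_cell w) \<in> null_sets lborel" (is "?Z \<in> _")
proof -
  define E where "E = (\<Union>n. \<Union>w\<in>words n. cell w - open_cell w)"
  have "countable E" unfolding E_def
  proof (intro countable_UN countableI_type)
    fix n w assume "w \<in> words n"
    then obtain l r where "open_cell w = {l<..<r}" "cell w = {l..r}" using wordsD cell_interval by metis
    then have "cell w - open_cell w \<subseteq> {l, r}" by auto
    then show "countable (cell w - open_cell w)" by (rule countable_subset) auto
  qed (use finite_words in \<open>auto intro: countable_finite\<close>)
  then have "E \<in> null_sets lborel" by (rule countable_imp_null_set_lborel)
  then have "E \<union> (\<Inter>n. remainder n) \<in> null_sets lborel" using remainder_Inter_null by (rule null_sets.Un)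
  moreover have "?Z \<subseteq> E \<union> (\<Inter>n. remainder n)"
  proof
    fix z assume z: "z \<in> ?Z"
    have no: "z \<notin> open_cell w" if "w \<in> words m" for w m using z wordsD[OF that] by auto
    show "z \<in> E \<union> (\<Inter>n. remainder n)"
    proof (rule ccontr)
      assume nz: "z \<notin> E \<union> (\<Inter>n. remainder n)"
      then obtain n where n: "z \<notin> remainder n" by auto
      then have "z \<notin> hulls n" using no unfolding remainder_def by auto
      then obtain m w where "w \<in> words m" "z \<in> cell w" using z Psi'_cover[of n] by auto
      then have "z \<in> E" using no unfolding E_def by blast
      then show False using nz by simp
    qed
  qed
  moreover have "?Z \<in> sets lborel"
  proof -
    have "open (\<Union>w\<in>{w. \<exists>c j. acc w c j}. open_cell w)" using open_open_cell by blast
    moreover have "closed (\<Psi>' \<alpha>)" by (simp add: Psi'_eq)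
    ultimately have "closed ?Z" by (rule closed_Diff[rotated])
    then show ?thesis by simp
  qed
  ultimately show ?thesis by (blast intro: null_sets_subset)
qed

text \<open>Distinct members come from distinct states. By \<open>acc_unique\<close> an open cell
  belongs to a single state and misses the fibres of all others, even the closure of their union, so
  the intersection avoids every open cell.\<close>

lemma CC_null:
  assumes "Y \<in> CC \<alpha>"
  shows "Y \<inter> closure (\<Union>(CC \<alpha> - {Y})) \<in> null_sets lebesgue"
proof -
  obtain c j where Y: "Y = fibre c j" using assms CC_eq by auto
  define Q where "Q = \<Union>(CC \<alpha> - {Y})"
  have Q: "\<exists>c' j'. q \<in> fibre c' j' \<and> (c', j') \<noteq> (c, j)" if q: "q \<in> Q" for q
  proof -
    obtain Y' where "Y' \<in> CC \<alpha>" "Y' \<noteq> Y" "q \<in> Y'" using q by (auto simp: Q_def)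
    then obtain c' j' where "Y' = fibre c' j'" using CC_eq by auto
    then show ?thesis using \<open>Y' \<noteq> Y\<close> \<open>q \<in> Y'\<close> Y by auto
  qed
  have sep: "open_cell w \<inter> fibre c' j' = {}" if w: "acc w c0 j0" "(c', j') \<noteq> (c0, j0)" for w c0 j0 c' j'
  proof -
    have "open_cell w \<inter> (\<Union>w\<in>{w. acc w c' j'}. cell w) = {}"
    proof -
      have "open_cell w \<inter> cell w' = {}" if "acc w' c' j'" for w'
        using open_cell_disjoint[OF w(1) that] acc_unique[of w] w that by blast
      then show ?thesis by blast
    qed
    then show ?thesis unfolding fibre_def using open_Int_closure_eq_empty[OF open_open_cell[OF w(1)]] by blast
  qed
  have "Y \<inter> closure Q \<subseteq> \<Psi>' \<alpha> - (\<Union>w\<in>{w. \<exists>c j. acc w c j}. open_cell w)"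
  proof clarify
    fix z assume z: "z \<in> Y" "z \<in> closure Q"
    have False if "acc w c0 j0" "z \<in> open_cell w" for w c0 j0
    proof (cases "(c, j) = (c0, j0)")
      case True
      have "open_cell w \<inter> Q = {}" using Q sep[OF that(1)] True by blast
      then have "open_cell w \<inter> closure Q = {}" using open_Int_closure_eq_empty[OF open_open_cell[OF that(1)]] by blast
      then show False using that z by blast
    next
      case False
      then show False using sep[OF that(1) False] that z Y by blast
    qed
    then show "z \<in> \<Psi>' \<alpha> - (\<Union>w\<in>{w. \<exists>c j. acc w c j}. open_cell w)"
      using z fibre_subset_Psi'[of c j] Y by blast
  qed
  moreover have "closed (Y \<inter> closure Q)" unfolding Y fibre_def by (intro closed_Int closed_closure)
  then have "Y \<inter> closure Q \<in> sets lborel" by simp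
  ultimately have "Y \<inter> closure Q \<in> null_sets lborel"
    using null_sets_subset[OF Psi'_diff_open_cells_null] by blast
  then show ?thesis unfolding Q_def[symmetric] by (rule null_sets_completionI)
qed

end

subsection \<open>The natural extension domain and the density\<close>

lemma irrational_closure_interval: "a < b \<Longrightarrow> {a..b} \<subseteq> closure ({a<..<b} - \<rat>)" for a b :: real
proof -
  assume "a < b"
  have "x \<in> closure (- \<rat>)" for x :: real
    unfolding closure_approachable
  proof (intro allI impI)
    fix e :: real assume "0 < e"
    then obtain y where "x < y" "y < x + e" "y \<notin> \<rat>" using irrational_between[of x "x + e"] by auto
    then show "\<exists>y\<in>- \<rat>. dist y x < e" by (auto simp: dist_real_def intro!: bexI[of _ y])
  qed
  then have "{a<..<b} \<subseteq> closure ({a<..<b} - \<rat>)"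
    using open_Int_closure_subset[of "{a<..<b}" "- \<rat>"] by (auto simp: Diff_eq)
  then have "closure {a<..<b} \<subseteq> closure ({a<..<b} - \<rat>)" by (simp add: closure_minimal)
  with \<open>a < b\<close> show ?thesis by simp
qed

lemma closed_section_right: "closed S \<Longrightarrow> closed {y. (x, y) \<in> S}"
  for S :: "(real \<times> real) set"
  using closed_vimage[of S "\<lambda>y. (x, y)"] by (simp add: vimage_def continuous_on_Pair continuous_on_const continuous_on_id)

lemma closed_section_left: "closed S \<Longrightarrow> closed {x. (x, y) \<in> S}"
  for S :: "(real \<times> real) set"
  using closed_vimage[of S "\<lambda>x. (x, y)"] by (simp add: vimage_def continuous_on_Pair continuous_on_const continuous_on_id)

text \<open>No left end lies in (x, x') and b is not left of x', so over this window each strip is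
  full or empty. The window is open, which lets this survive the closure.\<close>

lemma closure_strips:
  fixes l :: "'i \<Rightarrow> real" and F :: "'i \<Rightarrow> real set"
  assumes "(t, y) \<in> closure (\<Union>j\<in>J. {l j..b} \<times> F j)" "t \<in> {x<..<x'}" "s \<in> {x<..<x'}" "x' \<le> b"
    "\<And>j. j \<in> J \<Longrightarrow> l j \<notin> {x<..<x'}"
  shows "(s, y) \<in> closure (\<Union>j\<in>J. {l j..b} \<times> F j)"
proof -
  define A where "A = {j \<in> J. l j \<le> x}"
  define Q where "Q = {x<..<x'} \<times> (UNIV :: real set)"
  have "open Q" unfolding Q_def by (intro open_Times) auto
  then have "(t, y) \<in> closure (Q \<inter> (\<Union>j\<in>J. {l j..b} \<times> F j))"
    using open_Int_closure_subset[of Q "\<Union>j\<in>J. {l j..b} \<times> F j"] assms(1,2) by (auto simp: Q_def)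
  moreover have "Q \<inter> (\<Union>j\<in>J. {l j..b} \<times> F j) \<subseteq> {x<..<x'} \<times> (\<Union>j\<in>A. F j)"
  proof
    fix z assume "z \<in> Q \<inter> (\<Union>j\<in>J. {l j..b} \<times> F j)"
    then obtain p q j where *: "z = (p, q)" "(p, q) \<in> Q" "j \<in> J" "p \<in> {l j..b}" "q \<in> F j" by auto
    then have "l j \<le> x" using assms(5)[of j] by (auto simp: Q_def)
    with * show "z \<in> {x<..<x'} \<times> (\<Union>j\<in>A. F j)" by (auto simp: Q_def A_def)
  qed
  ultimately have "(t, y) \<in> closure ({x<..<x'} \<times> (\<Union>j\<in>A. F j))" using closure_mono by blast
  then have "y \<in> closure (\<Union>j\<in>A. F j)" by (simp add: closure_Times)
  then have "(s, y) \<in> closure ({s} \<times> (\<Union>j\<in>A. F j))" by (simp add: closure_Times)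
  moreover have "{s} \<times> (\<Union>j\<in>A. F j) \<subseteq> (\<Union>j\<in>J. {l j..b} \<times> F j)"
    using assms by (auto simp: A_def)
  ultimately show ?thesis using closure_mono by blast
qed

text \<open>The marginal density at \<open>t\<close> is the integral of \<open>1 / (1 + t y)\<^sup>2\<close> over the fibre at \<open>t\<close>.\<close>

lemma marginal_density:
  fixes W :: "(real \<times> real) set" and a b :: real
  assumes W: "closed W" "W \<subseteq> {a..b} \<times> {0..1}" and a: "-1 < a" "a \<le> 0" and b: "0 < b" "b \<le> 1"
    and box: "0 < c" "c \<le> 1" "{0..b} \<times> {0..c} \<subseteq> W"
  shows "\<exists>f :: real \<Rightarrow> real. f \<in> borel_measurable borel \<and> (\<forall>t. f t \<ge> 0)
    \<and> distr (uniform_measure \<mu> W) borel fst = density lborel (\<lambda>t. ennreal (f t))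
    \<and> (\<forall>x x'. (\<forall>t\<in>{x<..<x'}. \<forall>s\<in>{x<..<x'}. \<forall>y. (t, y) \<in> W \<longrightarrow> (s, y) \<in> W) \<longrightarrow> continuous_on {x<..<x'} f)"
proof -
  define k :: "real \<Rightarrow> real \<Rightarrow> real" where "k t y = 1 / (1 + t * y)\<^sup>2" for t y
  define h where "h t = (\<integral>\<^sup>+y. ennreal (k t y) * indicator W (t, y) \<partial>lborel)" for t
  define C0 where "C0 = emeasure \<mu> W"
  have Wm: "W \<in> sets borel" using W by auto
  have sets_mu: "sets \<mu> = sets borel" "space \<mu> = UNIV" by (auto simp: \<mu>_def)
  have fstm [measurable]: "(fst :: real \<times> real \<Rightarrow> real) \<in> borel_measurable borel"
    by (intro borel_measurable_continuous_onI continuous_on_fst continuous_on_id)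
  have [measurable]: "(snd :: real \<times> real \<Rightarrow> real) \<in> borel_measurable borel"
    by (intro borel_measurable_continuous_onI continuous_on_snd continuous_on_id)
  have km: "(\<lambda>p. ennreal (k (fst p) (snd p))) \<in> borel_measurable borel"
    unfolding k_def by measurable
  have mu_eq: "\<mu> = density lborel (\<lambda>p. ennreal (k (fst p) (snd p)))"
    unfolding \<mu>_def k_def by (simp add: case_prod_unfold)
  have kb: "0 \<le> k t y" "k t y \<le> 1 / (1 + a)\<^sup>2" if "t \<ge> a" "0 \<le> y" "y \<le> 1" for t y
  proof -
    show "0 \<le> k t y" by (simp add: k_def)
    have "1 + a \<le> 1 + a * y" using a that mult_left_mono_neg[of y 1 a] by simp
    also have "\<dots> \<le> 1 + t * y" using that by (simp add: mult_right_mono)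
    finally have "1 + a \<le> 1 + t * y" .
    then show "k t y \<le> 1 / (1 + a)\<^sup>2" unfolding k_def using a by (intro frac_le power_mono) auto
  qed
  have hm: "h \<in> borel_measurable borel"
  proof -
    have "(\<lambda>p. ennreal (k (fst p) (snd p)) * indicator W p) \<in> borel_measurable (lborel \<Otimes>\<^sub>M lborel)"
      using km Wm by (simp add: lborel_prod)
    from lborel.borel_measurable_nn_integral_fst[OF this] show ?thesis by (simp add: h_def[abs_def])
  qed
  have hb: "h t \<le> ennreal (1 / (1 + a)\<^sup>2)" for t
  proof -
    have "h t \<le> (\<integral>\<^sup>+y. ennreal (1 / (1 + a)\<^sup>2) * indicator {0..1::real} y \<partial>lborel)"
      unfolding h_def
    proof (rule nn_integral_mono)
      fix y :: real
      show "ennreal (k t y) * indicator W (t, y) \<le> ennreal (1 / (1 + a)\<^sup>2) * indicator {0..1} y"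
        using kb(2)[of t y] W(2) by (auto split: split_indicator intro!: ennreal_leI)
    qed
    then show ?thesis by (simp add: nn_integral_cmult)
  qed
  have h0: "h t = 0" if "t \<notin> {a..b}" for t
  proof -
    have "(t, y) \<notin> W" for y using that W by auto
    then show ?thesis by (simp add: h_def)
  qed
  have mass: "emeasure \<mu> (W \<inter> fst -` A) = (\<integral>\<^sup>+t. h t * indicator A t \<partial>lborel)" if A: "A \<in> sets borel" for A
  proof -
    have mA: "(fst -` A :: (real \<times> real) set) \<in> sets borel"
      using measurable_sets[OF fstm A] by simp
    have "emeasure \<mu> (W \<inter> fst -` A) = (\<integral>\<^sup>+p. ennreal (k (fst p) (snd p)) * indicator (W \<inter> fst -` A) p \<partial>lborel)"
      unfolding mu_eq using km Wm mA by (intro emeasure_density) auto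
    also have "\<dots> = (\<integral>\<^sup>+p. ennreal (k (fst p) (snd p)) * indicator (W \<inter> fst -` A) p \<partial>(lborel \<Otimes>\<^sub>M lborel))"
      by (simp add: lborel_prod)
    also have "\<dots> = (\<integral>\<^sup>+t. \<integral>\<^sup>+y. ennreal (k (fst (t, y)) (snd (t, y))) * indicator (W \<inter> fst -` A) (t, y) \<partial>lborel \<partial>lborel)"
      using km Wm mA by (intro lborel.nn_integral_fst[symmetric]) (simp add: lborel_prod)
    also have "\<dots> = (\<integral>\<^sup>+t. h t * indicator A t \<partial>lborel)"
    proof (intro nn_integral_cong)
      fix t
      have "(\<lambda>y. ennreal (k t y) * indicator W (t, y)) \<in> borel_measurable lborel"
      proof -
        have Pm: "Pair t \<in> borel_measurable borel"
          by (intro borel_measurable_continuous_onI continuous_intros)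
        have "(\<lambda>y. ennreal (k (fst (t, y)) (snd (t, y))) * indicator W (t, y)) \<in> borel_measurable borel"
          by (intro borel_measurable_times_ennreal measurable_compose[OF Pm km]
              measurable_compose[OF Pm borel_measurable_indicator[OF Wm]])
        then show ?thesis by simp
      qed
      then show "(\<integral>\<^sup>+y. ennreal (k (fst (t, y)) (snd (t, y))) * indicator (W \<inter> fst -` A) (t, y) \<partial>lborel) = h t * indicator A t"
        unfolding h_def by (cases "t \<in> A") (auto simp: indicator_def intro!: nn_integral_cong)
    qed
    finally show ?thesis .
  qed
  have C0_h: "C0 = (\<integral>\<^sup>+t. h t \<partial>lborel)" using mass[of UNIV] by (simp add: C0_def)
  have C0_fin: "C0 \<noteq> \<infinity>"
  proof -
    have "C0 \<le> (\<integral>\<^sup>+t. ennreal (1 / (1 + a)\<^sup>2) * indicator {a..b} t \<partial>lborel)"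
      unfolding C0_h using hb h0 by (intro nn_integral_mono) (auto split: split_indicator)
    also have "\<dots> < \<infinity>" using a b by (simp add: nn_integral_cmult ennreal_mult_less_top)
    finally show ?thesis by simp
  qed
  have C0_pos: "C0 \<noteq> 0"
  proof -
    have "h t \<ge> ennreal (c / 4)" if t: "t \<in> {0..b}" for t
    proof -
      \<comment> \<open>On the box 1 + t y is at most 2.\<close>
      have "k t y \<ge> 1 / 4" if y: "y \<in> {0..c}" for y
      proof -
        have "t * y \<le> 1 * 1" using t y b box by (intro mult_mono) auto
        then have "(1 + t * y)\<^sup>2 \<le> 2\<^sup>2" using t y by (intro power_mono) auto
        moreover have "1 + t * y > 0" using t y by (simp add: add_pos_nonneg)
        ultimately show ?thesis unfolding k_def by (simp add: field_simps)
      qed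
      then have "(\<integral>\<^sup>+y. ennreal (1 / 4) * indicator {0..c} y \<partial>lborel) \<le> h t"
        unfolding h_def using box t
        by (intro nn_integral_mono) (auto split: split_indicator intro!: ennreal_leI)
      then show ?thesis using box by (simp add: nn_integral_cmult ennreal_mult[symmetric] del: ennreal_divide_numeral)
    qed
    then have "(\<integral>\<^sup>+t. ennreal (c / 4) * indicator {0..b} t \<partial>lborel) \<le> C0"
      unfolding C0_h by (intro nn_integral_mono) (auto split: split_indicator)
    moreover have "(\<integral>\<^sup>+t. ennreal (c / 4) * indicator {0..b} t \<partial>lborel) > 0"
      using box b by (simp add: nn_integral_cmult ennreal_zero_less_mult_iff del: ennreal_divide_numeral)
    ultimately show ?thesis by auto
  qed
  define f where "f t = enn2real (h t / C0)" for t
  have fin: "h t / C0 < \<infinity>" for t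
  proof -
    have "h t \<noteq> top" using hb[of t] by (auto simp: top_unique)
    then show ?thesis using C0_pos by (auto simp: divide_ennreal_def ennreal_mult_eq_top_iff less_top[symmetric])
  qed
  have ef: "ennreal (f t) = h t / C0" for t
    using fin[of t] unfolding f_def by (intro ennreal_enn2real) simp
  have distr_eq: "distr (uniform_measure \<mu> W) borel fst = density lborel (\<lambda>t. ennreal (f t))"
  proof (rule measure_eqI)
    fix A assume "A \<in> sets (distr (uniform_measure \<mu> W) borel fst)"
    then have A: "A \<in> sets borel" by simp
    have mA: "(fst -` A :: (real \<times> real) set) \<in> sets borel"
      using measurable_sets[OF fstm A] by simp
    have "emeasure (distr (uniform_measure \<mu> W) borel fst) A = emeasure (uniform_measure \<mu> W) (fst -` A)"
    proof -
      have "fst \<in> borel_measurable (uniform_measure \<mu> W)"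
        using fstm measurable_cong_sets[of "uniform_measure \<mu> W" borel borel borel] sets_mu by auto
      then show ?thesis using A by (simp add: emeasure_distr sets_mu)
    qed
    also have "\<dots> = emeasure \<mu> (W \<inter> fst -` A) / C0"
      unfolding C0_def using Wm mA by (intro emeasure_uniform_measure) (auto simp: sets_mu)
    also have "\<dots> = (\<integral>\<^sup>+t. h t * indicator A t / C0 \<partial>lborel)"
      unfolding mass[OF A] using hm A by (intro nn_integral_divide[symmetric]) auto
    also have "\<dots> = (\<integral>\<^sup>+t. ennreal (f t) * indicator A t \<partial>lborel)"
      unfolding ef by (intro nn_integral_cong) (auto split: split_indicator)
    also have "\<dots> = emeasure (density lborel (\<lambda>t. ennreal (f t))) A"
      using A hm unfolding ef by (intro emeasure_density[symmetric]) auto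
    finally show "emeasure (distr (uniform_measure \<mu> W) borel fst) A = emeasure (density lborel (\<lambda>t. ennreal (f t))) A" .
  qed simp
  have cont: "continuous_on {x<..<x'} f"
    if const: "\<forall>t\<in>{x<..<x'}. \<forall>s\<in>{x<..<x'}. \<forall>y. (t, y) \<in> W \<longrightarrow> (s, y) \<in> W" for x x'
  \<comment> \<open>If the window leaves [a, b], one of its sections is empty, hence all of them
    are, and f vanishes on the window.\<close>
  proof (cases "{x<..<x'} \<subseteq> {a..b}")
    case False
    then obtain t0 where t0: "t0 \<in> {x<..<x'}" "t0 \<notin> {a..b}" by blast
    have "(t, y) \<notin> W" if "t \<in> {x<..<x'}" for t y using const that t0 W by blast
    then have "f t = 0" if "t \<in> {x<..<x'}" for t using that by (simp add: f_def h_def)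
    then show ?thesis using continuous_on_cong[of "{x<..<x'}" "{x<..<x'}" f "\<lambda>_. 0"] by simp
  next
    case True
    show ?thesis
    proof (cases "{x<..<x'} = {}")
      case False
      then obtain t0 where t0: "t0 \<in> {x<..<x'}" by blast
      define C where "C = {y. (t0, y) \<in> W}"
      have C: "(t, y) \<in> W \<longleftrightarrow> y \<in> C" if "t \<in> {x<..<x'}" for t y
        unfolding C_def mem_Collect_eq using const that t0 by blast
      have Cm: "C \<in> sets borel" unfolding C_def using closed_section_right[OF W(1)] by auto
      have C01: "C \<subseteq> {0..1}" using W by (auto simp: C_def)
      define g where "g t = (LINT y|lborel. k t y * indicator C y)" for t
      have dom: "norm (k t y * indicator C y) \<le> 1 / (1 + a)\<^sup>2 * indicator {0..1} y" if "t \<in> {x<..<x'}" for t y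
      proof (cases "y \<in> C")
        case inC: True
        have "t \<ge> a" "0 \<le> y" "y \<le> 1" using that True inC C01 by auto
        then show ?thesis using kb[of t y] inC by simp
      qed (simp add: indicator_def)
      have ig: "integrable lborel (\<lambda>y. k t y * indicator C y)" if "t \<in> {x<..<x'}" for t
      proof (rule Bochner_Integration.integrable_bound)
        show "integrable lborel (\<lambda>y. 1 / (1 + a)\<^sup>2 * indicator {0..1::real} y)"
          by (intro integrable_mult_right integrable_real_indicator) auto
        show "(\<lambda>y. k t y * indicator C y) \<in> borel_measurable lborel" unfolding k_def using Cm by measurable
        show "AE y in lborel. norm (k t y * indicator C y) \<le> norm (1 / (1 + a)\<^sup>2 * indicator {0..1} y)"
          using dom[OF that] by (intro AE_I2) auto
      qed
      have fg: "f t = g t / enn2real C0" if "t \<in> {x<..<x'}" for t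
      proof -
        have "h t = (\<integral>\<^sup>+y. ennreal (k t y * indicator C y) \<partial>lborel)"
          unfolding h_def using C[OF that] by (intro nn_integral_cong) (auto split: split_indicator)
        also have "\<dots> = ennreal (g t)"
          unfolding g_def using ig[OF that] by (intro nn_integral_eq_integral) (auto simp: k_def)
        finally have "h t = ennreal (g t)" .
        moreover have "C0 = ennreal (enn2real C0)" using C0_fin by (intro ennreal_enn2real[symmetric]) (simp add: less_top[symmetric])
        moreover have "enn2real C0 > 0" using C0_pos C0_fin by (simp add: enn2real_positive_iff less_top[symmetric] zero_less_iff_neq_zero)
        moreover have "g t \<ge> 0" unfolding g_def by (intro integral_nonneg_AE) (auto simp: k_def)
        ultimately show ?thesis unfolding f_def by (metis divide_ennreal enn2real_ennreal divide_nonneg_nonneg less_imp_le)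
      qed
      have "continuous_on {x<..<x'} g"
        unfolding continuous_on_sequentially
      proof (intro allI ballI impI, elim conjE)
        fix X t assume t: "t \<in> {x<..<x'}" and X: "\<forall>n. X n \<in> {x<..<x'}" "X \<longlonglongrightarrow> t"
        have "(\<lambda>n. LINT y|lborel. k (X n) y * indicator C y) \<longlonglongrightarrow> (LINT y|lborel. k t y * indicator C y)"
        proof (rule integral_dominated_convergence)
          show "integrable lborel (\<lambda>y. 1 / (1 + a)\<^sup>2 * indicator {0..1::real} y)"
            by (intro integrable_mult_right integrable_real_indicator) auto
          show "(\<lambda>y. k t y * indicator C y) \<in> borel_measurable lborel" unfolding k_def using Cm by measurable
          show "(\<lambda>y. k (X n) y * indicator C y) \<in> borel_measurable lborel" for n unfolding k_def using Cm by measurable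
          show "AE y in lborel. norm (k (X n) y * indicator C y) \<le> 1 / (1 + a)\<^sup>2 * indicator {0..1} y" for n
            using dom[of "X n"] X(1) by (intro AE_I2) blast
          show "AE y in lborel. (\<lambda>n. k (X n) y * indicator C y) \<longlonglongrightarrow> k t y * indicator C y"
          proof (intro AE_I2)
            fix y :: real
            show "(\<lambda>n. k (X n) y * indicator C y) \<longlonglongrightarrow> k t y * indicator C y"
            proof (cases "y \<in> C")
              case True': True
              have "1 + a \<le> 1 + a * y" using a True' C01 mult_left_mono_neg[of y 1 a] by auto
              also have "a * y \<le> t * y" using t True True' C01 by (intro mult_right_mono) auto
              finally have "1 + t * y \<noteq> 0" using a by linarith
              then have "(\<lambda>n. k (X n) y) \<longlonglongrightarrow> k t y" unfolding k_def using X(2) by (intro tendsto_intros) auto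
              then show ?thesis by (intro tendsto_mult tendsto_const)
            qed simp
          qed
        qed
        then show "(g \<circ> X) \<longlonglongrightarrow> g t" by (simp add: g_def o_def)
      qed
      moreover have "continuous_on {x<..<x'} f \<longleftrightarrow> continuous_on {x<..<x'} (\<lambda>t. g t / enn2real C0)"
        using fg by (intro continuous_on_cong) auto
      moreover have "enn2real C0 \<noteq> 0" using C0_pos C0_fin by (simp add: enn2real_eq_0_iff)
      ultimately show ?thesis by (simp add: continuous_on_divide continuous_on_const)
    qed simp
  qed
  have fm: "f \<in> borel_measurable borel" unfolding f_def[abs_def] using hm by measurable
  have "\<forall>t. f t \<ge> 0" by (simp add: f_def)
  with fm distr_eq cont show ?thesis by (intro exI[of _ f]) blast
qed

text \<open>For matching parameters the last states of the two branches may have a partial cylinder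
  with letter \<open>(-1, D + 1)\<close>, which the automaton ignores; \<open>final_dual\<close> says that its image is
  already covered by the letter \<open>(1, D)\<close>.\<close>

locale alpha_final = alpha_struct +
  assumes final_orb_gt: "enat j < klen c \<Longrightarrow> \<not> enat (Suc j) < klen c \<Longrightarrow> orb c j > - kap"
    and final_dual: "enat j < klen c \<Longrightarrow> (c \<Longrightarrow> 1 \<le> j) \<Longrightarrow> \<not> enat (Suc j) < klen c \<Longrightarrow> y \<in> fibre c j \<Longrightarrow> 1 - y \<in> \<Psi>' \<alpha>"
begin

section \<open>A forward invariant region and the shape of the domain\<close>

definition states :: "(bool \<times> nat) set" where
  "states = {(c, j). enat j < klen c \<and> (c \<longrightarrow> 1 \<le> j)}"

text \<open>Its forward invariance shows that no orbit leaves the claimed domain. The strips are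
  open on the right, like the range of T, and contain rational x as well.\<close>

definition region :: "(real \<times> real) set" where
  "region = (\<Union>(c, j)\<in>states. {orb c j..<\<alpha>} \<times> fibre c j)"

lemma bwd_letter_fibre:
  assumes "y \<in> fibre c j" "a \<in> proper_letters" "\<And>w. acc w c j \<Longrightarrow> acc (w @ [a]) c' j'"
  shows "bwd_letter a y \<in> fibre c' j'"
proof -
  have "bwd_letter a ` closure (\<Union>w\<in>{w. acc w c j}. cell w) = closure (bwd_letter a ` (\<Union>w\<in>{w. acc w c j}. cell w))"
    by (rule image_closure_compact[OF continuous_on_bwd_letter[OF assms(2)] compact_Icc cells_subset])
  moreover have "bwd_letter a ` (\<Union>w\<in>{w. acc w c j}. cell w) \<subseteq> (\<Union>w\<in>{w. acc w c' j'}. cell w)"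
  proof
    fix z assume "z \<in> bwd_letter a ` (\<Union>w\<in>{w. acc w c j}. cell w)"
    then obtain w t where "acc w c j" "t \<in> cell w" "z = bwd_letter a t" by auto
    then have "acc (w @ [a]) c' j'" "z \<in> cell (w @ [a])" using assms(3) by (auto simp: cell_append)
    then show "z \<in> (\<Union>w\<in>{w. acc w c' j'}. cell w)" by auto
  qed
  ultimately have "bwd_letter a ` fibre c j \<subseteq> fibre c' j'"
    unfolding fibre_def by (simp add: closure_mono)
  with assms(1) show ?thesis by auto
qed

lemma bwd_letter_plus:
  assumes "y \<in> \<Psi>' \<alpha>"
  shows "bwd_letter (1, Fin D) y \<in> fibre True 1"
proof -
  have "fibre True 1 = bwd (prefix1 (b_up \<alpha>) 1) ` \<Psi>' \<alpha>"
    using image_fibre_up[OF klen_up_gt_1] mobius_image_eq[OF prefix1_up_proper[OF klen_up_gt_1] Psi'_subset] by simp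
  moreover have "prefix1 (b_up \<alpha>) 1 = [(1, Fin D)]"
    using prefix1_up_Suc[of 0] by (simp add: prefix1_0 orb_0 letter_alpha)
  ultimately show ?thesis using assms by auto
qed

lemma plus_state: "(True, 1) \<in> states"
  using klen_up_gt_1 by (simp add: states_def)

lemma lo_state: "(False, 0) \<in> states"
  using klen_gt_0 by (simp add: states_def)

lemma region_reset: "\<alpha> - 1 \<le> x \<Longrightarrow> x < \<alpha> \<Longrightarrow> y \<in> fibre False 0 \<Longrightarrow> (x, y) \<in> region"
  unfolding region_def using lo_state by (intro UN_I[of "(False, 0)"]) (auto simp: orb_0)

lemma region_plus: "T \<alpha> \<alpha> \<le> x \<Longrightarrow> x < \<alpha> \<Longrightarrow> y \<in> \<Psi>' \<alpha> \<Longrightarrow> (x, bwd_letter (1, Fin D) y) \<in> region"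
  unfolding region_def using plus_state bwd_letter_plus by (intro UN_I[of "(True, 1)"]) (auto simp: orb_def)

lemma region_small: "\<alpha> - 1 \<le> x \<Longrightarrow> x < \<alpha> \<Longrightarrow> y \<in> {0..top_end \<alpha>} \<Longrightarrow> (x, y) \<in> region"
  using region_reset[of x y] cell_subset_fibre[OF acc_Nil] by (auto simp: cell_def)

text \<open>The transitions of \<open>acc_extend_big\<close>, carried out on whole fibres. The new
  case is a last state with negative x and digit D+1: this letter acts on y as \<open>(1, D)\<close>
  acts on 1 - y, and since x is right of -\<open>kap\<close>, its image is right of T
  \<alpha>.\<close>

lemma TT_region:
  assumes "(x, y) \<in> region"
  shows "TT \<alpha> (x, y) \<in> region"
proof -
  obtain c j where cj: "enat j < klen c" "c \<Longrightarrow> 1 \<le> j" and x: "orb c j \<le> x" "x < \<alpha>" and y: "y \<in> fibre c j"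
    using assms by (auto simp: region_def states_def)
  have range: "\<alpha> - 1 \<le> x" using orb_range[of c j] cj x by auto
  have y01: "0 \<le> y" "y \<le> 1" using fibre_subset[of c j] y by auto
  have yP: "y \<in> \<Psi>' \<alpha>" using fibre_subset_Psi'[of c j] y by auto
  show ?thesis
  proof (cases "x = 0")
    case True
    then have "TT \<alpha> (x, y) = (0, 0)" by (simp add: TT_def T_def)
    then show ?thesis using region_small[of 0 0] alpha_pos alpha_le_1 top_end_bounds by simp
  next
    case x0: False
    have Tx: "\<alpha> - 1 \<le> T \<alpha> x" "T \<alpha> x < \<alpha>" using T_range[OF x0, of \<alpha>] by auto
    show ?thesis
    proof (cases "letter_at \<alpha> x \<in> big_letters")
      case False
      then show ?thesis using small_letter[OF range x(2) x0 y01] region_small[OF Tx]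
        by (simp add: TT_eq big_letters_def)
    next
      case big: True
      show ?thesis
      proof (cases "x > 0")
        case True
        then obtain d where d: "letter_at \<alpha> x = (1, Fin d)" "T \<alpha> x = 1 / x - of_int d"
          using letter_pos[of x] x by auto
        with big have "d = D" by (auto simp: big_letters_def)
        have "1 / \<alpha> \<le> 1 / x" using True x by (simp add: frac_le)
        then have "T \<alpha> \<alpha> \<le> T \<alpha> x" using d \<open>d = D\<close> T_alpha by simp
        then show ?thesis using region_plus[OF _ Tx(2) yP] d \<open>d = D\<close> by (simp add: TT_eq)
      next
        case False
        with x0 have neg: "x < 0" by simp
        show ?thesis
        proof (cases "enat (Suc j) < klen c")
          case k: True
          obtain d where d: "letter_at \<alpha> x = (-1, Fin d)" "2 \<le> d" "T \<alpha> x = - 1 / x - of_int d"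
            using letter_neg[OF range neg] by metis
          with big have dD: "d \<le> D + 1" by (auto simp: big_letters_def)
          obtain d0 where d0: "letter_at \<alpha> (orb c j) = (-1, Fin d0)" "2 \<le> d0"
            "orb c (Suc j) = - 1 / orb c j - of_int d0" "orb c j < 0"
            using orb_letter[of c j] cj k by metis
          have "1 / (- orb c j) \<le> 1 / (- x)" using neg x d0 by (intro frac_le) auto
          then have le: "of_int d0 + orb c (Suc j) \<le> of_int d + T \<alpha> x" using d d0 by simp
          have "orb c (Suc j) \<ge> \<alpha> - 1" using orb_range[of c "Suc j"] by auto
          then have "real_of_int d0 < of_int d + 1" using le Tx by linarith
          then have "d0 \<le> d" by linarith
          have pl: "(-1, Fin d) \<in> proper_letters" using d by (simp add: proper_letters_def)
          show ?thesis
          proof (cases "d0 = d")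
            case True
            have "bwd_letter (-1, Fin d) y \<in> fibre c (Suc j)"
              using acc_step[OF _ k] d0 True by (intro bwd_letter_fibre[OF y pl]) metis
            moreover have "(c, Suc j) \<in> states" using k by (simp add: states_def)
            moreover have "orb c (Suc j) \<le> T \<alpha> x" using le True by simp
            ultimately show ?thesis unfolding TT_eq d region_def
              by (intro UN_I[of "(c, Suc j)"]) (use Tx d in auto)
          next
            case False
            then have "letter_less (letter_at \<alpha> (orb c j)) (-1, Fin d)"
              using \<open>d0 \<le> d\<close> d d0 letter_less_neg_iff by simp
            then have "bwd_letter (-1, Fin d) y \<in> fibre False 0"
              using acc_reset[OF _ k d(2) dD] by (intro bwd_letter_fibre[OF y pl])
            then show ?thesis using region_reset[OF Tx] d(1) by (simp add: TT_eq)
          qed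
        next
          case k: False
          have "x > - kap" using final_orb_gt[OF cj(1) k] x by simp
          then obtain d where d: "letter_at \<alpha> x = (-1, Fin d)" "D + 1 \<le> d" "T \<alpha> x > 1 / \<alpha> + 1 - of_int d"
            using letter_neg_small[OF range _ neg] by metis
          with big have dD: "d = D + 1" by (auto simp: big_letters_def)
          have "1 - y \<in> \<Psi>' \<alpha>" using final_dual[OF cj(1) _ k y] cj(2) by blast
          moreover have "T \<alpha> \<alpha> \<le> T \<alpha> x" using d dD T_alpha by simp
          ultimately have "(T \<alpha> x, bwd_letter (1, Fin D) (1 - y)) \<in> region" using region_plus Tx by blast
          then show ?thesis using d dD by (simp add: TT_eq algebra_simps)
        qed
      qed
    qed
  qed
qed

lemma visited_subset_region: "visited \<subseteq> region"
proof
  fix p assume "p \<in> visited"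
  then obtain n x where p: "p = (TT \<alpha> ^^ n) (x, 0)" "x \<in> {\<alpha> - 1..<\<alpha>}" by (auto simp: visited_def)
  have "(TT \<alpha> ^^ n) (x, 0) \<in> region"
  proof (induction n)
    case 0
    then show ?case using region_small[of x 0] p top_end_bounds by auto
  next
    case (Suc n)
    then show ?case using TT_region by (cases "(TT \<alpha> ^^ n) (x, 0)") auto
  qed
  with p show "p \<in> region" by simp
qed

text \<open>Points with irrational x and rational cell parameter are visited. Because the domain is
  closed, each section in y is filled first, and then x is extended to the closed interval.\<close>

lemma strip_subset_Omega:
  assumes "(c, j) \<in> states"
  shows "{orb c j..\<alpha>} \<times> fibre c j \<subseteq> \<Omega> \<alpha>"
proof -
  have cl: "closed (\<Omega> \<alpha>)" by (simp add: Omega_eq)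
  have lt: "orb c j < \<alpha>" using orb_range[of c j] assms by (auto simp: states_def)
  have 1: "fibre c j \<subseteq> {y. (x, y) \<in> \<Omega> \<alpha>}" if x: "x \<in> {orb c j<..<\<alpha>} - \<rat>" for x
    unfolding fibre_def
  proof (intro closure_minimal closed_section_right cl UN_least)
    fix w assume "w \<in> {w. acc w c j}"
    then have w: "acc w c j" by simp
    have "bwd w ` closure ({0<..<top_end \<alpha>} \<inter> \<rat>) \<subseteq> {y. (x, y) \<in> \<Omega> \<alpha>}"
    proof (rule image_closure_subset)
      have "closure ({0<..<top_end \<alpha>} \<inter> \<rat>) \<subseteq> {0..1}" using top_end_bounds by (intro closure_minimal) auto
      then show "continuous_on (closure ({0<..<top_end \<alpha>} \<inter> \<rat>)) (bwd w)"
        using continuous_on_bwd[OF acc_proper[OF w]] continuous_on_subset by blast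
      show "bwd w ` ({0<..<top_end \<alpha>} \<inter> \<rat>) \<subseteq> {y. (x, y) \<in> \<Omega> \<alpha>}"
        unfolding Omega_eq using visited_acc[OF w] x closure_subset[of visited] by auto
    qed (rule closed_section_right[OF cl])
    then show "cell w \<subseteq> {y. (x, y) \<in> \<Omega> \<alpha>}"
      unfolding cell_def using Rats_closure_interval[OF top_end_bounds(1)] by (meson image_mono order_trans)
  qed
  have 2: "{orb c j..\<alpha>} \<subseteq> {x. (x, y) \<in> \<Omega> \<alpha>}" if "y \<in> fibre c j" for y
  proof -
    have "closure ({orb c j<..<\<alpha>} - \<rat>) \<subseteq> {x. (x, y) \<in> \<Omega> \<alpha>}"
      by (intro closure_minimal closed_section_left cl) (use 1 that in blast)
    then show ?thesis using irrational_closure_interval[OF lt] by blast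
  qed
  then show ?thesis by blast
qed

definition lo_part :: "(real \<times> real) set" where
  "lo_part = (\<Union>j \<in> {j. 1 \<le> j \<and> enat j < k_lo \<alpha>}. {orb False j..\<alpha>} \<times> fibre False j)"

definition up_part :: "(real \<times> real) set" where
  "up_part = (\<Union>j \<in> {j. 1 \<le> j \<and> enat j < k_up \<alpha>}. {orb True j..\<alpha>} \<times> fibre True j)"

lemma Omega_decomp: "\<Omega> \<alpha> = II \<alpha> \<times> \<Psi> \<alpha> \<union> closure lo_part \<union> closure up_part"
proof (rule antisym)
  have "closed (II \<alpha> \<times> \<Psi> \<alpha>)" unfolding II_def Psi_eq fibre_def by (intro closed_Times) auto
  moreover have "region \<subseteq> II \<alpha> \<times> \<Psi> \<alpha> \<union> lo_part \<union> up_part"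
  proof
    fix p assume "p \<in> region"
    then obtain c j where p: "enat j < klen c" "c \<longrightarrow> 1 \<le> j" "p \<in> {orb c j..\<alpha>} \<times> fibre c j"
      by (fastforce simp: region_def states_def)
    consider "c" | "\<not> c" "j = 0" | "\<not> c" "1 \<le> j" by linarith
    then show "p \<in> II \<alpha> \<times> \<Psi> \<alpha> \<union> lo_part \<union> up_part"
    proof cases
      case 1
      then show ?thesis using p by (auto simp: up_part_def klen_def)
    next
      case 2
      then show ?thesis using p by (auto simp: II_def Psi_eq orb_0)
    next
      case 3
      then show ?thesis using p by (auto simp: lo_part_def klen_def)
    qed
  qed
  ultimately show "\<Omega> \<alpha> \<subseteq> II \<alpha> \<times> \<Psi> \<alpha> \<union> closure lo_part \<union> closure up_part"
    unfolding Omega_eq using visited_subset_region closure_subset[of lo_part] closure_subset[of up_part]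
    by (intro closure_minimal closed_Un closed_closure) blast+
  have cl: "closed (\<Omega> \<alpha>)" by (simp add: Omega_eq)
  have "II \<alpha> \<times> \<Psi> \<alpha> \<subseteq> \<Omega> \<alpha>" using strip_subset_Omega[OF lo_state] by (simp add: II_def Psi_eq orb_0)
  moreover have "lo_part \<subseteq> \<Omega> \<alpha>"
    unfolding lo_part_def using strip_subset_Omega[of False] by (intro UN_least) (simp add: states_def klen_def)
  moreover have "up_part \<subseteq> \<Omega> \<alpha>"
    unfolding up_part_def using strip_subset_Omega[of True] by (intro UN_least) (simp add: states_def klen_def)
  ultimately show "II \<alpha> \<times> \<Psi> \<alpha> \<union> closure lo_part \<union> closure up_part \<subseteq> \<Omega> \<alpha>"
    using cl by (simp add: closure_minimal)
qed

lemma Omega_formula: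
  "\<Omega> \<alpha> = II \<alpha> \<times> \<Psi> \<alpha>
       \<union> closure (\<Union>j \<in> {j. 1 \<le> j \<and> enat j < k_lo \<alpha>}.
           {(T \<alpha> ^^ j) (\<alpha> - 1)..\<alpha>} \<times> mobius_act (N (prefix1 (b_lo \<alpha>) j)) ` \<Psi> \<alpha>)
       \<union> closure (\<Union>j \<in> {j. 1 \<le> j \<and> enat j < k_up \<alpha>}.
           {(T \<alpha> ^^ j) \<alpha>..\<alpha>} \<times> mobius_act (N (prefix1 (b_up \<alpha>) j)) ` \<Psi>' \<alpha>)"
proof -
  have "(\<Union>j \<in> {j. 1 \<le> j \<and> enat j < k_lo \<alpha>}.
           {(T \<alpha> ^^ j) (\<alpha> - 1)..\<alpha>} \<times> mobius_act (N (prefix1 (b_lo \<alpha>) j)) ` \<Psi> \<alpha>) = lo_part"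
    unfolding lo_part_def using image_fibre_lo by (intro SUP_cong) (auto simp: klen_def orb_def)
  moreover have "(\<Union>j \<in> {j. 1 \<le> j \<and> enat j < k_up \<alpha>}.
           {(T \<alpha> ^^ j) \<alpha>..\<alpha>} \<times> mobius_act (N (prefix1 (b_up \<alpha>) j)) ` \<Psi>' \<alpha>) = up_part"
    unfolding up_part_def using image_fibre_up by (intro SUP_cong) (auto simp: klen_def orb_def)
  ultimately show ?thesis using Omega_decomp by simp
qed

lemma Omega_subset: "\<Omega> \<alpha> \<subseteq> {\<alpha> - 1..\<alpha>} \<times> {0..1}"
proof -
  have "region \<subseteq> {\<alpha> - 1..\<alpha>} \<times> {0..1}"
    unfolding region_def
  proof (intro UN_least)
    fix s assume s: "s \<in> states"
    obtain c j where "s = (c, j)" by force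
    with s orb_range[of c j] fibre_subset[of c j]
    show "(case s of (c, j) \<Rightarrow> {orb c j..<\<alpha>} \<times> fibre c j) \<subseteq> {\<alpha> - 1..\<alpha>} \<times> {0..1}"
      by (auto simp: states_def)
  qed
  then have "visited \<subseteq> {\<alpha> - 1..\<alpha>} \<times> {0..1}" using visited_subset_region by blast
  then show ?thesis unfolding Omega_eq by (intro closure_minimal closed_Times) auto
qed

text \<open>Index 0 counts: \<alpha> - 1 and \<alpha> themselves avoid the window, so a window that
  meets the domain stays between them and the first piece of the domain is constant over it.\<close>

lemma Omega_section_constant:
  assumes lo: "\<And>j. enat j < k_lo \<alpha> \<Longrightarrow> (T \<alpha> ^^ j) (\<alpha> - 1) \<notin> {x<..<x'}"
    and up: "\<And>j. enat j < k_up \<alpha> \<Longrightarrow> (T \<alpha> ^^ j) \<alpha> \<notin> {x<..<x'}"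
    and ts: "t \<in> {x<..<x'}" "s \<in> {x<..<x'}" and ty: "(t, y) \<in> \<Omega> \<alpha>"
  shows "(s, y) \<in> \<Omega> \<alpha>"
proof -
  have t: "\<alpha> - 1 \<le> t" "t \<le> \<alpha>" using ty Omega_subset by auto
  have a: "\<alpha> - 1 \<notin> {x<..<x'}" "\<alpha> \<notin> {x<..<x'}"
    using lo[of 0] up[of 0] klen_gt_0[of False] klen_gt_0[of True] by (auto simp: klen_def)
  have x: "\<alpha> - 1 \<le> x" "x' \<le> \<alpha>" using a ts t by auto
  have "(t, y) \<in> II \<alpha> \<times> \<Psi> \<alpha> \<union> closure lo_part \<union> closure up_part" using ty Omega_decomp by simp
  then consider "y \<in> \<Psi> \<alpha>" | "(t, y) \<in> closure lo_part" | "(t, y) \<in> closure up_part" by auto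
  then have "(s, y) \<in> II \<alpha> \<times> \<Psi> \<alpha> \<union> closure lo_part \<union> closure up_part"
  proof cases
    case 1
    then show ?thesis using ts x by (auto simp: II_def)
  next
    case 2
    have "(s, y) \<in> closure lo_part" unfolding lo_part_def
      by (rule closure_strips[OF 2[unfolded lo_part_def] ts x(2)]) (use lo in \<open>auto simp: orb_def\<close>)
    then show ?thesis by simp
  next
    case 3
    have "(s, y) \<in> closure up_part" unfolding up_part_def
      by (rule closure_strips[OF 3[unfolded up_part_def] ts x(2)]) (use up in \<open>auto simp: orb_def\<close>)
    then show ?thesis by simp
  qed
  then show ?thesis using Omega_decomp by simp
qed

lemma nu_density:
  "\<exists>f :: real \<Rightarrow> real. f \<in> borel_measurable borel \<and> (\<forall>t. f t \<ge> 0) \<and>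
        \<nu> \<alpha> = density lborel (\<lambda>t. ennreal (f t)) \<and>
        (\<forall>x x'.
           (\<forall>j. enat j < k_lo \<alpha> \<longrightarrow> (T \<alpha> ^^ j) (\<alpha> - 1) \<notin> {x<..<x'}) \<and>
           (\<forall>j. enat j < k_up \<alpha> \<longrightarrow> (T \<alpha> ^^ j) \<alpha> \<notin> {x<..<x'})
           \<longrightarrow> continuous_on {x<..<x'} f)"
proof -
  have "{0..\<alpha>} \<times> {0..top_end \<alpha>} \<subseteq> \<Omega> \<alpha>"
    using strip_subset_Omega[OF lo_state] cell_subset_fibre[OF acc_Nil] alpha_le_1
    by (fastforce simp: orb_0 cell_def)
  then obtain f where f: "f \<in> borel_measurable borel" "\<forall>t. f t \<ge> 0"
      "distr (uniform_measure \<mu> (\<Omega> \<alpha>)) borel fst = density lborel (\<lambda>t. ennreal (f t))"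
      "\<And>x x'. (\<forall>t\<in>{x<..<x'}. \<forall>s\<in>{x<..<x'}. \<forall>y. (t, y) \<in> \<Omega> \<alpha> \<longrightarrow> (s, y) \<in> \<Omega> \<alpha>) \<Longrightarrow> continuous_on {x<..<x'} f"
    using marginal_density[of "\<Omega> \<alpha>" "\<alpha> - 1" \<alpha> "top_end \<alpha>"] Omega_subset alpha_pos alpha_le_1 top_end_bounds
    by (auto simp: Omega_eq)
  show ?thesis
  proof (intro exI[of _ f] conjI allI impI)
    show "\<nu> \<alpha> = density lborel (\<lambda>t. ennreal (f t))" using f(3) by (simp add: \<nu>_def \<mu>_norm_def)
    fix x x' assume "(\<forall>j. enat j < k_lo \<alpha> \<longrightarrow> (T \<alpha> ^^ j) (\<alpha> - 1) \<notin> {x<..<x'}) \<and>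
           (\<forall>j. enat j < k_up \<alpha> \<longrightarrow> (T \<alpha> ^^ j) \<alpha> \<notin> {x<..<x'})"
    then show "continuous_on {x<..<x'} f"
      using Omega_section_constant by (intro f(4)) blast
  qed (use f in auto)
qed

end

subsection \<open>Regular continued fractions and matching\<close>

fun rcf :: "nat list \<Rightarrow> real \<Rightarrow> real" where
  "rcf [] t = t"
| "rcf (c # a) t = 1 / (real c + rcf a t)"

abbreviation pos_list :: "nat list \<Rightarrow> bool" where
  "pos_list a \<equiv> \<forall>n\<in>set a. n \<ge> 1"

lemma rcf_append: "rcf (a @ b) t = rcf a (rcf b t)"
  by (induction a) auto

lemma rcf_pos: "pos_list a \<Longrightarrow> a \<noteq> [] \<Longrightarrow> t > -1 \<Longrightarrow> rcf a t > 0"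
proof (induction a)
  case (Cons c a)
  have "rcf a t > -1" using Cons by (cases "a = []") force+
  then show ?case using Cons by auto
qed simp

lemma rcf_range: "pos_list a \<Longrightarrow> t \<in> {0..1} \<Longrightarrow> rcf a t \<in> {0..1}"
proof (induction a)
  case (Cons c a)
  then have "real c + rcf a t \<ge> 1" by auto
  then show ?case by simp
qed simp

lemma rcf_gt_minus_1: "pos_list a \<Longrightarrow> t > -1 \<Longrightarrow> rcf a t > -1"
  using rcf_pos[of a t] by (cases "a = []") auto

lemma rcf_less:
  "pos_list a \<Longrightarrow> -1 < t \<Longrightarrow> t < t' \<Longrightarrow> if even (length a) then rcf a t < rcf a t' else rcf a t' < rcf a t"
proof (induction a)
  case (Cons c a)
  have p: "real c + rcf a t > 0" "real c + rcf a t' > 0"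
    using rcf_gt_minus_1[of a t] rcf_gt_minus_1[of a t'] Cons.prems by auto
  then show ?case using Cons by (auto intro!: divide_strict_left_mono simp: mult_pos_pos)
qed simp

lemma rcf_inj: "pos_list a \<Longrightarrow> -1 < t \<Longrightarrow> -1 < t' \<Longrightarrow> rcf a t = rcf a t' \<Longrightarrow> t = t'"
  using rcf_less[of a t t'] rcf_less[of a t' t] by (metis less_irrefl linorder_neqE_linordered_idom)

lemma rcf_contract:
  "pos_list a \<Longrightarrow> a \<noteq> [] \<Longrightarrow> 0 \<le> s \<Longrightarrow> 0 \<le> t \<Longrightarrow> s \<noteq> t \<Longrightarrow> \<bar>rcf a s - rcf a t\<bar> < \<bar>s - t\<bar>"
proof (induction a)
  case (Cons c a)
  define x y where "x = rcf a s" and "y = rcf a t"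
  have xy: "0 \<le> x" "0 \<le> y" "x \<noteq> y"
  proof -
    show "0 \<le> x" "0 \<le> y" unfolding x_def y_def using rcf_pos[of a s] rcf_pos[of a t] Cons by (cases "a = []"; force)+
    show "x \<noteq> y" unfolding x_def y_def using rcf_inj[of a s t] Cons by auto
  qed
  have le: "\<bar>x - y\<bar> \<le> \<bar>s - t\<bar>" using Cons by (cases "a = []") (auto simp: x_def y_def)
  have c: "real c \<ge> 1" using Cons by auto
  have "1 < (real c + x) * (real c + y)"
  proof (cases "x > 0")
    case True
    then have "(real c + x) * 1 \<le> (real c + x) * (real c + y)" using c xy by (intro mult_left_mono) auto
    moreover have "1 < (real c + x) * 1" using c True by simp
    ultimately show ?thesis by (rule less_le_trans[rotated])
  next
    case False
    then have "y > 0" using xy by auto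
    have "1 * (real c + y) \<le> (real c + x) * (real c + y)" using c xy by (intro mult_right_mono) auto
    moreover have "1 < 1 * (real c + y)" using c \<open>y > 0\<close> by simp
    ultimately show ?thesis by (blast intro: less_le_trans)
  qed
  moreover have "1 / (real c + x) - 1 / (real c + y) = (y - x) / ((real c + x) * (real c + y))"
    using c xy by (simp add: diff_frac_eq)
  ultimately have "\<bar>1 / (real c + x) - 1 / (real c + y)\<bar> = \<bar>x - y\<bar> / ((real c + x) * (real c + y))"
    by (simp add: abs_divide abs_minus_commute)
  also have "\<dots> < \<bar>x - y\<bar>" using \<open>1 < _\<close> xy(3) by (simp add: divide_less_eq)
  finally show ?case using le by (simp add: x_def y_def)
qed simp

lemma rcf_continuous_on: "pos_list a \<Longrightarrow> continuous_on {-1<..} (rcf a)"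
proof (induction a)
  case (Cons c a)
  have "real c + rcf a t \<noteq> 0" if "t \<in> {-1<..}" for t
    using rcf_gt_minus_1[of a t] Cons.prems that by force
  moreover have "continuous_on {-1<..} (rcf a)" using Cons by simp
  moreover have "rcf (c # a) = (\<lambda>t. 1 / (real c + rcf a t))" by auto
  ultimately show ?case by (auto intro!: continuous_intros)
qed (simp add: continuous_on_id)

text \<open>The alternating order together with the parity convention of the definition of \<open>FF\<close>: for
  \<open>b = True\<close> equality is allowed in odd length only.\<close>

fun alt_ok :: "bool \<Rightarrow> nat list \<Rightarrow> nat list \<Rightarrow> bool" where
  "alt_ok b (x # s) (y # p) \<longleftrightarrow> (if b then x < y else y < x) \<or> (x = y \<and> alt_ok (\<not> b) s p)"
| "alt_ok b s p \<longleftrightarrow> \<not> b"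

lemma alt_ok_iff:
  "length s = length p \<Longrightarrow> alt_ok b s p \<longleftrightarrow> (s = p \<and> odd (length s) = b) \<or>
    (\<exists>j<length s. take j s = take j p \<and> (if even j = b then s ! j < p ! j else p ! j < s ! j))"
proof (induction s p arbitrary: b rule: list_induct2)
  case (Cons x s y p)
  have "(\<exists>j<length (x # s). take j (x # s) = take j (y # p) \<and> (if even j = b then (x # s) ! j < (y # p) ! j else (y # p) ! j < (x # s) ! j))
    \<longleftrightarrow> (if b then x < y else y < x) \<or> (x = y \<and> (\<exists>j<length s. take j s = take j p \<and> (if even j = (\<not> b) then s ! j < p ! j else p ! j < s ! j)))"
    unfolding length_Cons Ex_less_Suc2 by auto
  then show ?case using Cons by auto
qed auto

lemma alt_less_iff: "length s = length p \<Longrightarrow> alt_less s p \<longleftrightarrow>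
    (\<exists>j<length s. take j s = take j p \<and> (if even j then s ! j < p ! j else p ! j < s ! j))"
proof -
  assume "length s = length p"
  moreover have "(-1) ^ j * int (s ! j) < (-1) ^ j * int (p ! j) \<longleftrightarrow> (if even j then s ! j < p ! j else p ! j < s ! j)" for j
    by (cases "even j") auto
  ultimately show ?thesis by (simp add: alt_less_def)
qed

lemma alt_ok_even: "length s = length p \<Longrightarrow> even (length s) \<Longrightarrow> alt_ok True s p \<longleftrightarrow> alt_less s p"
  by (simp add: alt_ok_iff alt_less_iff)

lemma alt_ok_odd: "length s = length p \<Longrightarrow> odd (length s) \<Longrightarrow> alt_ok True s p \<longleftrightarrow> alt_le s p"
  by (auto simp: alt_ok_iff alt_less_iff alt_le_def)

text \<open>A larger quotient gives a smaller value, and the direction flips at each place as it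
  does in \<open>alt_ok\<close>. The inequality is only weak because tails may be 0 or 1.\<close>

lemma alt_ok_rcf:
  "length s = length p \<Longrightarrow> alt_ok b s p \<Longrightarrow> s \<noteq> p \<Longrightarrow> pos_list s \<Longrightarrow> pos_list p \<Longrightarrow> x \<in> {0..1} \<Longrightarrow> y \<in> {0..1} \<Longrightarrow>
    if b then rcf p y \<le> rcf s x else rcf s x \<le> rcf p y"
proof (induction s p arbitrary: b rule: list_induct2)
  case (Cons c s d p)
  have r: "rcf s x \<in> {0..1}" "rcf p y \<in> {0..1}" using rcf_range Cons.prems by auto
  have cd: "c \<ge> 1" "d \<ge> 1" using Cons.prems by auto
  consider "if b then c < d else d < c" | "c = d" "alt_ok (\<not> b) s p" "s \<noteq> p" using Cons.prems by auto
  then show ?case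
  proof cases
    case 1
    show ?thesis
    proof (cases b)
      case True
      with 1 have "real c + 1 \<le> real d" by simp
      then have "real c + rcf s x \<le> real d + rcf p y" "0 < real c + rcf s x" using r cd by auto
      then show ?thesis using True by (simp add: frac_le)
    next
      case False
      with 1 have "real d + 1 \<le> real c" by simp
      then have "real d + rcf p y \<le> real c + rcf s x" "0 < real d + rcf p y" using r cd by auto
      then show ?thesis using False by (simp add: frac_le)
    qed
  next
    case 2
    then have "if b then rcf s x \<le> rcf p y else rcf p y \<le> rcf s x" using Cons.IH[of "\<not> b"] Cons.prems by auto
    moreover have "0 < real c + rcf s x" "0 < real c + rcf p y" using r cd by auto
    ultimately show ?thesis using 2 by (auto intro: frac_le)
  qed
qed simp

text \<open>Merges the two families of conditions in \<open>FF\<close> into one condition on all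
  tails. The length may be even, so that both regular expansions of a rational number can be
  treated.\<close>

definition admissible :: "nat list \<Rightarrow> bool" where
  "admissible a \<longleftrightarrow> a \<noteq> [] \<and> pos_list a \<and> (\<forall>i. 0 < i \<and> i < length a \<longrightarrow> alt_ok True (drop i a) (take (length a - i) a))"

lemma pos_list_drop: "pos_list a \<Longrightarrow> pos_list (drop i a)"
  by (auto dest: in_set_dropD)

lemma pos_list_take: "pos_list a \<Longrightarrow> pos_list (take i a)"
  by (auto dest: in_set_takeD)

text \<open>If some tail were smaller than \<open>\<alpha>\<close>, take the smallest one: it comes from a border
  of odd length, and contraction yields \<open>\<alpha> \<le> t\<close>.\<close>

lemma admissible_tails_ge:
  assumes "admissible a" "0 \<le> t" "t < rcf a t" "t \<le> 1" "i < length a"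
  shows "rcf a t \<le> rcf (drop i a) t"
proof (rule ccontr)
  assume neg: "\<not> rcf a t \<le> rcf (drop i a) t"
  define N where "N = length a"
  define u where "u i = rcf (drop i a) t" for i
  have a: "pos_list a" using assms by (simp add: admissible_def)
  have i: "i \<in> {0<..<N}" using neg assms(5) by (cases "i = 0") (auto simp: N_def)
  define m where "m = arg_min_on u {0<..<N}"
  have ne: "{0<..<N} \<noteq> {}" using i by blast
  have m: "m \<in> {0<..<N}" "\<And>j. j \<in> {0<..<N} \<Longrightarrow> u m \<le> u j"
    unfolding m_def using arg_min_if_finite(1)[OF _ ne, of u] arg_min_least[OF _ ne, of _ u] by blast+
  have um: "u m < rcf a t" using m(2)[OF i] neg by (simp add: u_def)
  define s where "s = drop m a"
  define p where "p = take (N - m) a"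
  have len: "length s = length p" using m by (simp add: s_def p_def N_def)
  have ok: "alt_ok True s p" using assms(1) m by (simp add: admissible_def s_def p_def N_def)
  have split: "rcf a t = rcf p (u (N - m))"
    unfolding p_def u_def by (metis append_take_drop_id rcf_append)
  have Nm: "N - m \<in> {0<..<N}" using m by auto
  have uN: "u (N - m) \<in> {0..1}" unfolding u_def using rcf_range[OF pos_list_drop[OF a]] assms by auto
  have eq: "s = p"
  proof (rule ccontr)
    assume "s \<noteq> p"
    from alt_ok_rcf[OF len ok this, of t "u (N - m)"] pos_list_drop[OF a] pos_list_take[OF a] uN assms
    have "rcf p (u (N - m)) \<le> rcf s t" by (simp add: s_def p_def)
    then show False using um split by (simp add: u_def s_def)
  qed
  have ums: "u m = rcf p t" using eq by (simp add: u_def s_def)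
  have odd: "odd (length p)" using ok eq by (simp add: alt_ok_iff)
  have pp: "pos_list p" "p \<noteq> []" using pos_list_take[OF a] m by (auto simp: p_def N_def)
  have lt: "u (N - m) < t"
  proof (rule ccontr)
    assume "\<not> u (N - m) < t"
    then have "rcf p (u (N - m)) \<le> rcf p t"
      using rcf_less[OF pp(1), of t "u (N - m)"] odd assms by (cases "u (N - m) = t") auto
    then show False using um split ums by simp
  qed
  \<comment> \<open>The value of a is \<open>rcf p (u (N - m))\<close> and \<open>u m\<close> is
    \<open>rcf p t\<close>. By minimality \<open>u m <= u (N - m)\<close>, so the contraction would
    give a value of a below t.\<close>
  have "\<bar>rcf p (u (N - m)) - rcf p t\<bar> < \<bar>u (N - m) - t\<bar>"
    using rcf_contract[OF pp, of "u (N - m)" t] uN assms lt by auto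
  then have "rcf a t - u m < t - u (N - m)" using split ums um lt by simp
  then show False using m(2)[OF Nm] assms(3) by simp
qed

text \<open>Switches between the two regular continued fraction expansions of a rational number;
  meaningless on \<open>[1]\<close>.\<close>

definition conv :: "nat list \<Rightarrow> nat list" where
  "conv a = (if last a \<ge> 2 then butlast a @ [last a - 1, 1] else butlast (butlast a) @ [last (butlast a) + 1])"

lemma conv_split:
  assumes "a \<noteq> []" "pos_list a" "a \<noteq> [1]"
  obtains b c where "c \<ge> 2" "a = b @ [c]" "conv a = b @ [c - 1, 1]"
  | b c where "c \<ge> 1" "a = b @ [c, 1]" "conv a = b @ [c + 1]"
proof -
  obtain b e where a: "a = b @ [e]" using assms(1) by (metis append_butlast_last_id)
  show ?thesis
  proof (cases "e \<ge> 2")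
    case True
    then show ?thesis using a that(1)[of e b] by (simp add: conv_def)
  next
    case False
    then have e: "e = 1" using assms(2) a by auto
    then obtain b' c where b: "b = b' @ [c]" using a assms(3) by (metis append_Nil append_butlast_last_id)
    then show ?thesis using a e that(2)[of c b'] assms(2) by (simp add: conv_def butlast_append)
  qed
qed

text \<open>c + t = (c - 1) + 1/(1 + t') holds for t' = 1/(1 + t) - 1. This substitution is an
  involution and so serves both directions of \<open>conv\<close>.\<close>

lemma rcf_conv:
  assumes "a \<noteq> []" "pos_list a" "a \<noteq> [1]" "t > -1"
  shows "rcf (conv a) (1 / (1 + t) - 1) = rcf a t"
  using conv_split[OF assms(1-3)]
proof cases
  case (1 b c)
  then show ?thesis by (simp add: rcf_append of_nat_diff)
next
  case (2 b c)
  then show ?thesis by (simp add: rcf_append add.assoc)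
qed

lemma length_conv:
  assumes "a \<noteq> []" "pos_list a" "a \<noteq> [1]"
  shows "odd (length (conv a)) \<longleftrightarrow> even (length a)" "pos_list (conv a)" "conv a \<noteq> []"
  by (use assms(2) in \<open>cases rule: conv_split[OF assms]; auto\<close>)+

text \<open>At the last place, weak and strict comparison differ by one unit, which the split
  absorbs: c <= e becomes c - 1 < e, and e < c becomes e <= c - 1, a tie being settled by 1 <=
  e'.\<close>

lemma alt_ok_split_last:
  "length s = length p \<Longrightarrow> c \<ge> 2 \<Longrightarrow> e' \<ge> 1 \<Longrightarrow> alt_ok b (s @ [c]) (p @ [e]) \<Longrightarrow> alt_ok b (s @ [c - 1, 1]) (p @ [e, e'])"
proof (induction s p arbitrary: b rule: list_induct2)
  case Nil
  then show ?case by (cases b) (auto split: if_splits)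
qed auto

text \<open>The final digit 1 against e' >= 1 can settle a tie c = e in one direction only, so the
  two orders become c + 1 <= e and e < c + 1, as required at the last place.\<close>

lemma alt_ok_merge_last:
  "length s = length p \<Longrightarrow> e' \<ge> 1 \<Longrightarrow> alt_ok b (s @ [c, 1]) (p @ [e, e']) \<Longrightarrow> alt_ok b (s @ [c + 1]) (p @ [e])"
proof (induction s p arbitrary: b rule: list_induct2)
  case Nil
  then show ?case by (cases b) (auto split: if_splits)
qed auto

lemma take_Suc_snoc: "m < length b \<Longrightarrow> 0 < m \<Longrightarrow> take (Suc m) b = butlast (take m b) @ [last (take m b), b ! m]"
proof -
  assume m: "m < length b" "0 < m"
  then have "take m b \<noteq> []" by auto
  have "take (Suc m) b = take m b @ [b ! m]" using m by (simp add: take_Suc_conv_app_nth)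
  also have "take m b = butlast (take m b) @ [last (take m b)]" using \<open>take m b \<noteq> []\<close> by simp
  finally show ?thesis by simp
qed

text \<open>Switching the expansion alters each tail only at its end and lengthens or shortens the
  prefix compared with it by one digit, which is what the two lemmas on last digits handle.\<close>

lemma admissible_conv:
  assumes "admissible a" "a \<noteq> [1]"
  shows "admissible (conv a)"
proof -
  have a: "a \<noteq> []" "pos_list a" and ok: "\<And>i. 0 < i \<Longrightarrow> i < length a \<Longrightarrow> alt_ok True (drop i a) (take (length a - i) a)"
    using assms by (auto simp: admissible_def)
  have nth_pos: "l ! m \<ge> 1" if "pos_list l" "m < length l" for l :: "nat list" and m using that nth_mem by blast
  have "alt_ok True (drop i (conv a)) (take (length (conv a) - i) (conv a))" if i: "0 < i" "i < length (conv a)" for i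
    using conv_split[OF a assms(2)]
  proof cases
    case (1 b c)
    show ?thesis
    \<comment> \<open>The tail [1] is new. It is compared with the first digit, which is at least 1,
      and equality is allowed in length one.\<close>
    proof (cases "i = length a")
      case True
      then have d: "drop i (conv a) = [1]" "length (conv a) - i = 1" using 1 by auto
      obtain x l where x: "conv a = x # l" using 1 by (cases "conv a") auto
      have "x \<ge> 1" using length_conv(2)[OF a assms(2)] x by auto
      then show ?thesis unfolding d unfolding x by auto
    next
      case False
      define m where "m = length a - i"
      have i': "i < length a" "i \<le> length b" using False i 1 by auto
      have m: "0 < m" "m \<le> length b" using i' i 1 by (auto simp: m_def)
      have t1: "take m a = take m b" "take m (b @ [c - 1]) = take m b" using m 1 by auto
      have ne: "take m b \<noteq> []" using m by auto
      have "alt_ok True (drop i b @ [c]) (butlast (take m b) @ [last (take m b)])"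
        using ok[OF i(1) i'(1)] 1 i' t1 ne unfolding m_def[symmetric] by simp
      moreover have "length (drop i b) = length (butlast (take m b))" using m i' 1 by (auto simp: m_def)
      moreover have "(b @ [c - 1]) ! m \<ge> 1" using nth_pos[of "b @ [c - 1]" m] a(2) 1 m by auto
      ultimately have "alt_ok True (drop i b @ [c - 1, 1]) (butlast (take m b) @ [last (take m b), (b @ [c - 1]) ! m])"
        using 1(1) by (intro alt_ok_split_last)
      moreover have "take (Suc m) (b @ [c - 1]) = butlast (take m b) @ [last (take m b), (b @ [c - 1]) ! m]"
        using take_Suc_snoc[of m "b @ [c - 1]"] m t1 by simp
      moreover have "take (length (conv a) - i) (conv a) = take (Suc m) (b @ [c - 1])"
      proof -
        have "length (conv a) - i = Suc m" using 1 i' by (simp add: m_def Suc_diff_le)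
        moreover have "conv a = (b @ [c - 1]) @ [1]" using 1 by simp
        ultimately show ?thesis using m by (simp only: take_append) simp
      qed
      ultimately show ?thesis using 1 i' by simp
    qed
  next
    case (2 b c)
    define m where "m = length (conv a) - i"
    have i': "i \<le> length b" "i < length a" using i 2 by auto
    have m: "0 < m" "m \<le> length b" using i 2 by (auto simp: m_def)
    have t1: "take m (conv a) = take m b" "take m (b @ [c]) = take m b" using m 2 by auto
    have t2: "take (Suc m) (b @ [c]) = butlast (take m b) @ [last (take m b), (b @ [c]) ! m]"
      using take_Suc_snoc[of m "b @ [c]"] m t1 by simp
    have ne: "take m b \<noteq> []" using m by auto
    have "take (length a - i) a = take (Suc m) (b @ [c])"
    proof -
      have "length a - i = Suc m" using 2 i' by (simp add: m_def Suc_diff_le)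
      moreover have "a = (b @ [c]) @ [1]" using 2 by simp
      ultimately show ?thesis using m by (simp only: take_append) simp
    qed
    then have "alt_ok True (drop i b @ [c, 1]) (butlast (take m b) @ [last (take m b), (b @ [c]) ! m])"
      using ok[OF i(1) i'(2)] 2 i' t2 by simp
    moreover have "length (drop i b) = length (butlast (take m b))" using m i' 2 by (auto simp: m_def)
    moreover have "(b @ [c]) ! m \<ge> 1" using nth_pos[of "b @ [c]" m] a(2) 2 m by auto
    ultimately have "alt_ok True (drop i b @ [c + 1]) (butlast (take m b) @ [last (take m b)])"
      by (intro alt_ok_merge_last)
    then show ?thesis using 2 i' t1 ne unfolding m_def[symmetric] by simp
  qed
  then show ?thesis using length_conv[OF a assms(2)] by (simp add: admissible_def)
qed

text \<open>If a began with 1, the tail of length one would force the last digit to be 1. The tail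
  [x, 1] of length two would then have to be strictly below [1, y], which is impossible for x, y >=
  1.\<close>

lemma admissible_hd_ge_2:
  assumes "admissible a" "a \<noteq> [1]" "odd (length a)"
  shows "hd a \<ge> 2"
proof (rule ccontr)
  assume "\<not> hd a \<ge> 2"
  moreover have a: "a \<noteq> []" "pos_list a" using assms by (auto simp: admissible_def)
  then have "hd a \<ge> 1" by auto
  ultimately have h: "hd a = 1" by simp
  define N where "N = length a"
  obtain y l where yl: "a = 1 # y # l" using h a assms(2) by (cases a; cases "tl a") auto
  have N: "N \<ge> 2" using yl by (simp add: N_def)
  obtain b x z where b: "a = b @ [x, z]"
    using yl by (metis append.assoc append_Cons append_Nil append_butlast_last_id list.distinct(1) butlast.simps(2) last_ConsR)
  have lb: "length b = N - 2" using b by (simp add: N_def)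
  have ok: "\<And>i. 0 < i \<Longrightarrow> i < N \<Longrightarrow> alt_ok True (drop i a) (take (N - i) a)"
    using assms(1) by (simp add: admissible_def N_def)
  have 1: "alt_ok True (drop (N - 1) a) (take 1 a)"
    using ok[of "N - 1"] N by simp
  have "drop (N - 1) a = [z]" using b N lb by (simp add: numeral_2_eq_2 Suc_diff_le)
  moreover have "z \<ge> 1" using a(2) unfolding b by simp
  ultimately have z: "z = 1" using 1 yl by auto
  have "N \<noteq> 2" using assms(3) by (auto simp: N_def)
  then have "alt_ok True (drop (N - 2) a) (take 2 a)"
    using ok[of "N - 2"] N by simp
  moreover have "drop (N - 2) a = [x, z]" using b lb by simp
  moreover have "x \<ge> 1" using a(2) unfolding b by simp
  moreover have "y \<ge> 1" using a(2) unfolding yl by simp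
  ultimately show False using yl z by auto
qed

text \<open>The itinerary of -\<open>kap\<close>, where \<open>matches a t\<close> holds, up to the
  last point t. It is \<open>hat_word\<close> with the last digit lowered by one, because the orbit
  ends in t and not in t - 1.\<close>

fun up_word :: "nat list \<Rightarrow> letter list" where
  "up_word [] = []"
| "up_word [c] = [(-1, Fin (1 + int c))]"
| "up_word (c # b # a) = (-1, Fin (2 + int c)) # replicate (b - 1) (-1, Fin 2) @ up_word a"

lemma length_up_word: "length (up_word a) = length (hat_word a)"
  by (induction a rule: up_word.induct) auto

lemma up_word_split: "a \<noteq> [] \<Longrightarrow> \<exists>d r. up_word a = (-1, Fin d) # r"
  by (cases a rule: up_word.cases) auto

lemma char_word_neg: "pos_list a \<Longrightarrow> char_word a \<in> lists alph_neg"
  by (induction a rule: char_word.induct) (auto simp: alph_neg_def)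

text \<open>In the coordinate z with y = z/(1 + z) the letter \<open>(-1, 2)\<close> is the
  translation z -> z + 1.\<close>

lemma bwd_twos: "0 \<le> z \<Longrightarrow> bwd (replicate n (-1, Fin 2)) (z / (1 + z)) = (z + real n) / (1 + z + real n)"
proof (induction n arbitrary: z)
  case (Suc n)
  have "1 / (2 - z / (1 + z)) = (z + 1) / (1 + (z + 1))"
    using Suc.prems by (simp add: divide_simps) (simp add: algebra_simps)
  then show ?case using Suc.IH[of "z + 1"] Suc.prems by (simp add: algebra_simps)
qed simp

text \<open>Write the point as z/(1 + z) for the word and as 1 - z for its dual. A pair of quotients
  c, b replaces z by z' = 1/(b + x) with x = 1/(z + c) on both sides, so the induction
  closes.\<close>

lemma bwd_dual:
  "odd (length a) \<Longrightarrow> pos_list a \<Longrightarrow> 0 \<le> z \<Longrightarrow> 1 - bwd (char_word a) (z / (1 + z)) = bwd (up_word a) (1 - z)"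
proof (induction a arbitrary: z rule: up_word.induct)
  case (2 c)
  then have "bwd (char_word [c]) (z / (1 + z)) = (z + (real c - 1)) / (z + real c)"
    using bwd_twos[of z "c - 1"] by (simp add: of_nat_diff)
  then have "1 - bwd (char_word [c]) (z / (1 + z)) = 1 - (z + (real c - 1)) / (z + real c)" by simp
  also have "\<dots> = 1 / (z + real c)"
  proof -
    have "z + real c > 0" using 2 by auto
    then show ?thesis by (simp add: divide_simps)
  qed
  also have "\<dots> = bwd (up_word [c]) (1 - z)" by (simp add: algebra_simps)
  finally show ?case .
next
  case (3 c b a)
  have c: "c \<ge> 1" "b \<ge> 1" using 3 by auto
  define x where "x = 1 / (z + real c)"
  have x: "x > 0" using c 3 by (simp add: x_def add_nonneg_pos)
  define z' where "z' = 1 / (real b + x)"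
  have bx: "real b + x > 0" using x c by simp
  have z': "z' \<ge> 0" using bx by (simp add: z'_def)
  have y1: "bwd (replicate (c - 1) (-1, Fin 2)) (z / (1 + z)) = 1 - x"
    using bwd_twos[of z "c - 1"] c 3 by (simp add: of_nat_diff x_def divide_simps)
  have "bwd_letter (-1, Fin (2 + int b)) (1 - x) = 1 / (1 + (real b + x))" by (simp add: algebra_simps)
  also have "\<dots> = z' / (1 + z')" using bx by (simp add: z'_def divide_simps)
  finally have L: "bwd (char_word (c # b # a)) (z / (1 + z)) = bwd (char_word a) (z' / (1 + z'))"
    using y1 by (simp add: bwd_append)
  have "bwd_letter (-1, Fin (2 + int c)) (1 - z) = 1 / (1 + (z + real c))" by (simp add: algebra_simps)
  also have "\<dots> = x / (1 + x)" using c 3 by (simp add: x_def divide_simps)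
  finally have "bwd (up_word (c # b # a)) (1 - z) = bwd (up_word a) (bwd (replicate (b - 1) (-1, Fin 2)) (x / (1 + x)))"
    by (simp add: bwd_append)
  also have "bwd (replicate (b - 1) (-1, Fin 2)) (x / (1 + x)) = 1 - z'"
    using bwd_twos[of x "b - 1"] x c bx by (simp add: of_nat_diff z'_def divide_simps algebra_simps)
  finally show ?case using 3 z' L by simp
qed simp

lemma fwd_twos: "n \<ge> 1 \<Longrightarrow> s > -1 \<Longrightarrow> fwd (replicate (n - 1) (-1, Fin 2)) (1 / (1 + s) - 1) = 1 / (real n + s) - 1"
proof (induction n rule: dec_induct)
  case (step n)
  have "fwd (replicate (Suc n - 1) (-1, Fin 2)) (1 / (1 + s) - 1) = - 1 / (2 + (1 / (real n + s) - 1))"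
    using step by (cases n) auto
  also have "\<dots> = 1 / (real (Suc n) + s) - 1"
  proof -
    have "real n + s > 0" using step by auto
    then show ?thesis by (simp add: divide_simps)
  qed
  finally show ?case .
qed simp

text \<open>The passage between regular and backward continued fractions: a quotient c at an odd
  place becomes c - 1 letters \<open>(-1, 2)\<close>, a quotient b at an even place the letter
  \<open>(-1, 2 + b)\<close>.\<close>

lemma fwd_char_word: "odd (length a) \<Longrightarrow> pos_list a \<Longrightarrow> t > -1 \<Longrightarrow> fwd (char_word a) (1 / (1 + t) - 1) = rcf a t - 1"
proof (induction a rule: char_word.induct)
  case (2 c)
  then show ?case using fwd_twos[of c t] by simp
next
  case (3 c b a)
  have "a \<noteq> []" using 3 by auto
  then have s2: "rcf a t > 0" using rcf_pos[of a t] 3 by auto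
  define s where "s = rcf (b # a) t"
  have s: "s > 0" using rcf_pos[of "b # a" t] 3 by (simp add: s_def)
  have "of_int (-1) / (of_int (2 + int b) + (rcf a t - 1)) = 1 / (1 + s) - 1"
    using s2 3(3) by (simp add: s_def divide_simps)
  moreover have "fwd (char_word a) (1 / (1 + t) - 1) = rcf a t - 1" using 3 by simp
  ultimately have "fwd (char_word (c # b # a)) (1 / (1 + t) - 1) = fwd (replicate (c - 1) (-1, Fin 2)) (1 / (1 + s) - 1)"
    by (simp only: char_word.simps fwd_append append_Cons fwd.simps)
  also have "\<dots> = 1 / (real c + s) - 1" using 3 s by (intro fwd_twos) auto
  finally show ?case by (simp add: s_def)
qed simp

text \<open>The value 1/(1 + \<open>rcf a t\<close>) has an additional first quotient 1, which
  shifts the parity of all places; hence the exchanged roles in the dual word.\<close>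

lemma fwd_hat_word: "odd (length a) \<Longrightarrow> pos_list a \<Longrightarrow> t > 0 \<Longrightarrow> fwd (hat_word a) (t - 1) = 1 / (1 + rcf a t) - 1"
proof (induction a rule: hat_word.induct)
  case (2 c)
  then have "real c + t > 0" by auto
  then show ?case by (simp add: divide_simps)
next
  case (3 c b a)
  have "a \<noteq> []" using 3 by auto
  then have s2: "rcf a t > 0" using rcf_pos[of a t] 3 by auto
  define s where "s = rcf (b # a) t"
  have s: "s > 0" using rcf_pos[of "b # a" t] 3 by (simp add: s_def)
  have "fwd (hat_word (c # b # a)) (t - 1) = of_int (-1) / (of_int (2 + int c) + (1 / (real b + rcf a t) - 1))"
    using 3 fwd_twos[of b "rcf a t"] s2 by (simp add: fwd_append)
  also have "\<dots> = - 1 / (1 + (real c + s))" by (simp add: s_def algebra_simps)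
  also have "\<dots> = 1 / (1 + rcf (c # b # a) t) - 1"
  proof -
    have "real c + s > 0" using s 3 by auto
    moreover have "rcf (c # b # a) t = 1 / (real c + s)" by (simp add: s_def)
    ultimately show ?thesis by (simp only:) (simp add: divide_simps)
  qed
  finally show ?case .
qed simp

section \<open>Periodic expansions and the interval end points \<open>zeta\<close> and
  \<open>eta\<close>\<close>

lemma fwd_neg_mono:
  "w \<in> lists alph_neg \<Longrightarrow> -1 \<le> x \<Longrightarrow> x \<le> y \<Longrightarrow> -1 \<le> fwd w x \<and> fwd w x \<le> fwd w y"
proof (induction rule: lists.induct)
  case (Cons a w)
  obtain d where d: "a = (-1, Fin d)" "d \<ge> 2" using Cons by (auto simp: alph_neg_def)
  have p: "of_int d + fwd w x \<ge> 1" "of_int d + fwd w x \<le> of_int d + fwd w y" using Cons d by auto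
  then have "1 / (of_int d + fwd w y) \<le> 1 / (of_int d + fwd w x)" "1 / (of_int d + fwd w x) \<le> 1"
    by (auto intro!: frac_le)
  then show ?case using d by simp
qed simp

lemma fwd_neg_gt:
  assumes "w \<in> lists alph_neg" "-1 \<le> x" "x > -1 \<or> (\<exists>d\<ge>3. (-1, Fin d) \<in> set w)"
  shows "fwd w x > -1"
  using assms(1,3)
proof (induction rule: lists.induct)
  case (Cons a w)
  obtain d where d: "a = (-1, Fin d)" "d \<ge> 2" using Cons by (auto simp: alph_neg_def)
  have ge: "fwd w x \<ge> -1" using fwd_neg_mono[of w x x] Cons assms by auto
  have "of_int d + fwd w x > 1"
  proof (cases "d \<ge> 3")
    case True
    then show ?thesis using ge by linarith
  next
    case False
    then have "fwd w x > -1" using Cons d by auto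
    then show ?thesis using d by linarith
  qed
  then have "1 / (of_int d + fwd w x) < 1" by simp
  then show ?case using d by simp
qed (use assms in auto)

lemma fwd_neg_contract:
  "w \<in> lists alph_neg \<Longrightarrow> w \<noteq> [] \<Longrightarrow> -1 < x \<Longrightarrow> x < y \<Longrightarrow> fwd w x < fwd w y \<and> fwd w y - fwd w x < y - x"
proof (induction rule: lists.induct)
  case (Cons a w)
  obtain d where d: "a = (-1, Fin d)" "d \<ge> 2" using Cons by (auto simp: alph_neg_def)
  have lt: "fwd w x < fwd w y" "fwd w y - fwd w x \<le> y - x" using Cons by (cases "w = []"; auto)+
  define p q where "p = of_int d + fwd w x" and "q = of_int d + fwd w y"
  have "fwd w x > -1" using fwd_neg_gt[of w x] Cons by auto
  then have p: "p > 1" "p < q" using d lt by (auto simp: p_def q_def)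
  then have pq: "p * q > 1" by (simp add: less_1_mult)
  have eq: "fwd (a # w) y - fwd (a # w) x = (q - p) / (p * q)"
    using p d by (simp add: p_def[symmetric] q_def[symmetric] divide_simps)
  have "0 < (q - p) / (p * q)" using p pq by simp
  moreover have "(q - p) / (p * q) < q - p" using p pq by (simp add: divide_less_eq)
  ultimately show ?case using eq lt p_def q_def by linarith
qed simp

lemma fwd_neg_continuous: "w \<in> lists alph_neg \<Longrightarrow> continuous_on {-1..} (fwd w)"
proof (induction rule: lists.induct)
  case (Cons a w)
  obtain d where d: "a = (-1, Fin d)" "d \<ge> 2" using Cons by (auto simp: alph_neg_def)
  have "of_int d + fwd w x \<noteq> 0" if "x \<in> {-1..}" for x
    using fwd_neg_mono[of w x x] Cons d that by force
  moreover have "fwd (a # w) = (\<lambda>x. of_int (-1) / (of_int d + fwd w x))" using d by auto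
  ultimately show ?case using Cons by (auto intro!: continuous_intros)
qed (simp add: continuous_on_id)

text \<open>Truncations decrease and are at least -1, so they converge, and by continuity the limit
  is a fixed point. A digit of at least 3 excludes the value -1, the fixed point of the letter
  \<open>(-1, 2)\<close>.\<close>

lemma cf_value_periodic:
  assumes w: "w \<in> lists alph_neg" "d \<ge> 3" "(-1, Fin d) \<in> set w"
  shows "cf_value (periodic w) > -1" "fwd w (cf_value (periodic w)) = cf_value (periodic w)"
proof -
  define s where "s = periodic w"
  define X where "X n = cf_fin (map s [0..<n])" for n
  have ne: "w \<noteq> []" using w by auto
  have s: "s n \<in> alph_neg" for n using w(1) ne by (auto simp: s_def periodic_def)
  then have sw: "map s [0..<n] \<in> lists alph_neg" for n by auto
  have X: "X n = fwd (map s [0..<n]) 0" for n by (simp add: X_def cf_fin_eq_fwd)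
  have ge: "X n \<ge> -1" for n unfolding X using fwd_neg_mono[OF sw, of 0 0 n] by simp
  have "decseq X"
  proof (rule decseq_SucI)
    fix n
    obtain d where d: "s n = (-1, Fin d)" "d \<ge> 2" using s[of n] by (auto simp: alph_neg_def)
    have "X (Suc n) = fwd (map s [0..<n]) (- 1 / of_int d)" by (simp add: X fwd_append d)
    also have "\<dots> \<le> fwd (map s [0..<n]) 0" using d by (intro conjunct2[OF fwd_neg_mono[OF sw]]) auto
    finally show "X (Suc n) \<le> X n" by (simp add: X)
  qed
  then have "convergent X" using ge by (metis decseq_convergent convergentI)
  then have lim: "X \<longlonglongrightarrow> cf_value s" unfolding cf_value_def X_def[abs_def] by (simp add: convergent_LIMSEQ_iff)
  define L where "L = cf_value s"
  have L: "L \<ge> -1" using lim ge unfolding L_def by (intro LIMSEQ_le_const) auto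
  have shift: "X (length w + n) = fwd w (X n)" for n
  proof -
    have "map s [0..<length w + n] = w @ map s [0..<n]"
      by (rule nth_equalityI) (auto simp: s_def periodic_def nth_append le_mod_geq)
    then show ?thesis by (simp add: X fwd_append)
  qed
  have "(\<lambda>n. fwd w (X n)) \<longlonglongrightarrow> fwd w L"
    using continuous_on_tendsto_compose[OF fwd_neg_continuous[OF w(1)] lim] L ge by (simp add: L_def)
  moreover have "(\<lambda>n. X (n + length w)) \<longlonglongrightarrow> L" using LIMSEQ_ignore_initial_segment[OF lim] by (simp add: L_def)
  ultimately have eq: "fwd w L = L" using LIMSEQ_unique shift by (simp add: add.commute) blast
  show "fwd w (cf_value (periodic w)) = cf_value (periodic w)" using eq by (simp add: L_def s_def)
  have "fwd w L > -1" using w L by (intro fwd_neg_gt) auto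
  then show "cf_value (periodic w) > -1" using eq by (simp add: L_def s_def)
qed

lemma fwd_word_succ: "v \<in> lists alph_neg \<Longrightarrow> v \<noteq> [] \<Longrightarrow> fwd (word_succ v) x = fwd v (x + 1)"
proof -
  assume v: "v \<in> lists alph_neg" "v \<noteq> []"
  then obtain u a where u: "v = u @ [a]" by (metis append_butlast_last_id)
  then obtain d where "a = (-1, Fin d)" using v by (auto simp: alph_neg_def)
  then show ?thesis by (simp add: word_succ_def u fwd_append algebra_simps)
qed

lemma hat_word_neg: "pos_list a \<Longrightarrow> hat_word a \<in> lists alph_neg"
  by (induction a rule: hat_word.induct) (auto simp: alph_neg_def)

lemma hat_word_big: "a \<noteq> [] \<Longrightarrow> pos_list a \<Longrightarrow> \<exists>d\<ge>3. (-1, Fin d) \<in> set (hat_word a)"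
  by (cases a rule: hat_word.cases) (auto intro: exI[of _ "2 + int _"])

lemma char_seq_char_word:
  assumes "odd (length a)" "pos_list a"
  shows "char_seq (char_word a) = a"
proof -
  have "is_char_seq (char_word a) a" using assms by (simp add: is_char_seq_def)
  with ex1_char_seq[OF char_word_neg[OF assms(2)]] show ?thesis
    unfolding char_seq_def by (metis the1_equality)
qed

text \<open>The word followed by its dual applies \<open>rcf a\<close> twice. If z and q =
  \<open>rcf a z\<close> differed, \<open>rcf a\<close> would exchange them, against contraction. So
  \<open>zeta v\<close> is the parameter at which the last point of the upper branch would be
  \<alpha> itself.\<close>

lemma zeta_props:
  assumes "odd (length a)" "pos_list a"
  shows "zeta (char_word a) > 0" "rcf a (zeta (char_word a)) = zeta (char_word a)"
proof -
  define v where "v = char_word a"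
  define z where "z = zeta v"
  have a: "a \<noteq> []" using assms by auto
  have hat: "hat v = hat_word a" using char_seq_char_word[OF assms] by (simp add: hat_def v_def)
  have w: "v @ hat_word a \<in> lists alph_neg" using char_word_neg[OF assms(2)] hat_word_neg[OF assms(2)] by (simp add: v_def)
  obtain d where d: "d \<ge> 3" "(-1, Fin d) \<in> set (v @ hat_word a)" using hat_word_big[OF a assms(2)] by auto
  note L = cf_value_periodic[OF w d]
  have zL: "cf_value (periodic (v @ hat_word a)) = z - 1" by (simp add: z_def zeta_def hat)
  have z: "z > 0" using L(1) zL by simp
  then show "zeta (char_word a) > 0" by (simp add: z_def v_def)
  define q where "q = rcf a z"
  have q: "q > 0" using rcf_pos[of a z] assms a z by (simp add: q_def)
  have "z - 1 = fwd v (fwd (hat_word a) (z - 1))" using L(2) unfolding zL by (simp add: fwd_append)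
  also have "\<dots> = rcf a q - 1"
    using fwd_hat_word[OF assms z] fwd_char_word[OF assms, of q] q by (simp add: v_def q_def)
  finally have "z = rcf a q" by simp
  then have "q = z" using rcf_contract[of a q z] assms a q z q_def by force
  then show "rcf a (zeta (char_word a)) = zeta (char_word a)" by (simp add: q_def z_def v_def)
qed

text \<open>Raising the last digit by one adds 1 to the tail, so the fixed point equation says that
  at the parameter \<open>eta v\<close> the last point of the lower branch would be \<alpha> itself.
  The third form is the translation by \<open>fwd_char_word\<close>.\<close>

lemma eta_props:
  assumes "odd (length a)" "pos_list a" "char_word a \<noteq> []"
  shows "eta (char_word a) > 0" "fwd (char_word a) (eta (char_word a)) = eta (char_word a) - 1"
    "rcf a (1 / (1 + eta (char_word a)) - 1) = eta (char_word a)"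
proof -
  define v where "v = char_word a"
  define e where "e = eta v"
  have v: "v \<in> lists alph_neg" "v \<noteq> []" using char_word_neg[OF assms(2)] assms(3) by (auto simp: v_def)
  obtain u x where u: "v = u @ [x]" using v by (metis append_butlast_last_id)
  then obtain d where d: "x = (-1, Fin d)" "d \<ge> 2" using v by (auto simp: alph_neg_def)
  have ws: "word_succ v = u @ [(-1, Fin (d + 1))]" by (simp add: word_succ_def u d)
  have w: "word_succ v \<in> lists alph_neg" using v u d ws by (auto simp: alph_neg_def)
  have d1: "d + 1 \<ge> 3" "(-1, Fin (d + 1)) \<in> set (word_succ v)" using d ws by auto
  note L = cf_value_periodic[OF w d1]
  have eL: "cf_value (periodic (word_succ v)) = e - 1" by (simp add: e_def eta_def)
  have e: "e > 0" using L(1) eL by simp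
  then show "eta (char_word a) > 0" by (simp add: e_def v_def)
  have fe: "fwd v e = e - 1" using L(2) unfolding eL fwd_word_succ[OF v] by simp
  then show "fwd (char_word a) (eta (char_word a)) = eta (char_word a) - 1" by (simp add: e_def v_def)
  define t where "t = 1 / (1 + e) - 1"
  have t: "t > -1" "1 / (1 + t) - 1 = e" using e by (auto simp: t_def)
  have "rcf a t - 1 = e - 1" using fwd_char_word[OF assms(1,2) t(1)] t(2) fe by (simp add: v_def)
  then show "rcf a (1 / (1 + eta (char_word a)) - 1) = eta (char_word a)" by (simp add: t_def e_def v_def)
qed

lemma char_word_Nil_iff: "odd (length a) \<Longrightarrow> pos_list a \<Longrightarrow> char_word a = [] \<longleftrightarrow> a = [1]"
  by (cases a rule: char_word.cases) auto

text \<open>\<open>factor\<close> counts from 1, so the positions 2j and 2j + 1 are the tails after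
  2j - 1 and 2j places. Their lengths are even and odd, and this parity is how
  \<open>alt_ok True\<close> chooses between the strict and the weak order.\<close>

lemma FF_iff_admissible:
  assumes "odd (length a)" "pos_list a"
  shows "char_word a \<in> FF \<longleftrightarrow> admissible a"
proof -
  obtain l where l: "length a = 2 * l + 1" using assms(1) by (auto elim: oddE)
  have cs: "char_seq (char_word a) = a" by (rule char_seq_char_word[OF assms])
  have f: "factor (2 * j) (2 * l + 1) a = drop (2 * j - 1) a" "factor 1 (2 * l + 2 - 2 * j) a = take (length a - (2 * j - 1)) a"
     "factor (2 * j + 1) (2 * l + 1) a = drop (2 * j) a" "factor 1 (2 * l + 1 - 2 * j) a = take (length a - 2 * j) a"
    if "j \<in> {1..l}" for j
    using that l by (auto simp: factor_def)
  have "char_word a \<in> FF \<longleftrightarrow> (\<forall>j\<in>{1..l}. alt_less (drop (2 * j - 1) a) (take (length a - (2 * j - 1)) a)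
      \<and> alt_le (drop (2 * j) a) (take (length a - 2 * j) a))"
    unfolding FF_def mem_Collect_eq cs using char_word_neg[OF assms(2)] l f by auto
  also have "\<dots> \<longleftrightarrow> (\<forall>j\<in>{1..l}. alt_ok True (drop (2 * j - 1) a) (take (length a - (2 * j - 1)) a)
      \<and> alt_ok True (drop (2 * j) a) (take (length a - 2 * j) a))"
  proof (intro ball_cong refl conj_cong)
    fix j assume "j \<in> {1..l}"
    then have j: "1 \<le> j" "j \<le> l" by auto
    have "length (drop (2 * j - 1) a) = 2 * (l - j + 1)" using j l by simp
    then have "even (length (drop (2 * j - 1) a))" by simp
    then show "alt_less (drop (2 * j - 1) a) (take (length a - (2 * j - 1)) a) = alt_ok True (drop (2 * j - 1) a) (take (length a - (2 * j - 1)) a)"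
      by (intro alt_ok_even[symmetric]) auto
    have "length (drop (2 * j) a) = 2 * (l - j) + 1" using j l by simp
    then have "odd (length (drop (2 * j) a))" by simp
    then show "alt_le (drop (2 * j) a) (take (length a - 2 * j) a) = alt_ok True (drop (2 * j) a) (take (length a - 2 * j) a)"
      by (intro alt_ok_odd[symmetric]) auto
  qed
  also have "\<dots> \<longleftrightarrow> (\<forall>i. 0 < i \<and> i < length a \<longrightarrow> alt_ok True (drop i a) (take (length a - i) a))"
  proof (intro iffI allI impI ballI)
    fix i assume *: "\<forall>j\<in>{1..l}. alt_ok True (drop (2 * j - 1) a) (take (length a - (2 * j - 1)) a)
      \<and> alt_ok True (drop (2 * j) a) (take (length a - 2 * j) a)" and i: "0 < i \<and> i < length a"
    show "alt_ok True (drop i a) (take (length a - i) a)"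
    proof (cases "even i")
      case True
      then obtain j where "i = 2 * j" by auto
      with * i l show ?thesis by (auto dest!: bspec[of _ _ j])
    next
      case False
      then obtain j where "i = 2 * j + 1" by (auto elim: oddE)
      with * i l show ?thesis by (auto dest!: bspec[of _ _ "j + 1"])
    qed
  next
    fix j assume *: "\<forall>i. 0 < i \<and> i < length a \<longrightarrow> alt_ok True (drop i a) (take (length a - i) a)" and j: "j \<in> {1..l}"
    have "0 < 2 * j - 1" "2 * j - 1 < length a" "0 < 2 * j" "2 * j < length a" using j l by auto
    then show "alt_ok True (drop (2 * j - 1) a) (take (length a - (2 * j - 1)) a) \<and> alt_ok True (drop (2 * j) a) (take (length a - 2 * j) a)"
      using * by blast
  qed
  finally show ?thesis using assms by (auto simp: admissible_def)
qed

section \<open>Digits of the Gauss map and the alternating order\<close>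

fun gauss_digits :: "real \<Rightarrow> nat \<Rightarrow> nat list" where
  "gauss_digits u 0 = []"
| "gauss_digits u (Suc n) = nat \<lfloor>1 / u\<rfloor> # gauss_digits (gauss u) n"

lemma length_gauss_digits [simp]: "length (gauss_digits u n) = n"
  by (induction n arbitrary: u) auto

lemma gauss_digits_drop: "i \<le> n \<Longrightarrow> drop i (gauss_digits u n) = gauss_digits ((gauss ^^ i) u) (n - i)"
proof (induction i arbitrary: u n)
  case (Suc i)
  then obtain m where "n = Suc m" by (cases n) auto
  with Suc show ?case by (simp add: funpow_Suc_right del: funpow.simps(2))
qed simp

lemma gauss_digits_take: "i \<le> n \<Longrightarrow> take i (gauss_digits u n) = gauss_digits u i"
proof (induction i arbitrary: u n)
  case (Suc i)
  then obtain m where "n = Suc m" by (cases n) auto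
  with Suc show ?case by simp
qed simp

lemma gauss_digits_rep:
  assumes "\<And>i. i < n \<Longrightarrow> (gauss ^^ i) u > 0" "u \<le> 1"
  shows "pos_list (gauss_digits u n)" "rcf (gauss_digits u n) ((gauss ^^ n) u) = u"
proof -
  have "pos_list (gauss_digits u n) \<and> rcf (gauss_digits u n) ((gauss ^^ n) u) = u"
    using assms
  proof (induction n arbitrary: u)
    case (Suc n)
    have u: "u > 0" using Suc.prems(1)[of 0] by simp
    have c: "\<lfloor>1 / u\<rfloor> \<ge> 1" using gauss_digit_ge_1 u Suc.prems by auto
    then obtain c :: nat where c': "\<lfloor>1 / u\<rfloor> = int c" "int c \<ge> 1" by (metis nonneg_int_cases order_trans zero_le_one)
    have pos: "(gauss ^^ i) (gauss u) > 0" if "i < n" for i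
      using Suc.prems(1)[of "Suc i"] that by (simp add: funpow_Suc_right del: funpow.simps(2))
    from Suc.IH[OF pos] gauss_range(2)[of u] have "pos_list (gauss_digits (gauss u) n)"
      "rcf (gauss_digits (gauss u) n) ((gauss ^^ n) (gauss u)) = gauss u" by auto
    then show ?case using gauss_rep(2)[of u] c' by (auto simp: funpow_Suc_right simp del: funpow.simps(2))
  qed simp
  then show "pos_list (gauss_digits u n)" "rcf (gauss_digits u n) ((gauss ^^ n) u) = u" by auto
qed

text \<open>Digits compare in the opposite sense to the points, and the sense flips at each step. If
  all n digits agree, the order of the points does not settle the parity convention of
  \<open>alt_ok\<close>; hence the second alternative.\<close>

lemma gauss_digits_alt_ok:
  assumes "\<And>i. i < n \<Longrightarrow> (gauss ^^ i) u > 0" "\<And>i. i < n \<Longrightarrow> (gauss ^^ i) w > 0"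
    "if b then w \<le> u else u \<le> w"
  shows "alt_ok b (gauss_digits u n) (gauss_digits w n) \<or> (gauss_digits u n = gauss_digits w n \<and> even n = b)"
  using assms
proof (induction n arbitrary: u w b)
  case (Suc n)
  have uw: "u > 0" "w > 0" using Suc.prems(1)[of 0] Suc.prems(2)[of 0] by auto
  have pos: "(gauss ^^ i) (gauss u) > 0" "(gauss ^^ i) (gauss w) > 0" if "i < n" for i
    using Suc.prems(1,2)[of "Suc i"] that by (simp_all add: funpow_Suc_right del: funpow.simps(2))
  have fl: "if b then \<lfloor>1 / u\<rfloor> \<le> \<lfloor>1 / w\<rfloor> else \<lfloor>1 / w\<rfloor> \<le> \<lfloor>1 / u\<rfloor>"
    using Suc.prems(3) uw by (cases b) (auto intro!: floor_mono frac_le)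
  show ?case
  proof (cases "nat \<lfloor>1 / u\<rfloor> = nat \<lfloor>1 / w\<rfloor>")
    case False
    define p q where "p = \<lfloor>1 / u\<rfloor>" and "q = \<lfloor>1 / w\<rfloor>"
    have "0 \<le> p" "0 \<le> q" using uw by (auto simp: p_def q_def)
    then have "if b then nat p < nat q else nat q < nat p"
      using False fl unfolding p_def[symmetric] q_def[symmetric] by (cases b) auto
    then show ?thesis unfolding p_def q_def by (cases b) simp_all
  next
    case True
    have "\<lfloor>1 / u\<rfloor> \<ge> 0" "\<lfloor>1 / w\<rfloor> \<ge> 0" using uw by auto
    with True have eq: "\<lfloor>1 / u\<rfloor> = \<lfloor>1 / w\<rfloor>" by linarith
    have "if b then 1 / u \<le> 1 / w else 1 / w \<le> 1 / u"
      using Suc.prems(3) uw by (cases b) (auto intro!: frac_le)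
    then have "if \<not> b then gauss w \<le> gauss u else gauss u \<le> gauss w"
      using gauss_rep(1)[of u] gauss_rep(1)[of w] eq by (cases b) auto
    from Suc.IH[OF pos this] show ?thesis using True by auto
  qed
qed auto

lemma conv_conv:
  assumes "a \<noteq> []" "pos_list a" "a \<noteq> [1]"
  shows "conv (conv a) = a" "conv a \<noteq> [1]"
  by (use assms(2) in \<open>cases rule: conv_split[OF assms]; auto simp: conv_def butlast_append\<close>)+

text \<open>Every tail keeps its value except the new tail [1], which has the value 1 + t and so is
  at least 1.\<close>

lemma conv_tails:
  assumes "a \<noteq> []" "pos_list a" "a \<noteq> [1]" "t \<ge> 0" "x \<le> 1"
    "\<And>i. i < length a \<Longrightarrow> x \<le> rcf (drop i a) t" "i < length (conv a)"
  shows "x \<le> rcf (drop i (conv a)) (1 / (1 + t) - 1)"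
  using conv_split[OF assms(1-3)]
proof cases
  case (1 b c)
  have *: "rcf [c - 1, 1] (1 / (1 + t) - 1) = rcf [c] t" using 1(1) assms(4) by (simp add: of_nat_diff)
  show ?thesis
  proof (cases "i \<le> length b")
    case True
    then have "rcf (drop i (conv a)) (1 / (1 + t) - 1) = rcf (drop i a) t"
      using 1 * by (simp add: rcf_append)
    then show ?thesis using assms(6)[of i] 1 True by simp
  next
    case False
    then have "i = length b + 1" using assms(7) 1 by simp
    then have "rcf (drop i (conv a)) (1 / (1 + t) - 1) = 1 + t" using 1 assms(4) by simp
    then show ?thesis using assms by simp
  qed
next
  case (2 b c)
  have *: "rcf [c + 1] (1 / (1 + t) - 1) = rcf [c, 1] t" using assms(4) by (simp add: add.assoc)
  have "i \<le> length b" using assms(7) 2 by simp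
  then have "rcf (drop i (conv a)) (1 / (1 + t) - 1) = rcf (drop i a) t"
    using 2 * by (simp add: rcf_append)
  then show ?thesis using assms(6)[of i] 2 \<open>i \<le> length b\<close> by simp
qed

section \<open>Orbits of the end points on a matching interval\<close>

context alpha_expansion
begin

text \<open>The involution t -> 1/(1 + t) - 1 exchanges \<alpha> and -\<open>kap\<close>. It also
  relates the last points of the two branches, so one of them is below \<alpha> exactly when the
  other is right of -\<open>kap\<close>.\<close>

lemma kap_eq: "- kap = 1 / (1 + \<alpha>) - 1"
  using alpha_pos by (simp add: kap_def field_simps)

lemma le_kap_iff: "-1 < u \<Longrightarrow> 1 / (1 + u) - 1 \<le> - kap \<longleftrightarrow> \<alpha> \<le> u"
  using alpha_pos by (simp add: kap_eq field_simps)

lemma gt_kap_iff: "-1 < t \<Longrightarrow> - kap < t \<longleftrightarrow> 1 / (1 + t) - 1 < \<alpha>"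
  using alpha_pos by (simp add: kap_eq field_simps) linarith

definition descends :: "real \<Rightarrow> letter list \<Rightarrow> real \<Rightarrow> bool" where
  "descends x w x' \<longleftrightarrow> itin \<alpha> x (length w) = w \<and> (T \<alpha> ^^ length w) x = x' \<and> (\<forall>j<length w. (T \<alpha> ^^ j) x \<le> - kap)"

lemma descends_Nil: "descends x [] x"
  by (simp add: descends_def)

lemma descends_Cons:
  assumes "x \<le> - kap" "x = - 1 / (of_int d + x1)" "of_int d + x1 > 0" "\<alpha> - 1 \<le> x1" "x1 < \<alpha>" "descends x1 w x'"
  shows "descends x ((-1, Fin d) # w) x'"
proof -
  have T: "letter_at \<alpha> x = (-1, Fin d)" "T \<alpha> x = x1"
    using T_inverse_branch[of "-1" d x1 \<alpha> x] assms by auto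
  have "(T \<alpha> ^^ j) x \<le> - kap" if "j < Suc (length w)" for j
    using that T assms(1,6) by (cases j) (auto simp: descends_def funpow_Suc_right simp del: funpow.simps(2))
  then show ?thesis using T assms(6)
    by (simp add: descends_def itin_Suc' funpow_Suc_right del: funpow.simps(2))
qed

lemma descends_append:
  assumes "descends x u x1" "descends x1 w x'"
  shows "descends x (u @ w) x'"
proof -
  have pw: "(T \<alpha> ^^ (length u + j)) x = (T \<alpha> ^^ j) x1" for j
  proof -
    have "(T \<alpha> ^^ (j + length u)) x = (T \<alpha> ^^ j) x1" using assms(1) unfolding funpow_add by (simp add: descends_def)
    then show ?thesis by (simp add: add.commute)
  qed
  have "(T \<alpha> ^^ j) x \<le> - kap" if "j < length u + length w" for j
  proof (cases "j < length u")
    case True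
    then show ?thesis using assms(1) by (simp add: descends_def)
  next
    case False
    then obtain i where "j = length u + i" by (metis le_Suc_ex linorder_not_le)
    then show ?thesis using assms(2) pw that by (simp add: descends_def)
  qed
  then show ?thesis using assms pw itin_add[of \<alpha> x "length u" "length w"]
    by (simp add: descends_def)
qed

lemma descends_twos:
  assumes "n \<ge> 1" "-1 < s" "\<alpha> - 1 \<le> s" "n \<ge> 2 \<Longrightarrow> \<alpha> \<le> 1 / (real n + s)" "1 / (1 + s) - 1 < \<alpha>"
  shows "descends (1 / (real n + s) - 1) (replicate (n - 1) (-1, Fin 2)) (1 / (1 + s) - 1)"
  using assms(1,4)
proof (induction n rule: dec_induct)
  case base
  then show ?case by (simp add: descends_Nil)
next
  case (step n)
  have n: "real n \<ge> 1" using step by simp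
  have p: "real n + s > 0" using n assms by linarith
  have a: "\<alpha> \<le> 1 / (real (Suc n) + s)" using step by simp
  also have "\<dots> \<le> 1 / (real n + s)" using p by (intro frac_le) auto
  finally have a': "\<alpha> \<le> 1 / (real n + s)" .
  have "1 / (real n + s) \<le> 1 / (1 + s)" using n assms by (intro frac_le) auto
  then have lt: "1 / (real n + s) - 1 < \<alpha>" using assms by linarith
  have "descends (1 / (real (Suc n) + s) - 1) ((-1, Fin 2) # replicate (n - 1) (-1, Fin 2)) (1 / (1 + s) - 1)"
  proof (rule descends_Cons)
    have "\<alpha> \<le> real n + s" using n assms alpha_le_1 by linarith
    then have "1 / (1 + (real n + s)) - 1 \<le> - kap" using le_kap_iff[of "real n + s"] p by simp
    then show "1 / (real (Suc n) + s) - 1 \<le> - kap" by (simp add: add.assoc)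
    show "1 / (real (Suc n) + s) - 1 = - 1 / (of_int 2 + (1 / (real n + s) - 1))"
      using p by (simp add: divide_simps)
    have "0 < 1 / (real n + s)" using p by simp
    then show "0 < of_int 2 + (1 / (real n + s) - 1)" by linarith
    show "descends (1 / (real n + s) - 1) (replicate (n - 1) (-1, Fin 2)) (1 / (1 + s) - 1)"
      using step.IH a' by blast
  qed (use a' lt in auto)
  moreover have "replicate (Suc n - 1) (-1, Fin 2) = (-1, Fin 2) # replicate (n - 1) (-1 :: int, Fin 2)"
    using step by (cases n) auto
  ultimately show ?case by simp
qed

text \<open>\<open>a\<close> lists the regular continued fraction digits of \<open>\<alpha>\<close> up to the matching, and \<open>t\<close> is the
  last point of the orbit of \<open>\<alpha>\<close> that counts, of index \<open>k' - 1\<close>.\<close>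

definition matches :: "nat list \<Rightarrow> real \<Rightarrow> bool" where
  "matches a t \<longleftrightarrow> odd (length a) \<and> admissible a \<and> \<alpha> = rcf a t \<and> - kap < t \<and> t < \<alpha> \<and> \<alpha> - 1 \<le> t \<and>
    (\<forall>i<length a. \<alpha> \<le> rcf (drop i a) t)"

text \<open>Letters \<open>(-1, 2)\<close> count an odd-place quotient down to 1, and
  \<open>(-1, 2 + b)\<close> removes the remaining unit together with b. The bounds on the tails
  keep the images in the window and the points at or left of -\<open>kap\<close>.\<close>

lemma descends_char_word:
  assumes "odd (length a)" "pos_list a" "- kap < t" "\<alpha> - 1 \<le> t" "\<And>i. i < length a \<Longrightarrow> \<alpha> \<le> rcf (drop i a) t"
  shows "descends (rcf a t - 1) (char_word a) (1 / (1 + t) - 1)"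
  using assms(1,2,5)
proof (induction a rule: char_word.induct)
  case (2 c)
  have t: "t > -1" "1 / (1 + t) - 1 < \<alpha>" using assms(3) kap_bounds gt_kap_iff[of t] by auto
  have "descends (1 / (real c + t) - 1) (replicate (c - 1) (-1, Fin 2)) (1 / (1 + t) - 1)"
    using 2(2) 2(3)[of 0] t assms by (intro descends_twos) auto
  then show ?case by simp
next
  case (3 c b a)
  have t: "t > -1" using assms(3) kap_bounds by auto
  have ne: "a \<noteq> []" using 3 by auto
  define s2 where "s2 = rcf a t"
  define s where "s = 1 / (real b + s2)"
  have s2: "s2 \<ge> \<alpha>" using 3(4)[of 2] ne by (simp add: s2_def)
  have s: "s \<ge> \<alpha>" using 3(4)[of 1] by (simp add: s_def s2_def)
  have u: "\<alpha> \<le> 1 / (real c + s)" using 3(4)[of 0] by (simp add: s_def s2_def)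
  have b: "real b \<ge> 1" using 3 by simp
  have s0: "s > 0" using s alpha_pos by linarith
  have "1 / (1 + s) < 1" using s0 by simp
  then have "1 / (1 + s) - 1 < \<alpha>" using alpha_pos by linarith
  then have 1: "descends (1 / (real c + s) - 1) (replicate (c - 1) (-1, Fin 2)) (1 / (1 + s) - 1)"
    using 3 u s0 alpha_pos alpha_le_1 by (intro descends_twos) auto
  have IH: "descends (s2 - 1) (char_word a) (1 / (1 + t) - 1)"
    unfolding s2_def
  proof (rule 3(1))
    show "\<alpha> \<le> rcf (drop i a) t" if "i < length a" for i using 3(4)[of "Suc (Suc i)"] that by simp
  qed (use 3 in auto)
  have 2: "descends (1 / (1 + s) - 1) ((-1, Fin (2 + int b)) # char_word a) (1 / (1 + t) - 1)"
  proof (rule descends_Cons[OF _ _ _ _ _ IH])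
    show "1 / (1 + s) - 1 \<le> - kap" using le_kap_iff[of s] s s0 by simp
    have p: "real b + s2 > 0" using b s2 alpha_pos by linarith
    show "1 / (1 + s) - 1 = - 1 / (of_int (2 + int b) + (s2 - 1))"
      using p by (simp add: s_def divide_simps)
    show "0 < of_int (2 + int b) + (s2 - 1)" using p by simp
    show "\<alpha> - 1 \<le> s2 - 1" using s2 by simp
    show "s2 - 1 < \<alpha>"
    proof -
      obtain c' a' where a: "a = c' # a'" using ne by (cases a) auto
      have c': "real c' \<ge> 1" using 3 a by simp
      show ?thesis
      proof (cases "a' = []")
        case True
        have "1 / (real c' + t) \<le> 1 / (1 + t)" using c' t by (intro frac_le) auto
        then show ?thesis using gt_kap_iff[of t] t assms(3) a True by (simp add: s2_def)
      next
        case False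
        have "rcf a' t > 0" using rcf_pos[of a' t] False 3 a t by auto
        then have "1 / (real c' + rcf a' t) < 1" using c' by simp
        then show ?thesis using a alpha_pos by (simp add: s2_def)
      qed
    qed
  qed
  from descends_append[OF 1 2] show ?case by (simp add: s_def s2_def)
qed simp

lemma descends_up_word:
  assumes "odd (length a)" "pos_list a" "- kap < t" "\<alpha> - 1 \<le> t" "t < \<alpha>" "\<And>i. i < length a \<Longrightarrow> \<alpha> \<le> rcf (drop i a) t"
  shows "descends (1 / (1 + rcf a t) - 1) (up_word a) t"
  using assms(1,2,6)
proof (induction a rule: up_word.induct)
  case (2 c)
  have t: "t > -1" using assms(3) kap_bounds by auto
  have u: "\<alpha> \<le> 1 / (real c + t)" using 2(3)[of 0] by simp
  have p: "real c + t > 0" using 2 t by auto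
  have "descends (1 / (1 + 1 / (real c + t)) - 1) [(-1, Fin (1 + int c))] t"
  proof (rule descends_Cons[OF _ _ _ _ _ descends_Nil])
    show "1 / (1 + 1 / (real c + t)) - 1 \<le> - kap" using le_kap_iff[of "1 / (real c + t)"] u alpha_pos by simp
    show "1 / (1 + 1 / (real c + t)) - 1 = - 1 / (of_int (1 + int c) + t)" using p by (simp add: divide_simps)
  qed (use p assms in auto)
  then show ?case by simp
next
  case (3 c b a)
  have t: "t > -1" using assms(3) kap_bounds by auto
  have ne: "a \<noteq> []" using 3 by auto
  define s2 where "s2 = rcf a t"
  define s where "s = 1 / (real b + s2)"
  have s2: "s2 \<ge> \<alpha>" using 3(4)[of 2] ne by (simp add: s2_def)
  have s: "s \<ge> \<alpha>" using 3(4)[of 1] by (simp add: s_def s2_def)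
  have u: "\<alpha> \<le> 1 / (real c + s)" using 3(4)[of 0] by (simp add: s_def s2_def)
  have bc: "real b \<ge> 1" "real c \<ge> 1" using 3 by simp_all
  have s20: "s2 > 0" "s > 0" using s2 s alpha_pos by linarith+
  have s1: "s \<le> 1" using bc s20 by (simp add: s_def)
  have "1 / (1 + s2) < 1" using s20 by simp
  then have "1 / (1 + s2) - 1 < \<alpha>" using alpha_pos by linarith
  then have 1: "descends (1 / (real b + s2) - 1) (replicate (b - 1) (-1, Fin 2)) (1 / (1 + s2) - 1)"
    using 3 s s20 alpha_pos alpha_le_1 unfolding s_def by (intro descends_twos) auto
  have IH: "descends (1 / (1 + s2) - 1) (up_word a) t"
    unfolding s2_def
  proof (rule 3(1))
    show "\<alpha> \<le> rcf (drop i a) t" if "i < length a" for i using 3(4)[of "Suc (Suc i)"] that by simp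
  qed (use 3 in auto)
  have "descends (1 / (1 + 1 / (real c + s)) - 1) ((-1, Fin (2 + int c)) # (replicate (b - 1) (-1, Fin 2) @ up_word a)) t"
  proof (rule descends_Cons)
    show "1 / (1 + 1 / (real c + s)) - 1 \<le> - kap" using le_kap_iff[of "1 / (real c + s)"] u alpha_pos by simp
    show "1 / (1 + 1 / (real c + s)) - 1 = - 1 / (of_int (2 + int c) + (s - 1))"
      using bc s20 by (simp add: divide_simps)
    show "descends (s - 1) (replicate (b - 1) (-1, Fin 2) @ up_word a) t"
      using descends_append[OF 1 IH] by (simp add: s_def)
  qed (use s s1 s20 bc alpha_pos in auto)
  then show ?case by (simp add: s_def s2_def)
qed simp

lemma matches_lo:
  assumes "matches a t"
  shows "itin \<alpha> (\<alpha> - 1) (length (char_word a)) = char_word a"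
    "(T \<alpha> ^^ length (char_word a)) (\<alpha> - 1) = 1 / (1 + t) - 1"
    "\<And>j. j < length (char_word a) \<Longrightarrow> (T \<alpha> ^^ j) (\<alpha> - 1) \<le> - kap"
proof -
  have "descends (rcf a t - 1) (char_word a) (1 / (1 + t) - 1)"
    using assms by (intro descends_char_word) (auto simp: matches_def admissible_def)
  then show "itin \<alpha> (\<alpha> - 1) (length (char_word a)) = char_word a"
    "(T \<alpha> ^^ length (char_word a)) (\<alpha> - 1) = 1 / (1 + t) - 1"
    "\<And>j. j < length (char_word a) \<Longrightarrow> (T \<alpha> ^^ j) (\<alpha> - 1) \<le> - kap"
    using assms by (auto simp: descends_def matches_def)
qed

text \<open>-\<open>kap\<close> and \<alpha> have the same image under T. So the orbit of \<alpha>
  is the one computed from -\<open>kap\<close> by \<open>descends_up_word\<close>, with the first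
  letter \<open>(-1, d)\<close> exchanged for its W-partner \<open>(1, d - 1)\<close>.\<close>

lemma matches_up:
  assumes "matches a t" "up_word a = (-1, Fin d) # r"
  shows "itin \<alpha> \<alpha> (length (up_word a)) = (1, Fin (d - 1)) # r"
    "(T \<alpha> ^^ length (up_word a)) \<alpha> = t"
    "\<And>j. 1 \<le> j \<Longrightarrow> j < length (up_word a) \<Longrightarrow> (T \<alpha> ^^ j) \<alpha> \<le> - kap"
proof -
  have "descends (1 / (1 + rcf a t) - 1) (up_word a) t"
    using assms by (intro descends_up_word) (auto simp: matches_def admissible_def)
  moreover have "rcf a t = \<alpha>" using assms by (simp add: matches_def)
  ultimately have des: "descends (- kap) ((-1, Fin d) # r) t" by (simp only: kap_eq assms(2))
  then have l: "letter_at \<alpha> (- kap) = (-1, Fin d)" "itin \<alpha> (T \<alpha> (- kap)) (length r) = r"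
    "(T \<alpha> ^^ length r) (T \<alpha> (- kap)) = t"
    by (auto simp: descends_def itin_Suc' funpow_Suc_right simp del: funpow.simps(2))
  have small: "(T \<alpha> ^^ j) (T \<alpha> (- kap)) \<le> - kap" if "j < length r" for j
    using des that unfolding descends_def by (auto simp: funpow_Suc_right simp del: funpow.simps(2) dest!: spec[of _ "Suc j"])
  have k0: "- kap \<noteq> 0" using kap_bounds by simp
  have Tk: "\<alpha> - 1 \<le> T \<alpha> (- kap)" "T \<alpha> (- kap) < \<alpha>" using T_range[OF k0, of \<alpha>] by auto
  have "of_int d + T \<alpha> (- kap) = 1 / \<bar>- kap\<bar>"
    using letter_at_inverse[OF k0, of \<alpha>] l(1) by (metis Pair_inject digit.inject)
  also have "\<dots> = 1 + 1 / \<alpha>" using kap_bounds by simp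
  finally have eq: "of_int (d - 1) + T \<alpha> (- kap) = 1 / \<alpha>" by simp
  have la: "letter_at \<alpha> \<alpha> = (1, Fin (d - 1))" "T \<alpha> \<alpha> = T \<alpha> (- kap)"
    using T_inverse_branch[of 1 "d - 1" "T \<alpha> (- kap)" \<alpha> \<alpha>] Tk eq alpha_pos by auto
  show "itin \<alpha> \<alpha> (length (up_word a)) = (1, Fin (d - 1)) # r" using la l assms(2) by (simp add: itin_Suc')
  show "(T \<alpha> ^^ length (up_word a)) \<alpha> = t"
    using la l assms(2) by (simp add: funpow_Suc_right del: funpow.simps(2))
  show "(T \<alpha> ^^ j) \<alpha> \<le> - kap" if j: "1 \<le> j" "j < length (up_word a)" for j
  proof -
    obtain i where "j = Suc i" using j by (cases j) auto
    then show ?thesis using small[of i] j assms(2) la by (simp add: funpow_Suc_right del: funpow.simps(2))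
  qed
qed

section \<open>Existence and uniqueness of a match, and its link with \<open>Gam\<close>\<close>

lemma matches_gt_minus_1: "matches a t \<Longrightarrow> t > -1"
  using kap_bounds by (auto simp: matches_def)

text \<open>The length of the word is the first time at which the orbit of \<alpha> - 1 is right of
  -\<open>kap\<close>, and the word is the itinerary up to then.\<close>

lemma matches_unique:
  assumes "matches a t" "matches a' t'"
  shows "char_word a = char_word a'"
proof -
  have *: "length (char_word a) \<le> length (char_word a')" if m: "matches a t" "matches a' t'" for a t a' t'
  proof (rule ccontr)
    assume "\<not> length (char_word a) \<le> length (char_word a')"
    then have "1 / (1 + t') - 1 \<le> - kap" using matches_lo(3)[OF m(1)] matches_lo(2)[OF m(2)] by (metis not_le)
    then show False using le_kap_iff[of t'] m(2) matches_gt_minus_1[OF m(2)] by (auto simp: matches_def)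
  qed
  have "length (char_word a) = length (char_word a')" using *[OF assms] *[OF assms(2,1)] by simp
  then show ?thesis using matches_lo(1)[OF assms(1)] matches_lo(1)[OF assms(2)] by metis
qed

text \<open>A first digit of at least 2 makes 1/\<alpha> larger than 1 + 1/(1 + \<alpha>), that is,
  \<alpha> - 1 < -\<open>kap\<close>; and t is right of -\<open>kap\<close>.\<close>

lemma end_range:
  assumes "pos_list a" "a \<noteq> []" "hd a \<ge> 2" "\<alpha> = rcf a t" "- kap < t"
  shows "\<alpha> - 1 \<le> t"
proof -
  obtain c a' where a: "a = c # a'" using assms(2) by (cases a) auto
  have c: "real c \<ge> 2" using assms(3) a by simp
  have t: "t > -1" using assms(5) kap_bounds by auto
  have inv: "1 / \<alpha> = real c + rcf a' t" using assms(4) a by simp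
  have g: "0 < 1 / (1 + \<alpha>)" "1 / (1 + \<alpha>) < 1" using alpha_pos by auto
  have "1 / \<alpha> > 1 + 1 / (1 + \<alpha>)"
  proof (cases "a' = []")
    case True
    then show ?thesis using inv c assms(5) kap_eq by simp
  next
    case False
    then have "rcf a' t > 0" using rcf_pos[of a' t] assms(1) a t by auto
    then show ?thesis using inv c g by linarith
  qed
  then have "\<alpha> - 1 < - kap" using alpha_pos by (simp add: kap_eq field_simps)
  then show ?thesis using assms(5) by simp
qed

text \<open>Stop the Gauss orbit when it first falls below \<alpha>. All earlier points are at least
  \<alpha>, which gives the bounds on tails and the admissibility of the digits. For an even number
  of digits the other expansion is taken, whose tail 1/(1 + t0) - 1 is at most 0.\<close>

lemma matches_exists:
  assumes "(gauss ^^ m) \<alpha> < \<alpha>"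
  shows "\<exists>a t. matches a t"
proof -
  define n where "n = (LEAST m. (gauss ^^ m) \<alpha> < \<alpha>)"
  have n: "(gauss ^^ n) \<alpha> < \<alpha>" unfolding n_def using assms by (rule LeastI)
  have ge: "\<alpha> \<le> (gauss ^^ i) \<alpha>" if "i < n" for i using not_less_Least[of i] that unfolding n_def by fastforce
  have n0: "n > 0" using n by (cases n) auto
  define t0 where "t0 = (gauss ^^ n) \<alpha>"
  obtain n' where "n = Suc n'" using n0 by (cases n) auto
  then have t0: "0 \<le> t0" "t0 < \<alpha>" using n gauss_range by (auto simp: t0_def)
  have pos: "(gauss ^^ i) \<alpha> > 0" if "i < n" for i using ge[OF that] alpha_pos by linarith
  define a0 where "a0 = gauss_digits \<alpha> n"
  have a0: "pos_list a0" "rcf a0 t0 = \<alpha>" "length a0 = n" "a0 \<noteq> []"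
    using gauss_digits_rep[of n \<alpha>] pos alpha_le_1 n0 length_gauss_digits[of \<alpha> n] unfolding a0_def t0_def by (auto simp del: length_gauss_digits)
  have shift: "(gauss ^^ l) ((gauss ^^ i) \<alpha>) = (gauss ^^ (l + i)) \<alpha>" for l i by (simp add: funpow_add)
  have tail: "rcf (drop i a0) t0 = (gauss ^^ i) \<alpha>" if "i < n" for i
  proof -
    have "(gauss ^^ i) \<alpha> \<le> 1" using alpha_le_1 gauss_range(2) by (cases i) (auto intro: less_imp_le)
    moreover have "(gauss ^^ (n - i)) ((gauss ^^ i) \<alpha>) = t0" using that by (simp add: shift t0_def)
    ultimately show ?thesis
      using gauss_digits_rep(2)[of "n - i" "(gauss ^^ i) \<alpha>"] pos that
      by (simp add: a0_def gauss_digits_drop shift)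
  qed
  have adm: "admissible a0"
    unfolding admissible_def
  proof (intro conjI allI impI)
    fix i assume i: "0 < i \<and> i < length a0"
    define u where "u = (gauss ^^ i) \<alpha>"
    have d: "drop i a0 = gauss_digits u (n - i)" "take (length a0 - i) a0 = gauss_digits \<alpha> (n - i)"
      using i a0(3) by (auto simp: a0_def u_def gauss_digits_drop gauss_digits_take)
    have "alt_ok True (gauss_digits u (n - i)) (gauss_digits \<alpha> (n - i)) \<or>
       gauss_digits u (n - i) = gauss_digits \<alpha> (n - i) \<and> even (n - i) = True"
      using i a0(3) pos ge[of i] by (intro gauss_digits_alt_ok) (auto simp: u_def shift)
    \<comment> \<open>In even length \<open>rcf s\<close> is increasing, so equal digits with the
      tail t0 < \<alpha> would give a value u below \<alpha>.\<close>
    moreover have False if eq: "gauss_digits u (n - i) = gauss_digits \<alpha> (n - i)" and ev: "even (n - i)"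
    proof -
      define s where "s = gauss_digits \<alpha> (n - i)"
      have s: "pos_list s" "rcf s ((gauss ^^ (n - i)) \<alpha>) = \<alpha>"
        using gauss_digits_rep[of "n - i" \<alpha>] pos alpha_le_1 by (auto simp: s_def)
      have us: "u = rcf s t0" using tail[of i] i a0(3) d(1) eq by (simp add: u_def s_def)
      have ugeq: "\<alpha> \<le> u" using ge[of i] i a0(3) by (simp add: u_def)
      have wge: "\<alpha> \<le> (gauss ^^ (n - i)) \<alpha>" using ge[of "n - i"] i a0(3) by simp
      have "rcf s t0 < rcf s ((gauss ^^ (n - i)) \<alpha>)"
        using rcf_less[OF s(1), of t0 "(gauss ^^ (n - i)) \<alpha>"] t0 wge ev by (auto simp: s_def)
      then show False using us s ugeq by simp
    qed
    ultimately show "alt_ok True (drop i a0) (take (length a0 - i) a0)" unfolding d by auto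
  qed (use a0 in auto)
  show ?thesis
  proof (cases "odd n")
    case True
    have "matches a0 t0" unfolding matches_def
      using True a0 adm t0 kap_bounds alpha_le_1 tail ge by auto
    then show ?thesis by blast
  next
    case False
    have ne1: "a0 \<noteq> [1]" using False a0(3) by auto
    define t where "t = 1 / (1 + t0) - 1"
    have t: "t > -1" "t \<le> 0" "- kap < t" using t0 le_kap_iff[of t0] by (auto simp: t_def)
    note lc = length_conv[OF a0(4,1) ne1]
    have admc: "admissible (conv a0)" using adm ne1 by (rule admissible_conv)
    have oc: "odd (length (conv a0))" using lc(1) False a0(3) by simp
    have val: "\<alpha> = rcf (conv a0) t" using rcf_conv[OF a0(4,1) ne1, of t0] t0 a0(2) by (simp add: t_def)
    have hd: "hd (conv a0) \<ge> 2" using admissible_hd_ge_2[OF admc _ oc] conv_conv(2)[OF a0(4,1) ne1] by blast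
    have "matches (conv a0) t" unfolding matches_def
    proof (intro conjI allI impI)
      show "\<alpha> - 1 \<le> t" by (rule end_range[OF lc(2,3) hd val t(3)])
      show "t < \<alpha>" using t alpha_pos by linarith
      show "\<alpha> \<le> rcf (drop i (conv a0)) t" if "i < length (conv a0)" for i
        unfolding t_def using a0 ne1 t0 alpha_le_1 tail ge that by (intro conv_tails) auto
    qed (use oc admc val t in auto)
    then show ?thesis by blast
  qed
qed

text \<open>Both last points, t and 1/(1 + t) - 1, are below \<alpha>. Comparing t with the fixed
  point of the decreasing map \<open>rcf a\<close> gives the bound by \<open>zeta\<close>; comparing
  the other one by contraction of \<open>fwd v\<close> gives the bound by \<open>eta\<close>. For
  the empty word the condition is 1 < \<alpha> (1 + \<alpha>), whence g.\<close>

lemma matches_Gam_int: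
  assumes "matches a t"
  shows "char_word a \<in> FF" "\<alpha> \<in> Gam_int (char_word a)"
proof -
  have a: "odd (length a)" "admissible a" "pos_list a" "\<alpha> = rcf a t" "- kap < t" "t < \<alpha>" "\<alpha> - 1 \<le> t"
    using assms by (auto simp: matches_def admissible_def)
  show "char_word a \<in> FF" using FF_iff_admissible a by blast
  have t: "t > -1" "1 / (1 + t) - 1 < \<alpha>" using matches_gt_minus_1[OF assms] gt_kap_iff[of t] a by auto
  show "\<alpha> \<in> Gam_int (char_word a)"
  proof (cases "char_word a = []")
    case True
    then have "a = [1]" using char_word_Nil_iff[OF a(1,3)] by simp
    then have al: "\<alpha> = 1 / (1 + t)" using a by simp
    then have "1 / \<alpha> < 1 + \<alpha>" using a by simp
    then have "1 < \<alpha> * (1 + \<alpha>)" using alpha_pos by (simp add: divide_less_eq mult.commute)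
    then have "5 < (2 * \<alpha> + 1)\<^sup>2" by (simp add: power2_eq_square algebra_simps)
    then have "sqrt 5 < 2 * \<alpha> + 1" using alpha_pos by (intro real_less_lsqrt) auto
    then show ?thesis using True alpha_le_1 by (simp add: Gam_int_def)
  next
    case False
    define v where "v = char_word a"
    note z = zeta_props[OF a(1,3)] and e = eta_props[OF a(1,3) False]
    have v: "v \<in> lists alph_neg" "v \<noteq> []" using char_word_neg[OF a(3)] False by (auto simp: v_def)
    have "zeta v < \<alpha>"
    proof (rule ccontr)
      assume "\<not> zeta v < \<alpha>"
      then have "t < zeta v" using a by simp
      then have "zeta v < \<alpha>" using rcf_less[OF a(3) t(1), of "zeta v"] z(2) a(1,4) by (simp add: v_def)
      with \<open>\<not> zeta v < \<alpha>\<close> show False by simp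
    qed
    moreover have "\<alpha> < eta v"
    proof (rule ccontr)
      assume ge: "\<not> \<alpha> < eta v"
      define t2 where "t2 = 1 / (1 + t) - 1"
      have t2: "t2 > -1" "t2 < \<alpha>" using t by (auto simp: t2_def)
      have ft: "fwd v t2 = \<alpha> - 1" using fwd_char_word[OF a(1,3) t(1)] a(4) by (simp add: v_def t2_def)
      have fe: "fwd v (eta v) = eta v - 1" "eta v > 0" using e by (auto simp: v_def)
      consider "t2 < eta v" | "t2 = eta v" | "t2 > eta v" by linarith
      then show False
      proof cases
        case 1
        then show False using fwd_neg_contract[OF v t2(1) 1] ft fe ge by simp
      next
        case 2
        then show False using ft fe t2 by simp
      next
        case 3
        then show False using fwd_neg_contract[OF v _ 3] ft fe t2 by simp
      qed
    qed
    ultimately show ?thesis using False by (simp add: Gam_int_def v_def)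
  qed
qed

text \<open>The map \<open>rcf a\<close> takes the value \<open>eta v\<close> at \<open>tau\<close>
  and \<open>zeta v\<close> at \<open>zeta v\<close>, so some t in between has the value \<alpha>.
  The strict bounds on \<alpha> then put both last points below \<alpha>.\<close>

lemma Gam_int_matches:
  assumes "v \<in> FF" "\<alpha> \<in> Gam_int v"
  shows "\<exists>a t. matches a t \<and> v = char_word a"
proof -
  define a where "a = char_seq v"
  have "v \<in> lists alph_neg" using assms by (simp add: FF_def)
  then have "is_char_seq v a" unfolding a_def char_seq_def by (rule theI'[OF ex1_char_seq])
  then have a: "odd (length a)" "pos_list a" "v = char_word a" by (auto simp: is_char_seq_def)
  have ne: "a \<noteq> []" using a by auto
  have adm: "admissible a" using FF_iff_admissible[OF a(1,2)] assms(1) a(3) by simp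
  show ?thesis
  proof (cases "v = []")
    case True
    then have a1: "a = [1]" using char_word_Nil_iff[OF a(1,2)] a(3) by simp
    define t where "t = 1 / \<alpha> - 1"
    have "(sqrt 5 - 1) / 2 < \<alpha>" using assms(2) True by (simp add: Gam_int_def)
    then have "sqrt 5 < 2 * \<alpha> + 1" by simp
    then have "(sqrt 5)\<^sup>2 < (2 * \<alpha> + 1)\<^sup>2" by (intro power_strict_mono) auto
    then have "1 < \<alpha> * (1 + \<alpha>)" by (simp add: power2_eq_square algebra_simps)
    then have "1 / \<alpha> < 1 + \<alpha>" using alpha_pos by (simp add: divide_less_eq mult.commute)
    then have "t < \<alpha>" "0 \<le> t" using alpha_pos alpha_le_1 by (auto simp: t_def)
    moreover have "rcf [1] t = \<alpha>" using alpha_pos by (simp add: t_def)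
    ultimately have "matches a t" unfolding matches_def a1 using adm a1 kap_bounds alpha_le_1 by auto
    then show ?thesis using a by blast
  next
    case False
    then have a1: "a \<noteq> [1]" using char_word_Nil_iff[OF a(1,2)] a(3) by simp
    have ze: "zeta v < \<alpha>" "\<alpha> < eta v" using assms(2) False by (auto simp: Gam_int_def)
    note z = zeta_props[OF a(1,2), folded a(3)] and e = eta_props[OF a(1,2), folded a(3), OF False]
    have v: "v \<in> lists alph_neg" "v \<noteq> []" using assms False by (auto simp: FF_def)
    define tau where "tau = 1 / (1 + eta v) - 1"
    have tau: "tau > -1" using e(1) by (simp add: tau_def)
    have rtau: "rcf a tau = eta v" using e(3) by (simp add: tau_def)
    have le: "tau \<le> zeta v"
    proof (rule ccontr)
      assume "\<not> tau \<le> zeta v"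
      then have "eta v < zeta v" using rcf_less[OF a(2), of "zeta v" tau] z a(1) rtau by simp
      then show False using ze by simp
    qed
    have "continuous_on {tau..zeta v} (rcf a)"
      by (rule continuous_on_subset[OF rcf_continuous_on[OF a(2)]]) (use tau in auto)
    then obtain t where t: "tau \<le> t" "t \<le> zeta v" "rcf a t = \<alpha>"
      using IVT2'[of "rcf a" "zeta v" \<alpha> tau] z(2) rtau ze le by auto
    have t1: "t > -1" using t tau by simp
    have tz: "t < \<alpha>" using t ze by simp
    define t2 where "t2 = 1 / (1 + t) - 1"
    have t2: "t2 > -1" using t1 by (simp add: t2_def)
    have ft: "fwd v t2 = \<alpha> - 1" using fwd_char_word[OF a(1,2) t1] t(3) a(3) by (simp add: t2_def)
    have "tau < t" using t rtau ze by (cases "tau = t") auto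
    then have "1 / (1 + t) < 1 / (1 + tau)" using tau by (intro frac_less2) auto
    then have "t2 < eta v" using e(1) by (simp add: t2_def tau_def)
    from fwd_neg_contract[OF v t2 this] have t2a: "t2 < \<alpha>" using ft e(2) by simp
    then have kt: "- kap < t" using gt_kap_iff[OF t1] by (simp add: t2_def)
    have hd: "hd a \<ge> 2" using admissible_hd_ge_2[OF adm a1 a(1)] .
    have range: "\<alpha> - 1 \<le> t" using end_range[OF a(2) ne hd _ kt] t(3) by simp
    \<comment> \<open>\<open>admissible_tails_ge\<close> requires a tail of at least 0. If t < 0,
      the other expansion \<open>conv a\<close> has the tail \<open>t2\<close> >= 0, and
      \<open>conv_tails\<close> carries the bounds back to a.\<close>
    have tails: "\<alpha> \<le> rcf (drop i a) t" if i: "i < length a" for i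
    proof (cases "t \<ge> 0")
      case True
      then show ?thesis using admissible_tails_ge[OF adm, of t i] i t(3) tz alpha_le_1 by simp
    next
      case False
      have t20: "t2 \<ge> 0" using False t1 by (simp add: t2_def)
      note lc = length_conv[OF ne a(2) a1]
      have val: "rcf (conv a) t2 = \<alpha>" using rcf_conv[OF ne a(2) a1 t1] t(3) by (simp add: t2_def)
      have tc: "\<alpha> \<le> rcf (drop j (conv a)) t2" if "j < length (conv a)" for j
        using admissible_tails_ge[OF admissible_conv[OF adm a1], of t2 j] that val t20 t2a alpha_le_1 by simp
      have "1 / (1 + t2) - 1 = t" using t1 by (simp add: t2_def)
      then show ?thesis
        using conv_tails[OF lc(3,2) conv_conv(2)[OF ne a(2) a1] t20 alpha_le_1 tc, of i] i
        by (simp add: conv_conv(1)[OF ne a(2) a1])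
    qed
    have "matches a t" unfolding matches_def using a adm t tz kt range tails by auto
    then show ?thesis using a by blast
  qed
qed

text \<open>t and 1/(1 + t) - 1 have opposite signs, so one of the two last points is nonnegative.
  Membership in \<open>Gam\<close> asks for an index of at least 1, which on the lower branch fails
  for the empty word only; there t >= 0.\<close>

lemma matches_Gam:
  assumes "matches a t"
  shows "\<alpha> \<in> Gam" "Gam_word \<alpha> = char_word a"
proof -
  show "Gam_word \<alpha> = char_word a"
    unfolding Gam_word_def
  proof (rule the_equality)
    show "char_word a \<in> FF \<and> \<alpha> \<in> Gam_int (char_word a)" using matches_Gam_int[OF assms] by blast
    fix v assume "v \<in> FF \<and> \<alpha> \<in> Gam_int v"
    then show "v = char_word a" using Gam_int_matches matches_unique assms by metis
  qed
  have a: "odd (length a)" "pos_list a" "\<alpha> = rcf a t" using assms by (auto simp: matches_def admissible_def)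
  have t: "t > -1" by (rule matches_gt_minus_1[OF assms])
  have ne: "a \<noteq> []" using a by auto
  obtain d r where up: "up_word a = (-1, Fin d) # r" using up_word_split[OF ne] by auto
  have "\<exists>n\<ge>1. (T \<alpha> ^^ n) (\<alpha> - 1) \<ge> 0 \<or> (T \<alpha> ^^ n) \<alpha> \<ge> 0"
  proof (cases "t \<ge> 0")
    case True
    then show ?thesis using matches_up(2)[OF assms up] up by (intro exI[of _ "length (up_word a)"]) auto
  next
    case False
    have "char_word a \<noteq> []"
    proof
      assume "char_word a = []"
      then have "a = [1]" using char_word_Nil_iff[OF a(1,2)] by simp
      then have "1 / \<alpha> = 1 + t" using a by simp
      moreover have "1 / \<alpha> \<ge> 1" using alpha_pos alpha_le_1 by simp
      ultimately show False using False by simp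
    qed
    then have "length (char_word a) \<ge> 1" by (cases "char_word a") auto
    moreover have "1 / (1 + t) - 1 \<ge> 0" using False t by simp
    ultimately show ?thesis using matches_lo(2)[OF assms] by (intro exI[of _ "length (char_word a)"]) auto
  qed
  then show "\<alpha> \<in> Gam" using alpha_pos alpha_le_1 by (simp add: Gam_def)
qed

text \<open>The points of both orbits have the form x = 1/(c + s) - 1 with c >= 1 and s a point of
  the Gauss orbit of \<alpha>. Writing x = 1/(1 + u) - 1 with u = (c - 1) + s >= \<alpha> shows x <=
  -\<open>kap\<close>.\<close>

lemma not_Gam_orbit:
  assumes ge: "\<And>n. \<alpha> \<le> (gauss ^^ n) \<alpha>"
  shows "(T \<alpha> ^^ j) (\<alpha> - 1) \<le> - kap" "1 \<le> j \<Longrightarrow> (T \<alpha> ^^ j) \<alpha> \<le> - kap"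
proof -
  define I where "I x \<longleftrightarrow> (\<exists>c n. c \<ge> 1 \<and> x = 1 / (real c + (gauss ^^ Suc n) \<alpha>) - 1 \<and> \<alpha> \<le> 1 / (real c + (gauss ^^ Suc n) \<alpha>))" for x
  have g: "0 < (gauss ^^ n) \<alpha>" for n using ge[of n] alpha_pos by linarith
  have I_kap: "x \<le> - kap" if "I x" for x
  proof -
    obtain c n where c: "c \<ge> 1" "x = 1 / (real c + (gauss ^^ Suc n) \<alpha>) - 1" using \<open>I x\<close> by (auto simp: I_def)
    define u where "u = (real c - 1) + (gauss ^^ Suc n) \<alpha>"
    have "real c \<ge> 1" using c by simp
    then have "\<alpha> \<le> u" using ge[of "Suc n"] by (simp add: u_def)
    moreover have "x = 1 / (1 + u) - 1" using c by (simp add: u_def)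
    ultimately show ?thesis using le_kap_iff[of u] alpha_pos by simp
  qed
  have I_start: "I ((gauss ^^ n) \<alpha> - 1)" for n
  proof -
    define u where "u = (gauss ^^ n) \<alpha>"
    have u: "0 < u" "u \<le> 1"
    proof -
      show "0 < u" using g by (simp add: u_def)
      show "u \<le> 1" using alpha_le_1 less_imp_le[OF gauss_range(2)] by (cases n) (auto simp: u_def)
    qed
    have "\<lfloor>1 / u\<rfloor> \<ge> 1" using gauss_digit_ge_1[OF u] .
    then obtain c :: nat where c: "\<lfloor>1 / u\<rfloor> = int c" "int c \<ge> 1" by (metis nonneg_int_cases order_trans zero_le_one)
    then have "u = 1 / (real c + (gauss ^^ Suc n) \<alpha>)" using gauss_rep(2)[of u] by (simp add: u_def)
    moreover have "\<alpha> \<le> u" using ge by (simp add: u_def)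
    ultimately show ?thesis unfolding I_def u_def[symmetric] using c by (intro exI[of _ c] exI[of _ n]) auto
  qed
  have I_T: "I (T \<alpha> x)" if "I x" for x
  proof -
    obtain c n where c: "c \<ge> 1" "x = 1 / (real c + (gauss ^^ Suc n) \<alpha>) - 1" "\<alpha> \<le> 1 / (real c + (gauss ^^ Suc n) \<alpha>)"
      using \<open>I x\<close> by (auto simp: I_def)
    define s where "s = (gauss ^^ Suc n) \<alpha>"
    have s: "0 < s" "s < 1" unfolding s_def by (rule g, simp add: gauss_range)
    show ?thesis
    proof (cases "c = 1")
      case True
      define b where "b = \<lfloor>1 / s\<rfloor>"
      have s': "1 / s = of_int b + gauss s" using gauss_rep(1)[of s] by (simp add: b_def)
      have gs: "gauss s = (gauss ^^ Suc (Suc n)) \<alpha>" by (simp add: s_def)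
      have x: "x = 1 / (1 + s) - 1" using c True by (simp add: s_def)
      have "of_int (2 + b) + (gauss s - 1) = 1 + 1 / s" using s' by simp
      note sum = this
      have "T \<alpha> x = gauss s - 1"
      proof (rule T_inverse_branch(2))
        show "x = of_int (-1) / (of_int (2 + b) + (gauss s - 1))"
          unfolding sum x using s by (simp add: divide_simps)
        show "0 < of_int (2 + b) + (gauss s - 1)" unfolding sum using s by (simp add: add_pos_pos)
        show "\<alpha> - 1 \<le> gauss s - 1" using ge[of "Suc (Suc n)"] unfolding gs by simp
        show "gauss s - 1 < \<alpha>" using gauss_range(2)[of s] alpha_pos by linarith
      qed simp
      then have "T \<alpha> x = (gauss ^^ Suc (Suc n)) \<alpha> - 1" unfolding gs .
      then show ?thesis using I_start by (simp only:)
    next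
      case False
      define m where "m = c - 1"
      have m: "m \<ge> 1" "real c = real m + 1" using c False by (auto simp: m_def)
      have p: "real m + s > 0" using s m by simp
      have "1 / (real c + s) \<le> 1 / (real m + s)" using p m by (intro frac_le) auto
      then have a: "\<alpha> \<le> 1 / (real m + s)" using c by (simp add: s_def)
      have "1 / (real m + s) \<le> 1" using m s by simp
      then have lt: "1 / (real m + s) - 1 < \<alpha>" using alpha_pos by linarith
      have "T \<alpha> x = 1 / (real m + s) - 1"
      proof (rule T_inverse_branch(2))
        show "x = of_int (-1) / (of_int 2 + (1 / (real m + s) - 1))"
          unfolding c(2) s_def[symmetric] m(2) using p by (simp add: divide_simps)
        have "0 < 1 / (real m + s)" using p by simp
        then show "0 < of_int 2 + (1 / (real m + s) - 1)" by linarith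
      qed (use a lt in auto)
      then show ?thesis unfolding I_def using a m by (intro exI[of _ m] exI[of _ n]) (simp add: s_def)
    qed
  qed
  have I_pow: "I ((T \<alpha> ^^ j) x)" if "I x" for j x by (induction j) (use that I_T in auto)
  show "(T \<alpha> ^^ j) (\<alpha> - 1) \<le> - kap" using I_kap I_pow I_start[of 0] by simp
  have "T \<alpha> \<alpha> = gauss \<alpha> - 1"
  proof (rule T_inverse_branch(2))
    define b where "b = \<lfloor>1 / \<alpha>\<rfloor>"
    have "1 / \<alpha> = of_int b + gauss \<alpha>" using gauss_rep(1)[of \<alpha>] by (simp add: b_def)
    then have "of_int (b + 1) + (gauss \<alpha> - 1) = 1 / \<alpha>" by simp
    then show "\<alpha> = of_int 1 / (of_int (\<lfloor>1 / \<alpha>\<rfloor> + 1) + (gauss \<alpha> - 1))" "0 < of_int (\<lfloor>1 / \<alpha>\<rfloor> + 1) + (gauss \<alpha> - 1)"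
      using alpha_pos unfolding b_def[symmetric] by auto
    show "\<alpha> - 1 \<le> gauss \<alpha> - 1" "gauss \<alpha> - 1 < \<alpha>" using ge[of 1] gauss_range(2)[of \<alpha>] alpha_pos by auto
  qed simp
  then have "I (T \<alpha> \<alpha>)" using I_start[of 1] by simp
  then show "1 \<le> j \<Longrightarrow> (T \<alpha> ^^ j) \<alpha> \<le> - kap"
    using I_kap I_pow[of "T \<alpha> \<alpha>" "j - 1"] by (cases j) (auto simp: funpow_Suc_right simp del: funpow.simps(2))
qed

end

subsection \<open>Reduction to the rational parameter\<close>

lemma prefix1_cong: "(\<And>i. 1 \<le> i \<Longrightarrow> i \<le> j \<Longrightarrow> b i = b' i) \<Longrightarrow> prefix1 b j = prefix1 b' j"
  unfolding prefix1_def by (intro map_cong) auto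

lemma languages_cong:
  assumes k: "k_lo \<alpha> = k_lo \<beta>" "k_up \<alpha> = k_up \<beta>" "enat 1 < k_up \<alpha>"
    and lo: "\<And>j. 1 \<le> j \<Longrightarrow> enat j < k_lo \<alpha> \<Longrightarrow> b_lo \<alpha> j = b_lo \<beta> j"
    and up: "\<And>j. 1 \<le> j \<Longrightarrow> enat j < k_up \<alpha> \<Longrightarrow> b_up \<alpha> j = b_up \<beta> j"
    and D: "d_int \<alpha> \<alpha> = d_int \<beta> \<beta>"
  shows "LL' \<alpha> = LL' \<beta>" "top_end \<alpha> = top_end \<beta>" "\<Psi> \<alpha> = \<Psi> \<beta>" "\<Psi>' \<alpha> = \<Psi>' \<beta>" "CC \<alpha> = CC \<beta>"
proof -
  have le: "enat i < k" if "enat j < k" "i \<le> j" for i j k using that by (meson enat_ord_simps(1) le_less_trans)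
  have plo: "prefix1 (b_lo \<alpha>) j = prefix1 (b_lo \<beta>) j" if "enat j < k_lo \<alpha>" for j
    using that lo le by (intro prefix1_cong) blast
  have pup: "prefix1 (b_up \<alpha>) j = prefix1 (b_up \<beta>) j" if "enat j < k_up \<alpha>" for j
    using that up le by (intro prefix1_cong) blast
  have plo': "prefix1 (b_lo \<alpha>) (j - 1) = prefix1 (b_lo \<beta>) (j - 1)" if "enat j < k_lo \<alpha>" for j
    using plo le[OF that, of "j - 1"] by simp
  have pup': "prefix1 (b_up \<alpha>) (j - 1) = prefix1 (b_up \<beta>) (j - 1)" if "enat j < k_up \<alpha>" for j
    using pup le[OF that, of "j - 1"] by simp
  have b1: "b_up \<alpha> 1 = b_up \<beta> 1" using up k(3) by simp
  have U1: "U1 \<alpha> = U1 \<beta>" unfolding U1_def k(1)[symmetric] by (intro Collect_cong ex_cong1) (use plo in auto)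
  have U2: "U2 \<alpha> = U2 \<beta>" unfolding U2_def k(2)[symmetric] by (intro Collect_cong ex_cong1) (use pup in auto)
  have U3: "U3 \<alpha> = U3 \<beta>" unfolding U3_def k(1)[symmetric] b1
    by (intro Collect_cong ex_cong1) (use plo' lo in auto)
  have U4: "U4 \<alpha> = U4 \<beta>" unfolding U4_def k(2)[symmetric] b1
    by (intro Collect_cong ex_cong1) (use pup' up in auto)
  have LL: "LL \<alpha> = LL \<beta>" by (simp add: LL_def U1 U2 U3 U4)
  show LL': "LL' \<alpha> = LL' \<beta>" by (simp add: LL'_def LL U1 U2)
  show top: "top_end \<alpha> = top_end \<beta>" by (simp add: top_end_def D)
  show Psi: "\<Psi> \<alpha> = \<Psi> \<beta>" by (simp add: \<Psi>_def LL top)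
  show Psi': "\<Psi>' \<alpha> = \<Psi>' \<beta>" by (simp add: \<Psi>'_def LL' top)
  have "{mobius_act (N (prefix1 (b_lo \<alpha>) j)) ` \<Psi> \<alpha> | j. 1 \<le> j \<and> enat j < k_lo \<alpha>}
      = {mobius_act (N (prefix1 (b_lo \<beta>) j)) ` \<Psi> \<beta> | j. 1 \<le> j \<and> enat j < k_lo \<beta>}"
    unfolding k(1)[symmetric] Psi by (intro Collect_cong ex_cong1) (use plo in auto)
  moreover have "{mobius_act (N (prefix1 (b_up \<alpha>) j)) ` \<Psi>' \<alpha> | j. 1 \<le> j \<and> enat j < k_up \<alpha>}
      = {mobius_act (N (prefix1 (b_up \<beta>) j)) ` \<Psi>' \<beta> | j. 1 \<le> j \<and> enat j < k_up \<beta>}"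
    unfolding k(2)[symmetric] Psi' by (intro Collect_cong ex_cong1) (use pup in auto)
  ultimately show "CC \<alpha> = CC \<beta>" unfolding CC_def Psi by simp
qed

context alpha_expansion
begin

text \<open>Both orbits stay negative, so the parameter is outside \<open>Gam\<close>, k and k' are
  infinite, and the requirements on last states are vacuous.\<close>

lemma not_Gam_good:
  assumes "\<And>n. \<alpha> \<le> (gauss ^^ n) \<alpha>"
  shows "alpha_good \<alpha>" "alpha_final \<alpha>"
proof -
  note orbit = not_Gam_orbit[OF assms]
  have "\<alpha> \<notin> Gam"
  proof
    assume "\<alpha> \<in> Gam"
    then obtain n where "n \<ge> 1" "(T \<alpha> ^^ n) (\<alpha> - 1) \<ge> 0 \<or> (T \<alpha> ^^ n) \<alpha> \<ge> 0" by (auto simp: Gam_def)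
    then show False using orbit(1)[of n] orbit(2)[of n] kap_bounds(1) by linarith
  qed
  then have k: "k_lo \<alpha> = \<infinity>" "k_up \<alpha> = \<infinity>" by (auto simp: k_lo_def k_up_def)
  interpret S: alpha_struct \<alpha> by unfold_locales (use orbit k in auto)
  have kl: "klen c = \<infinity>" for c using k by (simp add: klen_def)
  show "alpha_good \<alpha>" by unfold_locales (simp add: kl)
  show "alpha_final \<alpha>" by unfold_locales (simp_all add: kl)
qed

lemma matches_struct:
  assumes "matches a t"
  shows "alpha_struct \<alpha>" "klen False = enat (Suc (length (char_word a)))" "klen True = enat (Suc (length (up_word a)))"
proof -
  have a: "odd (length a)" "pos_list a" using assms by (auto simp: matches_def admissible_def)
  have ne: "a \<noteq> []" using a by auto
  obtain d r where up: "up_word a = (-1, Fin d) # r" using up_word_split[OF ne] by auto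
  note G = matches_Gam[OF assms]
  have k: "k_lo \<alpha> = enat (Suc (length (char_word a)))" "k_up \<alpha> = enat (Suc (length (up_word a)))"
    using G char_seq_char_word[OF a] by (auto simp: k_lo_def k_up_def hat_def length_up_word)
  then show "klen False = enat (Suc (length (char_word a)))" "klen True = enat (Suc (length (up_word a)))"
    by (auto simp: klen_def)
  show "alpha_struct \<alpha>"
  proof unfold_locales
    show "1 \<le> k_lo \<alpha>" using k by (simp add: one_enat_def)
    show "2 \<le> k_up \<alpha>" using k up by (simp add: numeral_eq_enat)
  qed (use k matches_lo(3)[OF assms] matches_up(3)[OF assms up] in auto)
qed

lemma matches_letters:
  assumes "matches a t" "up_word a = (-1, Fin d) # r"
  shows "\<And>j. 1 \<le> j \<Longrightarrow> enat j < k_lo \<alpha> \<Longrightarrow> b_lo \<alpha> j = char_word a ! (j - 1)"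
    "\<And>j. 1 \<le> j \<Longrightarrow> enat j < k_up \<alpha> \<Longrightarrow> b_up \<alpha> j = ((1, Fin (d - 1)) # r) ! (j - 1)" "D = d - 1"
proof -
  note k = matches_struct(2,3)[OF assms(1)]
  show "b_lo \<alpha> j = char_word a ! (j - 1)" if "1 \<le> j" "enat j < k_lo \<alpha>" for j
    using itin_nth[of "j - 1" "length (char_word a)" \<alpha> "\<alpha> - 1"] that k matches_lo(1)[OF assms(1)]
    by (auto simp: b_lo_def klen_def)
  show "b_up \<alpha> j = ((1, Fin (d - 1)) # r) ! (j - 1)" if "1 \<le> j" "enat j < k_up \<alpha>" for j
    using itin_nth[of "j - 1" "length (up_word a)" \<alpha> \<alpha>] that k matches_up(1)[OF assms]
    by (auto simp: b_up_def klen_def)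
  show "D = d - 1" using matches_up(1)[OF assms] letter_alpha assms(2) by (simp add: itin_Suc')
qed

text \<open>The parameter \<open>rcf a 0\<close> lies in the same matching interval, has the same languages, and
  there both orbits end in \<open>0\<close>.\<close>

lemma matches_pseudocenter:
  assumes "matches a t"
  shows "alpha_expansion (rcf a 0)" "alpha_expansion.matches (rcf a 0) a 0"
proof -
  have a: "odd (length a)" "admissible a" "pos_list a" "a \<noteq> []" using assms by (auto simp: matches_def admissible_def)
  have r: "0 < rcf a 0" "rcf a 0 \<le> 1" using rcf_pos[of a 0] rcf_range[of a 0] a by auto
  then show "alpha_expansion (rcf a 0)" by unfold_locales
  then interpret R: alpha_expansion "rcf a 0" .
  show "R.matches a 0"
    unfolding R.matches_def using a r R.kap_bounds(1) admissible_tails_ge[OF a(2), of 0] by auto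
qed

text \<open>For t = 0 both branches end in 0, the fixed point of t -> 1/(1 + t) - 1.\<close>

lemma matches_good:
  assumes "matches a 0"
  shows "alpha_good \<alpha>"
proof -
  note S = matches_struct[OF assms]
  interpret S: alpha_struct \<alpha> by (rule S(1))
  have ne: "a \<noteq> []" using assms by (auto simp: matches_def admissible_def)
  obtain d r where up: "up_word a = (-1, Fin d) # r" using up_word_split[OF ne] by auto
  show ?thesis
  proof unfold_locales
    fix j c assume "enat j < klen c" "\<not> enat (Suc j) < klen c"
    then show "orb c j = 0"
      using S matches_lo(2)[OF assms] matches_up(2)[OF assms up] by (cases c) (auto simp: orb_def not_less_less_Suc_eq)
  qed
qed

text \<open>This is \<open>bwd_dual\<close> with z = s/(1 - s), the action of the transpose of E.
  The first letter of \<open>up_word\<close> acts on 1 - z as its W-partner, the first letter of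
  \<alpha>, acts on z.\<close>

lemma matches_dual:
  assumes "matches a t" "s \<in> {0..1/2}"
  shows "1 - bwd (prefix1 (b_lo \<alpha>) (length (char_word a))) s = bwd (prefix1 (b_up \<alpha>) (length (up_word a))) (s / (1 - s))"
proof -
  have a: "odd (length a)" "pos_list a" "a \<noteq> []" using assms by (auto simp: matches_def admissible_def)
  obtain d r where up: "up_word a = (-1, Fin d) # r" using up_word_split[OF a(3)] by auto
  define z where "z = s / (1 - s)"
  have z: "0 \<le> z" "z / (1 + z) = s" using assms(2) by (auto simp: z_def field_simps)
  have "1 - bwd (char_word a) s = bwd (up_word a) (1 - z)" using bwd_dual[OF a(1,2) z(1)] z(2) by simp
  also have "\<dots> = bwd ((1, Fin (d - 1)) # r) z" by (simp add: up algebra_simps)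
  finally show ?thesis using matches_lo(1)[OF assms(1)] matches_up(1)[OF assms(1) up]
    by (simp add: prefix1_b_lo prefix1_b_up z_def)
qed

text \<open>Since \<open>\<Psi>' \<alpha>\<close> is the image of \<open>\<Psi> \<alpha>\<close>
  under s -> s/(1 - s), \<open>matches_dual\<close> says that y -> 1 - y exchanges the fibres of the
  two last states, and both fibres lie in \<open>\<Psi>' \<alpha>\<close>.\<close>

lemma matches_final:
  assumes "matches a t" "\<Psi>' \<alpha> = mobius_act (transpose E_mat) ` \<Psi> \<alpha>" "\<Psi> \<alpha> \<subseteq> {0..1/2}"
  shows "alpha_final \<alpha>"
proof -
  note S = matches_struct[OF assms(1)]
  interpret S: alpha_struct \<alpha> by (rule S(1))
  have a: "a \<noteq> []" using assms by (auto simp: matches_def admissible_def)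
  obtain d r where up: "up_word a = (-1, Fin d) # r" using up_word_split[OF a] by auto
  have t: "t > -1" by (rule matches_gt_minus_1[OF assms(1)])
  have t': "- kap < t" "t < \<alpha>" using assms(1) unfolding matches_def by blast+
  define n m where "n = length (char_word a)" and "m = length (up_word a)"
  have nm: "enat n < klen False" "enat m < klen True" "1 \<le> m" using S up by (auto simp: n_def m_def)
  have lo: "S.fibre False n = bwd (prefix1 (b_lo \<alpha>) n) ` \<Psi> \<alpha>"
    using S.image_fibre_lo[OF nm(1)] S.mobius_image_eq[OF S.prefix1_lo_proper[OF nm(1)] S.fibre_subset]
    by (simp add: S.Psi_eq)
  have up_eq: "S.fibre True m = bwd (prefix1 (b_up \<alpha>) m) ` \<Psi>' \<alpha>"
    using S.image_fibre_up[OF nm(2,3)] S.mobius_image_eq[OF S.prefix1_up_proper[OF nm(2)] S.Psi'_subset] by simp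
  note dual = matches_dual[OF assms(1), folded n_def m_def]
  have tE: "mobius_act (transpose E_mat) s = s / (1 - s)" for s by (rule mobius_act_tE)
  show ?thesis
  proof unfold_locales
    fix j c assume "enat j < klen c" "\<not> enat (Suc j) < klen c"
    then show "orb c j > - kap"
      using S matches_lo(2)[OF assms(1)] matches_up(2)[OF assms(1) up] t t' le_kap_iff[of t]
      by (cases c) (auto simp: orb_def not_less_less_Suc_eq)
  next
    fix j c y assume *: "enat j < klen c" "\<not> enat (Suc j) < klen c" "y \<in> S.fibre c j"
    show "1 - y \<in> \<Psi>' \<alpha>"
    proof (cases c)
      case True
      then have "j = m" using * S(3) by (simp add: m_def)
      then obtain z where z: "z \<in> \<Psi>' \<alpha>" "y = bwd (prefix1 (b_up \<alpha>) m) z" using * True up_eq by auto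
      then obtain s where s: "s \<in> \<Psi> \<alpha>" "z = s / (1 - s)" using assms(2) tE by auto
      then have "1 - y = bwd (prefix1 (b_lo \<alpha>) n) s" using dual[of s] assms(3) z by auto
      then have "1 - y \<in> S.fibre False n" using s lo by simp
      then show ?thesis using S.fibre_subset_Psi' by blast
    next
      case False
      then have "j = n" using * S(2) by (simp add: n_def)
      then obtain s where s: "s \<in> \<Psi> \<alpha>" "y = bwd (prefix1 (b_lo \<alpha>) n) s" using * False lo by auto
      then have "1 - y = bwd (prefix1 (b_up \<alpha>) m) (s / (1 - s))" using dual[of s] assms(3) by auto
      moreover have "s / (1 - s) \<in> \<Psi>' \<alpha>" using s assms(2) tE by auto
      ultimately have "1 - y \<in> S.fibre True m" using up_eq by simp
      then show ?thesis using S.fibre_subset_Psi' by blast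
    qed
  qed
qed

text \<open>If no Gauss iterate falls below \<alpha>, the parameter is its own twin. Otherwise the
  twin is \<open>rcf a 0\<close>, and the relation by E proved there is the input that
  \<open>matches_final\<close> requires at \<alpha>.\<close>

lemma final_and_good_twin:
  "\<exists>\<beta>. alpha_good \<beta> \<and> alpha_final \<alpha> \<and> LL' \<alpha> = LL' \<beta> \<and> top_end \<alpha> = top_end \<beta> \<and> \<Psi> \<alpha> = \<Psi> \<beta> \<and> \<Psi>' \<alpha> = \<Psi>' \<beta> \<and> CC \<alpha> = CC \<beta>"
proof (cases "\<exists>m. (gauss ^^ m) \<alpha> < \<alpha>")
  case False
  then have "\<alpha> \<le> (gauss ^^ n) \<alpha>" for n by (meson not_le)
  then show ?thesis using not_Gam_good by blast
next
  case True
  then obtain a t where m: "matches a t" using matches_exists by blast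
  have ne: "a \<noteq> []" using m by (auto simp: matches_def admissible_def)
  obtain d r where up: "up_word a = (-1, Fin d) # r" using up_word_split[OF ne] by auto
  define \<beta> where "\<beta> = rcf a 0"
  interpret R: alpha_expansion \<beta> using matches_pseudocenter(1)[OF m] by (simp add: \<beta>_def)
  have mR: "R.matches a 0" using matches_pseudocenter(2)[OF m] by (simp add: \<beta>_def)
  interpret G: alpha_good \<beta> using R.matches_good[OF mR] .
  note k = matches_struct(2,3)[OF m] and kR = R.matches_struct(2,3)[OF mR]
  note l = matches_letters[OF m up] and lR = R.matches_letters[OF mR up]
  have ke: "k_lo \<alpha> = k_lo \<beta>" "k_up \<alpha> = k_up \<beta>" using k kR by (auto simp: klen_def R.klen_def)
  have "enat 1 < k_up \<alpha>" using k up by (simp add: klen_def)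
  then have eq: "LL' \<alpha> = LL' \<beta>" "top_end \<alpha> = top_end \<beta>" "\<Psi> \<alpha> = \<Psi> \<beta>" "\<Psi>' \<alpha> = \<Psi>' \<beta>" "CC \<alpha> = CC \<beta>"
    using languages_cong[of \<alpha> \<beta>] ke l lR by auto
  have "alpha_final \<alpha>" by (rule matches_final[OF m]) (use G.tE_Psi G.Psi_subset eq in auto)
  then show ?thesis using eq G.alpha_good_axioms by blast
qed

end

theorem theorem7:
  fixes \<alpha> :: real
  assumes "0 < \<alpha>" and "\<alpha> \<le> 1"
  shows
    "\<Omega> \<alpha> =
       II \<alpha> \<times> \<Psi> \<alpha>
       \<union> closure (\<Union>j \<in> {j. 1 \<le> j \<and> enat j < k_lo \<alpha>}.
           {(T \<alpha> ^^ j) (\<alpha> - 1)..\<alpha>} \<times> mobius_act (N (prefix1 (b_lo \<alpha>) j)) ` \<Psi> \<alpha>)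
       \<union> closure (\<Union>j \<in> {j. 1 \<le> j \<and> enat j < k_up \<alpha>}.
           {(T \<alpha> ^^ j) \<alpha>..\<alpha>} \<times> mobius_act (N (prefix1 (b_up \<alpha>) j)) ` \<Psi>' \<alpha>)
     \<and>
     (\<exists>f :: real \<Rightarrow> real. f \<in> borel_measurable borel \<and> (\<forall>t. f t \<ge> 0) \<and>
        \<nu> \<alpha> = density lborel (\<lambda>t. ennreal (f t)) \<and>
        (\<forall>x x'.
           (\<forall>j. enat j < k_lo \<alpha> \<longrightarrow> (T \<alpha> ^^ j) (\<alpha> - 1) \<notin> {x<..<x'}) \<and>
           (\<forall>j. enat j < k_up \<alpha> \<longrightarrow> (T \<alpha> ^^ j) \<alpha> \<notin> {x<..<x'})
           \<longrightarrow> continuous_on {x<..<x'} f))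
     \<and>
     (\<forall>Y \<in> CC \<alpha>. Y \<inter> closure (\<Union>(CC \<alpha> - {Y})) \<in> null_sets lebesgue)
     \<and>
     closure (\<Union>(CC \<alpha>)) = \<Psi>' \<alpha> \<and> \<Psi>' \<alpha> = mobius_act (transpose E_mat) ` \<Psi> \<alpha>
     \<and>
     (\<forall>w \<in> LL' \<alpha>.
        mobius_act (N w) ` {0<..<top_end \<alpha>}
        \<inter> closure (\<Union>w' \<in> LL' \<alpha> - {w}. mobius_act (N w') ` {0..top_end \<alpha>}) = {})"
proof -
  interpret A: alpha_expansion \<alpha> by unfold_locales (use assms in auto)
  obtain \<beta> where \<beta>: "alpha_good \<beta>" "alpha_final \<alpha>" "LL' \<alpha> = LL' \<beta>" "top_end \<alpha> = top_end \<beta>"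
    "\<Psi> \<alpha> = \<Psi> \<beta>" "\<Psi>' \<alpha> = \<Psi>' \<beta>" "CC \<alpha> = CC \<beta>"
    using A.final_and_good_twin by blast
  interpret F: alpha_final \<alpha> by (rule \<beta>(2))
  interpret G: alpha_good \<beta> by (rule \<beta>(1))
  have "\<forall>Y \<in> CC \<alpha>. Y \<inter> closure (\<Union>(CC \<alpha> - {Y})) \<in> null_sets lebesgue"
    using G.CC_null \<beta>(7) by simp
  moreover have "\<Psi>' \<alpha> = mobius_act (transpose E_mat) ` \<Psi> \<alpha>" using G.tE_Psi \<beta>(5,6) by simp
  moreover have "\<forall>w \<in> LL' \<alpha>. mobius_act (N w) ` {0<..<top_end \<alpha>}
        \<inter> closure (\<Union>w' \<in> LL' \<alpha> - {w}. mobius_act (N w') ` {0..top_end \<alpha>}) = {}"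
    using G.cells_separated \<beta>(3,4) by simp
  ultimately show ?thesis
    using F.Omega_formula F.nu_density F.closure_Union_CC by blast
qed

end
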